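(* Let $D\subset\mathbb{C}^n$ be an open invariant set and let $f\in\mathcal{S}(\Omega_D)$. Then $f\in\mathcal{SR}(\Omega_D)$ if and only if $\mathcal{S}^{\llbracket m\rrbracket}_K(f)\in\mathcal{SR}_{m+1}(\Omega_D)$ for every $m=0,\dots,n-1$ and every $K\in\mathcal{P}(m)$. In that case, for these $m$ and $K$, one can write $$\mathcal{S}^{\llbracket m\rrbracket}_K(f)=(-1)^m\,\overline{\partial}_{x_m}\Big(x_m^{\chi_K(m)}\cdots\overline{\partial}_{x_1}\big(x_1^{\chi_K(1)}f\big)\cdots\Big),$$ where $\chi_K$ is the characteristic function of $K$ and the products are pointwise.
   Context: Sets and products. $\mathbb{H}$ denotes the quaternions, $\mathbb{S}_\mathbb{H}=\{J\in\mathbb{H}: J^2=-1\}$, $\mathcal{P}(m)$ is the power set of $\llbracket m\rrbracket:=\{1,\dots,m\}$, $\llbracket0\rrbracket=\emptyset$. For $K=\{k_1<\dots<k_p\}$ and quaternions $q_k$, $q_K:=q_{k_1}\cdots q_{k_p}$ (increasing order), $q_\emptyset:=1$. For $z\in\mathbb{C}^n$ write $z_h=\alpha_h+i\beta_h$ with $\alpha_h,\beta_h\in\mathbb{R}$, and let $\overline z^h$ be $z$ with $z_h$ replaced by $\overline{z_h}$. Stem and slice functions. $D\subset\mathbb{C}^n$ is invariant if $z\in D\iff\overline z^h\in D$ for all $h$. Let $\{e_K\}_{K\in\mathcal{P}(n)}$ be a basis of $\mathbb{R}^{2^n}$, $e_\emptyset=1$, $e_h:=e_{\{h\}}$. A stem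 function on $D$ is a continuous $F=\sum_{K\in\mathcal{P}(n)}e_KF_K:D\to\mathbb{H}\otimes\mathbb{R}^{2^n}$ ($F_K$ $\mathbb{H}$-valued) with $F_K(\overline z^h)=(-1)^{|K\cap\{h\}|}F_K(z)$ for all $K,h$. The circularization of $D$ is $\Omega_D=\{(\alpha_1+J_1\beta_1,\dots,\alpha_n+J_n\beta_n): (\alpha_1+i\beta_1,\dots,\alpha_n+i\beta_n)\in D,\ J_1,\dots,J_n\in\mathbb{S}_\mathbb{H}\}$. $F$ induces the slice function $f=\mathcal{I}(F):\Omega_D\to\mathbb{H}$, $f(x)=\sum_{K}J_KF_K(z)$ for $x=(\alpha_h+J_h\beta_h)_h$, $z=(\alpha_h+i\beta_h)_h$; the stem function $F$ is determined by $f$. $\mathcal{S}(\Omega_D)$ is the set of slice functions on $\Omega_D$. Product: $(F\otimes G)(z)=\sum_{H,K}(-1)^{|H\cap K|}e_{K\Delta H}F_K(z)G_H(z)$ ($\Delta$ = symmetric difference) and $\mathcal{I}(F)\odot\mathcal{I}(G):=\mathcal{I}(F\otimes G)$. The coordinate function $x_j$ is the slice function induced by $Z_j(z)=\alpha_j+e_j\beta_j$; $x_K$ is the ordered product of the $x_k$, $k\in K$. Regularity. $\mathcal{J}_h(q\otimes e_K)=(-1)^{|K\cap\{h\}|}q\otimes e_{K\Delta\{h\}}$ and $\overline\partial_h=\frac12(\partial/\partial\alpha_h+\mathcal{J}_h\,\partial/\partial\beta_h)$. A $C^1$ stem function $F$ is holomorphic if $\overline\partial_hF=0$ for every $h=1,\dots,n$;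 $f=\mathcal{I}(F)$ is slice regular if $F$ is holomorphic. $\mathcal{SR}(\Omega_D)$ is the set of slice regular functions. A function $f\in\mathcal{S}(\Omega_D)$ is slice regular w.r.t. $x_h$, written $f\in\mathcal{SR}_h(\Omega_D)$, if for every $y\in\Omega_D$ the function $x\mapsto f(y_1,\dots,y_{h-1},x,y_{h+1},\dots,y_n)$, defined for those $x\in\mathbb{H}$ for which the argument lies in $\Omega_D$, is a slice regular function of one quaternionic variable, i.e. there are $C^1$ functions $G_0,G_1:E\to\mathbb{H}$ on the conjugation-invariant set $E=\{\alpha+i\beta\in\mathbb{C}: (y_1,\dots,y_{h-1},\alpha+J\beta,y_{h+1},\dots,y_n)\in\Omega_D\ \forall J\in\mathbb{S}_\mathbb{H}\}$ with $G_0(\overline w)=G_0(w)$, $G_1(\overline w)=-G_1(w)$, $\frac{\partial G_0}{\partial\alpha}=\frac{\partial G_1}{\partial\beta}$, $\frac{\partial G_0}{\partial\beta}=-\frac{\partial G_1}{\partial\alpha}$, such that the function takes the value $G_0(\alpha+i\beta)+J\,G_1(\alpha+i\beta)$ at $x=\alpha+J\beta$ for all $\alpha+i\beta\in E$ and $J\in\mathbb{S}_\mathbb{H}$. Spherical derivatives and components. For $H\in\mathcal{P}(n)$ let $H^c=\{1,\dots,n\}\setminus H$, $D_H=\{z\in D:\beta_h\ne0\ \forall h\in H\}$, $\Omega_{D_H}$ its circularization, and for $f=\mathcal{I}(F)\in\mathcal{S}(\Omega_D)$ let $f'_{s,H}=\mathcal{I}(F'_H)\in\mathcal{S}(\Omega_{D_H})$,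 where $F'_H(z)=\big(\prod_{h\in H}\beta_h\big)^{-1}\sum_{K\subset H^c}e_KF_{K\cup H}(z)$. For $K\subset\llbracket m\rrbracket$ define $\mathcal{S}^{\llbracket m\rrbracket}_K(f):=(x_K\odot f)'_{s,\llbracket m\rrbracket}$ on $\Omega_{D_{\llbracket m\rrbracket}}$; in particular $\mathcal{S}^{\llbracket0\rrbracket}_\emptyset(f)=f$. "$\mathcal{S}^{\llbracket m\rrbracket}_K(f)\in\mathcal{SR}_{m+1}(\Omega_D)$" means that $\mathcal{S}^{\llbracket m\rrbracket}_K(f)$ is the restriction of a (necessarily unique) element of $\mathcal{SR}_{m+1}(\Omega_D)$; that extension is denoted by the same symbol. Writing $x_h=\alpha_h+i\beta_h+j\gamma_h+k\delta_h$ in real coordinates, $\overline\partial_{x_h}=\frac12\left(\frac{\partial}{\partial\alpha_h}+i\frac{\partial}{\partial\beta_h}+j\frac{\partial}{\partial\gamma_h}+k\frac{\partial}{\partial\delta_h}\right)$. *)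

theory Defs
  imports "HOL-Analysis.Analysis"
begin

section \<open>Quaternions\<close>

datatype quat = Quat (quat_re: real) (quat_i: real) (quat_j: real) (quat_k: real)

lemma quat_eq_iff:
  "p = q \<longleftrightarrow> quat_re p = quat_re q \<and> quat_i p = quat_i q \<and> quat_j p = quat_j q \<and> quat_k p = quat_k q"
  by (cases p; cases q) simp

instantiation quat :: real_normed_div_algebra
begin

definition "0 = Quat 0 0 0 0"
definition "1 = Quat 1 0 0 0"
definition "p + q = Quat (quat_re p + quat_re q) (quat_i p + quat_i q)
                         (quat_j p + quat_j q) (quat_k p + quat_k q)"
definition "- p = Quat (- quat_re p) (- quat_i p) (- quat_j p) (- quat_k p)"
definition "p - q = p + (- q :: quat)"
definition "r *\<^sub>R p = Quat (r * quat_re p) (r * quat_i p) (r * quat_j p) (r * quat_k p)"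
definition "p * q = Quat
  (quat_re p * quat_re q - quat_i p * quat_i q - quat_j p * quat_j q - quat_k p * quat_k q)
  (quat_re p * quat_i q + quat_i p * quat_re q + quat_j p * quat_k q - quat_k p * quat_j q)
  (quat_re p * quat_j q - quat_i p * quat_k q + quat_j p * quat_re q + quat_k p * quat_i q)
  (quat_re p * quat_k q + quat_i p * quat_j q - quat_j p * quat_i q + quat_k p * quat_re q)"
definition "norm p = sqrt ((quat_re p)\<^sup>2 + (quat_i p)\<^sup>2 + (quat_j p)\<^sup>2 + (quat_k p)\<^sup>2)"
definition "inverse p = inverse ((norm p)\<^sup>2) *\<^sub>R
  Quat (quat_re p) (- quat_i p) (- quat_j p) (- quat_k p)"
definition "p div q = p * inverse (q :: quat)"
definition "sgn p = inverse (norm p) *\<^sub>R (p :: quat)"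
definition "dist p q = norm (p - q :: quat)"
definition "(uniformity :: (quat \<times> quat) filter) =
  (INF e\<in>{0 <..}. principal {(p, q). dist p q < e})"
definition "open (U :: quat set) \<longleftrightarrow>
  (\<forall>p\<in>U. eventually (\<lambda>(p', q). p' = p \<longrightarrow> q \<in> U) uniformity)"

lemmas quat_arith_defs = zero_quat_def one_quat_def plus_quat_def uminus_quat_def
  minus_quat_def scaleR_quat_def times_quat_def quat_eq_iff

lemma norm_quat_eq:
  "norm p = norm (Complex (quat_re p) (quat_i p), Complex (quat_j p) (quat_k p))"
  by (simp add: norm_quat_def norm_prod_def cmod_def add.assoc)

lemma norm_quat_sq:
  "(norm p)\<^sup>2 = (quat_re p)\<^sup>2 + (quat_i p)\<^sup>2 + (quat_j p)\<^sup>2 + (quat_k p)\<^sup>2"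
  by (simp add: norm_quat_def)

instance
proof
  fix p q s :: quat and a b :: real
  show "p + q + s = p + (q + s)" "p + q = q + p" "0 + p = p" "- p + p = 0" "p - q = p + - q"
    by (simp_all add: quat_arith_defs)
  show "a *\<^sub>R (p + q) = a *\<^sub>R p + a *\<^sub>R q" "(a + b) *\<^sub>R p = a *\<^sub>R p + b *\<^sub>R p"
    "a *\<^sub>R b *\<^sub>R p = (a * b) *\<^sub>R p" "1 *\<^sub>R p = p"
    by (simp_all add: quat_arith_defs algebra_simps)
  show "p * q * s = p * (q * s)" "(p + q) * s = p * s + q * s" "p * (q + s) = p * q + p * s"
    "a *\<^sub>R p * q = a *\<^sub>R (p * q)" "p * a *\<^sub>R q = a *\<^sub>R (p * q)"
    by (simp_all add: quat_arith_defs algebra_simps)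
  show "1 * p = p" "p * 1 = p" "(0 :: quat) \<noteq> 1"
    by (simp_all add: quat_arith_defs)
  show norm0: "(norm p = 0) = (p = 0)" for p :: quat
    by (auto simp: norm_quat_eq zero_quat_def quat_eq_iff zero_prod_def complex_eq_iff)
  show "norm (p + q) \<le> norm p + norm q"
    unfolding norm_quat_eq
    by (rule order_trans[OF _ norm_triangle_ineq]) (simp add: plus_quat_def plus_prod_def plus_complex.code)
  show "norm (a *\<^sub>R p) = \<bar>a\<bar> * norm p"
    by (simp add: norm_quat_def scaleR_quat_def power_mult_distrib distrib_left [symmetric]
        real_sqrt_mult)
  show "norm (p * q) = norm p * norm q"
    by (simp add: norm_quat_def times_quat_def real_sqrt_mult [symmetric])
       (simp add: power2_eq_square algebra_simps)
  show "inverse p * p = 1" if "p \<noteq> 0"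
  proof -
    have nz: "(norm p)\<^sup>2 \<noteq> 0" using that norm0 by simp
    have "inverse p * p = inverse ((norm p)\<^sup>2) *\<^sub>R Quat ((norm p)\<^sup>2) 0 0 0"
      unfolding norm_quat_sq
      by (simp add: inverse_quat_def norm_quat_sq times_quat_def scaleR_quat_def)
         (simp add: power2_eq_square algebra_simps)
    with nz show ?thesis by (simp add: scaleR_quat_def one_quat_def)
  qed
  show "p * inverse p = 1" if "p \<noteq> 0"
  proof -
    have nz: "(norm p)\<^sup>2 \<noteq> 0" using that norm0 by simp
    have "p * inverse p = inverse ((norm p)\<^sup>2) *\<^sub>R Quat ((norm p)\<^sup>2) 0 0 0"
      unfolding norm_quat_sq
      by (simp add: inverse_quat_def norm_quat_sq times_quat_def scaleR_quat_def)
         (simp add: power2_eq_square algebra_simps)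
    with nz show ?thesis by (simp add: scaleR_quat_def one_quat_def)
  qed
  show "inverse (0 :: quat) = 0"
    by (simp add: inverse_quat_def zero_quat_def scaleR_quat_def)
qed (rule divide_quat_def sgn_quat_def dist_quat_def open_quat_def uniformity_quat_def)+

end

definition imag_units :: "quat set" where
  "imag_units = {J. J\<^sup>2 = -1}"

section \<open>Index set and coordinates\<close>

text \<open>
  The index set $\{1,\dots,n\}$ is an arbitrary nonempty finite linearly ordered type
  \<open>'n\<close> with \<open>n = CARD('n)\<close>; \<open>idx k\<close> is its \<open>k\<close>-th element in increasing order
  (meaningful for \<open>1 \<le> k \<le> n\<close>).
\<close>

definition idx :: "nat \<Rightarrow> 'n::{finite,linorder}" where
  "idx k = sorted_list_of_set (UNIV :: 'n set) ! (k - 1)"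

definition seg :: "nat \<Rightarrow> 'n::{finite,linorder} set" where
  "seg m = idx ` {1..m}"

definition ordered_prod :: "'n::{finite,linorder} set \<Rightarrow> ('n \<Rightarrow> quat) \<Rightarrow> quat" where
  "ordered_prod K q = prod_list (map q (sorted_list_of_set K))"

definition vec_upd :: "'a ^ 'n \<Rightarrow> 'n \<Rightarrow> 'a \<Rightarrow> 'a ^ 'n::finite" where
  "vec_upd z h w = (\<chi> k. if k = h then w else z $ k)"

type_synonym 'n cvec = "(complex, 'n) vec"
type_synonym 'n qvec = "(quat, 'n) vec"

definition conj_at :: "'n \<Rightarrow> 'n cvec \<Rightarrow> 'n::finite cvec" where
  "conj_at h z = vec_upd z h (cnj (z $ h))"

definition invariant_set :: "'n::finite cvec set \<Rightarrow> bool" where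
  "invariant_set D \<longleftrightarrow> (\<forall>z h. z \<in> D \<longleftrightarrow> conj_at h z \<in> D)"

definition slice_point :: "complex \<Rightarrow> quat \<Rightarrow> quat" where
  "slice_point w J = of_real (Re w) + J * of_real (Im w)"

definition slice_vec :: "'n cvec \<Rightarrow> ('n \<Rightarrow> quat) \<Rightarrow> 'n::finite qvec" where
  "slice_vec z J = (\<chi> h. slice_point (z $ h) (J h))"

definition circularization :: "'n::finite cvec set \<Rightarrow> 'n qvec set" where
  "circularization D = {slice_vec z J | z J. z \<in> D \<and> (\<forall>h. J h \<in> imag_units)}"

section \<open>Stem functions and slice functions\<close>

text \<open>
  $\mathbb{H}\otimes\mathbb{R}^{2^n}$ is \<open>quat ^ 'n set\<close>: the element $\sum_K e_K q_K$ is the vector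
  with coordinates \<open>q\<^sub>K\<close>, and \<open>axis K q\<close> is $q\otimes e_K$.
\<close>

type_synonym 'n stem = "'n cvec \<Rightarrow> quat ^ 'n set"

definition stem_fun :: "'n::finite cvec set \<Rightarrow> 'n stem \<Rightarrow> bool" where
  "stem_fun D F \<longleftrightarrow> continuous_on D F \<and>
     (\<forall>z\<in>D. \<forall>K h. F (conj_at h z) $ K = (-1) ^ card (K \<inter> {h}) * F z $ K)"

text \<open>
  For a stem function on an invariant set the value below does not depend on the choice
  of \<open>z\<close> and \<open>J\<close> representing a point \<open>x\<close> of the circularization, so the description
  is proper there. Outside the circularization the value is irrelevant.
\<close>

definition induced :: "'n::{finite,linorder} cvec set \<Rightarrow> 'n stem \<Rightarrow> 'n qvec \<Rightarrow> quat" where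
  "induced D F x = (THE v. \<exists>z\<in>D. \<exists>J. (\<forall>h. J h \<in> imag_units) \<and> x = slice_vec z J \<and>
     v = (\<Sum>K\<in>UNIV. ordered_prod K J * F z $ K))"

text \<open>
  Functions on a subset are total functions whose values off that subset play no role.
\<close>

definition induces :: "'n::{finite,linorder} cvec set \<Rightarrow> 'n stem \<Rightarrow> ('n qvec \<Rightarrow> quat) \<Rightarrow> bool" where
  "induces D F f \<longleftrightarrow> stem_fun D F \<and> (\<forall>x\<in>circularization D. f x = induced D F x)"

definition slice_functions :: "'n::{finite,linorder} cvec set \<Rightarrow> ('n qvec \<Rightarrow> quat) set" where
  "slice_functions D = {f. \<exists>F. induces D F f}"

text \<open>On \<open>D\<close> the stem function is determined by the slice function it induces.\<close>

definition stem_of :: "'n::{finite,linorder} cvec set \<Rightarrow> ('n qvec \<Rightarrow> quat) \<Rightarrow> 'n stem" where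
  "stem_of D f = (SOME F. induces D F f)"

definition stem_prod :: "'n::finite stem \<Rightarrow> 'n stem \<Rightarrow> 'n stem" where
  "stem_prod F G z = (\<Sum>H\<in>UNIV. \<Sum>K\<in>UNIV.
     axis (sym_diff K H) ((-1) ^ card (H \<inter> K) * (F z $ K * G z $ H)))"

definition slice_prod :: "'n::{finite,linorder} cvec set \<Rightarrow>
    ('n qvec \<Rightarrow> quat) \<Rightarrow> ('n qvec \<Rightarrow> quat) \<Rightarrow> 'n qvec \<Rightarrow> quat" where
  "slice_prod D f g = induced D (stem_prod (stem_of D f) (stem_of D g))"

definition coord_prod :: "'n::{finite,linorder} set \<Rightarrow> 'n qvec \<Rightarrow> quat" where
  "coord_prod K x = ordered_prod K (\<lambda>k. x $ k)"

section \<open>Slice regularity\<close>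

definition C1_on :: "'a::real_normed_vector set \<Rightarrow> ('a \<Rightarrow> 'b::real_normed_vector) \<Rightarrow> bool" where
  "C1_on S f \<longleftrightarrow> (\<exists>f' :: 'a \<Rightarrow> 'a \<Rightarrow>\<^sub>L 'b.
     (\<forall>x\<in>S. (f has_derivative blinfun_apply (f' x)) (at x)) \<and> continuous_on S f')"

definition dir_deriv :: "('a::real_normed_vector \<Rightarrow> 'b::real_normed_vector) \<Rightarrow> 'a \<Rightarrow> 'a \<Rightarrow> 'b" where
  "dir_deriv f x v = vector_derivative (\<lambda>t. f (x + t *\<^sub>R v)) (at 0)"

definition stem_J :: "'n::finite \<Rightarrow> quat ^ 'n set \<Rightarrow> quat ^ 'n set" where
  "stem_J h v = (\<Sum>K\<in>UNIV. axis (sym_diff K {h}) ((-1) ^ card (K \<inter> {h}) * v $ K))"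

definition stem_dbar :: "'n::finite \<Rightarrow> 'n stem \<Rightarrow> 'n stem" where
  "stem_dbar h F z = (1/2) *\<^sub>R (dir_deriv F z (axis h 1) + stem_J h (dir_deriv F z (axis h \<i>)))"

definition holomorphic_stem :: "'n::finite cvec set \<Rightarrow> 'n stem \<Rightarrow> bool" where
  "holomorphic_stem D F \<longleftrightarrow> stem_fun D F \<and> C1_on D F \<and> (\<forall>h. \<forall>z\<in>D. stem_dbar h F z = 0)"

definition slice_regular :: "'n::{finite,linorder} cvec set \<Rightarrow> ('n qvec \<Rightarrow> quat) set" where
  "slice_regular D = {f. \<exists>F. induces D F f \<and> holomorphic_stem D F}"

definition slice_domain :: "'n::finite cvec set \<Rightarrow> 'n \<Rightarrow> 'n qvec \<Rightarrow> complex set" where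
  "slice_domain D h y = {w. \<forall>J\<in>imag_units. vec_upd y h (slice_point w J) \<in> circularization D}"

definition slice_regular1 :: "complex set \<Rightarrow> (quat \<Rightarrow> quat) \<Rightarrow> bool" where
  "slice_regular1 E g \<longleftrightarrow> (\<exists>G0 G1. C1_on E G0 \<and> C1_on E G1 \<and>
     (\<forall>w\<in>E. G0 (cnj w) = G0 w \<and> G1 (cnj w) = - G1 w \<and>
        dir_deriv G0 w 1 = dir_deriv G1 w \<i> \<and> dir_deriv G0 w \<i> = - dir_deriv G1 w 1 \<and>
        (\<forall>J\<in>imag_units. g (slice_point w J) = G0 w + J * G1 w)))"

definition slice_regular_wrt ::
    "'n::{finite,linorder} cvec set \<Rightarrow> 'n \<Rightarrow> ('n qvec \<Rightarrow> quat) set" where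
  "slice_regular_wrt D h = {f \<in> slice_functions D.
     \<forall>y\<in>circularization D. slice_regular1 (slice_domain D h y) (\<lambda>x. f (vec_upd y h x))}"

section \<open>Spherical derivatives and spherical components\<close>

definition off_real :: "'n::finite cvec set \<Rightarrow> 'n set \<Rightarrow> 'n cvec set" where
  "off_real D H = {z \<in> D. \<forall>h\<in>H. Im (z $ h) \<noteq> 0}"

definition stem_sder :: "'n set \<Rightarrow> 'n stem \<Rightarrow> 'n::finite stem" where
  "stem_sder H F z = inverse (\<Prod>h\<in>H. Im (z $ h)) *\<^sub>R (\<Sum>K\<in>Pow (- H). axis K (F z $ (K \<union> H)))"

definition spherical_deriv :: "'n::{finite,linorder} cvec set \<Rightarrow> 'n set \<Rightarrow>
    ('n qvec \<Rightarrow> quat) \<Rightarrow> 'n qvec \<Rightarrow> quat" where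
  "spherical_deriv D H f = induced (off_real D H) (stem_sder H (stem_of D f))"

definition spherical_comp :: "'n::{finite,linorder} cvec set \<Rightarrow> nat \<Rightarrow> 'n set \<Rightarrow>
    ('n qvec \<Rightarrow> quat) \<Rightarrow> 'n qvec \<Rightarrow> quat" where
  "spherical_comp D m K f = spherical_deriv D (seg m) (slice_prod D (coord_prod K) f)"

text \<open>\<open>g\<close> is an element of $\mathcal{SR}_{m+1}(\Omega_D)$ extending the spherical component.\<close>

definition regular_extension :: "'n::{finite,linorder} cvec set \<Rightarrow> nat \<Rightarrow> 'n set \<Rightarrow>
    ('n qvec \<Rightarrow> quat) \<Rightarrow> ('n qvec \<Rightarrow> quat) \<Rightarrow> bool" where
  "regular_extension D m K f g \<longleftrightarrow> g \<in> slice_regular_wrt D (idx (m + 1)) \<and>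
     (\<forall>x\<in>circularization (off_real D (seg m)). g x = spherical_comp D m K f x)"

section \<open>The operators $\overline\partial_{x_h}$ on functions of quaternionic variables\<close>

definition quat_dbar :: "'n \<Rightarrow> ('n qvec \<Rightarrow> quat) \<Rightarrow> 'n::finite qvec \<Rightarrow> quat" where
  "quat_dbar h g x = (1/2) *\<^sub>R
     (dir_deriv g x (axis h 1)
      + Quat 0 1 0 0 * dir_deriv g x (axis h (Quat 0 1 0 0))
      + Quat 0 0 1 0 * dir_deriv g x (axis h (Quat 0 0 1 0))
      + Quat 0 0 0 1 * dir_deriv g x (axis h (Quat 0 0 0 1)))"

definition has_partials :: "'n \<Rightarrow> ('n qvec \<Rightarrow> quat) \<Rightarrow> 'n::finite qvec \<Rightarrow> bool" where
  "has_partials h g x \<longleftrightarrow> (\<forall>u\<in>{1, Quat 0 1 0 0, Quat 0 0 1 0, Quat 0 0 0 1}.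
     (\<lambda>t::real. g (x + t *\<^sub>R axis h u)) differentiable (at 0))"

definition twist :: "'n set \<Rightarrow> 'n \<Rightarrow> ('n qvec \<Rightarrow> quat) \<Rightarrow> 'n::finite qvec \<Rightarrow> quat" where
  "twist K h g x = (x $ h) ^ (if h \<in> K then 1 else 0) * g x"

text \<open>
  \<open>iter_dbar K f m\<close> is
  $\overline\partial_{x_m}(x_m^{\chi_K(m)}\cdots\overline\partial_{x_1}(x_1^{\chi_K(1)}f)\cdots)$.
\<close>

primrec iter_dbar :: "'n set \<Rightarrow> ('n qvec \<Rightarrow> quat) \<Rightarrow> nat \<Rightarrow>
    'n::{finite,linorder} qvec \<Rightarrow> quat" where
  "iter_dbar K f 0 = f"
| "iter_dbar K f (Suc m) = quat_dbar (idx (Suc m)) (twist K (idx (Suc m)) (iter_dbar K f m))"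

end

theory Submission
  imports Defs "HOL-Complex_Analysis.Cauchy_Integral_Formula"
begin

text \<open>
  A stem function \<open>F\<close> on an open set is holomorphic exactly if, for every index \<open>h\<close> and every \<open>L\<close>
  with \<open>h \<notin> L\<close>, the pair \<open>(F L, F (insert h L))\<close> satisfies the Cauchy-Riemann equations in \<open>z\<^sub>h\<close>
  (\<open>cr_along\<close>). Such pairs can be treated by complex function theory, coordinate by coordinate.
  What has to be understood is how regularity in a single quaternionic variable sees them.

  In the induced sum of the terms \<open>J\<^sub>K F\<^sub>K\<close> the unit \<open>J\<^sub>h\<close> stands in general inside the ordered
  product. It can be pulled to the left only if no component with an index below \<open>h\<close> occurs, and
  then the slice in \<open>x\<^sub>h\<close> is \<open>A + J\<^sub>h B\<close> with \<open>A\<close> and \<open>B\<close> built from the pairs above. The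
  spherical components for \<open>{1,\<dots>,m}\<close> have no components with indices up to \<open>m\<close>, so \<open>x\<^sub>m\<^sub>+\<^sub>1\<close> is the
  right variable for them, and all of them together, for the different \<open>K\<close>, still contain the full
  information about \<open>F\<close>.

  If \<open>F\<close> is holomorphic, the spherical components are built one variable at a time: multiply by
  \<open>x\<^sub>h\<close> or not, then divide the components containing \<open>h\<close> by \<open>Im z\<^sub>h\<close> (\<open>stem_step\<close>,
  \<open>comp_stem_eq\<close>). Those components are odd in \<open>Im z\<^sub>h\<close>, and their derivatives in \<open>z\<^sub>h\<close> are
  jointly continuous by Cauchy's estimate (\<open>cr_partials_continuous\<close>), so the quotients extend
  continuously to real \<open>z\<^sub>h\<close> (\<open>continuous_on_im_quotient\<close>). The equations in the later variables
  survive the extension, because locally uniform limits of holomorphic functions are holomorphic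
  (\<open>cr_along_off_real\<close>). Hence every step leads to a stem function of the same kind
  (\<open>regular_off_stem_step\<close>), which induces the required extension.

  Conversely, let all spherical components be regular in their variable. Averaging over the signs
  of the units isolates their single pairs of components (\<open>component_extraction\<close>). At points with
  nonreal coordinates the components of \<open>F\<close> are obtained from these by solving a system that is
  triangular in \<open>K\<close>, with coefficients independent of the variable in question
  (\<open>cr_along_of_spherical_comps\<close>), and the limit argument covers the real points. So \<open>F\<close> is
  continuous and holomorphic in each variable, hence continuously differentiable
  (\<open>regular_off_imp_holomorphic_stem\<close>).

  The formula rests on one computation in a single variable: if
  \<open>\<phi> (\<alpha> + J \<beta>) = A + J B\<close> is slice regular and \<open>B = \<beta> C\<close>, then the operator maps \<open>\<phi>\<close> to \<open>-C\<close>
  (\<open>directional_derivatives\<close>). Multiplication by the variable replaces \<open>C\<close> by \<open>\<alpha> C + A\<close>, and this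
  is the recursion that defines the stem functions of the spherical components
  (\<open>dbar_twist_step\<close>). By density of the points with nonreal coordinates the extensions are unique
  (\<open>regular_extension_unique\<close>), so the formula holds for all of them.
\<close>

section \<open>Quaternions, indices and ordered products\<close>

text \<open>
  Componentwise arguments below take inner products with the basis \<open>1, i, j, k\<close>.
\<close>

instantiation quat :: euclidean_space
begin

definition inner_quat :: "quat \<Rightarrow> quat \<Rightarrow> real" where
  "inner_quat p q = quat_re p * quat_re q + quat_i p * quat_i q + quat_j p * quat_j q + quat_k p * quat_k q"

definition Basis_quat :: "quat set" where
  "Basis_quat = {1, Quat 0 1 0 0, Quat 0 0 1 0, Quat 0 0 0 1}"

instance
proof
  fix p q s :: quat and r :: real
  show "inner p q = inner q p"
    by (simp add: inner_quat_def)
  show "inner (p + q) s = inner p s + inner q s" "inner (r *\<^sub>R p) q = r * inner p q"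
    by (simp_all add: inner_quat_def plus_quat_def scaleR_quat_def algebra_simps)
  show "0 \<le> inner p p"
    by (simp add: inner_quat_def)
  show norm_eq: "norm p = sqrt (inner p p)" for p :: quat
    by (simp add: inner_quat_def norm_quat_def power2_eq_square)
  have "inner p p = 0 \<longleftrightarrow> norm p = 0"
    by (simp only: norm_eq real_sqrt_eq_zero_cancel_iff)
  then show "inner p p = 0 \<longleftrightarrow> p = 0" by simp
  show "(Basis :: quat set) \<noteq> {}" "finite (Basis :: quat set)"
    by (simp_all add: Basis_quat_def)
  have B: "u = Quat 1 0 0 0 \<or> u = Quat 0 1 0 0 \<or> u = Quat 0 0 1 0 \<or> u = Quat 0 0 0 1"
    if "u \<in> Basis" for u :: quat
    using that unfolding Basis_quat_def one_quat_def by blast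
  show "inner p q = (if p = q then 1 else 0)" if "p \<in> Basis" "q \<in> Basis"
    using B[OF that(1)] B[OF that(2)] by (elim disjE) (simp_all add: inner_quat_def)
  have "(\<forall>u\<in>Basis. inner p u = 0) \<longleftrightarrow>
      quat_re p = 0 \<and> quat_i p = 0 \<and> quat_j p = 0 \<and> quat_k p = 0"
    unfolding Basis_quat_def one_quat_def ball_simps by (simp add: inner_quat_def)
  also have "\<dots> \<longleftrightarrow> p = 0"
    unfolding quat_eq_iff[of p] by (simp add: zero_quat_def)
  finally show "(\<forall>u\<in>Basis. inner p u = 0) \<longleftrightarrow> p = 0" .
qed

end

lemma of_real_quat: "(of_real r :: quat) = Quat r 0 0 0"
  by (simp add: of_real_def scaleR_quat_def one_quat_def)

lemma imag_units_iff:
  "J \<in> imag_units \<longleftrightarrow> quat_re J = 0 \<and> (quat_i J)\<^sup>2 + (quat_j J)\<^sup>2 + (quat_k J)\<^sup>2 = 1"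
proof
  assume "J \<in> imag_units"
  then have sq: "J * J = -1" by (simp add: imag_units_def power2_eq_square)
  have e: "quat_re J * quat_re J - quat_i J * quat_i J - quat_j J * quat_j J - quat_k J * quat_k J = -1"
    "quat_re J * quat_i J = 0" "quat_re J * quat_j J = 0" "quat_re J * quat_k J = 0"
    using sq by (auto simp: quat_arith_defs)
  have "quat_re J = 0"
  proof (rule ccontr)
    assume "quat_re J \<noteq> 0"
    with e have "quat_re J * quat_re J = -1" by simp
    then show False using zero_le_square[of "quat_re J"] by linarith
  qed
  with e show "quat_re J = 0 \<and> (quat_i J)\<^sup>2 + (quat_j J)\<^sup>2 + (quat_k J)\<^sup>2 = 1"
    by (simp add: power2_eq_square)
next
  assume "quat_re J = 0 \<and> (quat_i J)\<^sup>2 + (quat_j J)\<^sup>2 + (quat_k J)\<^sup>2 = 1"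
  then show "J \<in> imag_units"
    by (simp add: imag_units_def power2_eq_square quat_arith_defs)
qed

lemma uminus_imag_units: "- J \<in> imag_units \<longleftrightarrow> J \<in> imag_units"
  by (simp add: imag_units_def)

lemma imag_unit_sq: "J \<in> imag_units \<Longrightarrow> J * J = -1"
  by (simp add: imag_units_def power2_eq_square)

lemma imag_unit_nonzero: "J \<in> imag_units \<Longrightarrow> J \<noteq> 0"
  by (auto simp: imag_units_def)

lemma quat_i_imag_unit: "Quat 0 1 0 0 \<in> imag_units"
  and quat_j_imag_unit: "Quat 0 0 1 0 \<in> imag_units"
  and quat_k_imag_unit: "Quat 0 0 0 1 \<in> imag_units"
  by (simp_all add: imag_units_iff)

text \<open>
  A quaternion determines its real part and the length of its imaginary part, so only the sign
  of \<open>Im w\<close> and the matching sign of the unit are free; at a real point the unit is arbitrary.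
\<close>

lemma slice_point_eqD:
  assumes "slice_point w J = slice_point w' J'" "J \<in> imag_units" "J' \<in> imag_units"
  shows "w' = w \<and> (Im w = 0 \<or> J' = J) \<or> w' = cnj w \<and> J' = - J"
proof -
  have eq: "Re w = Re w'" "quat_i J * Im w = quat_i J' * Im w'"
    "quat_j J * Im w = quat_j J' * Im w'" "quat_k J * Im w = quat_k J' * Im w'"
    using assms by (auto simp: slice_point_def of_real_quat quat_arith_defs imag_units_iff)
  have "(Im w)\<^sup>2 = ((quat_i J)\<^sup>2 + (quat_j J)\<^sup>2 + (quat_k J)\<^sup>2) * (Im w)\<^sup>2"
    using assms by (simp add: imag_units_iff)
  also have "\<dots> = (quat_i J * Im w)\<^sup>2 + (quat_j J * Im w)\<^sup>2 + (quat_k J * Im w)\<^sup>2"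
    by (simp add: power_mult_distrib algebra_simps)
  also have "\<dots> = ((quat_i J')\<^sup>2 + (quat_j J')\<^sup>2 + (quat_k J')\<^sup>2) * (Im w')\<^sup>2"
    unfolding eq by (simp add: power_mult_distrib algebra_simps)
  also have "\<dots> = (Im w')\<^sup>2" using assms by (simp add: imag_units_iff)
  finally have "Im w' = Im w \<or> Im w' = - Im w" by (auto simp: power2_eq_iff)
  moreover have "J * of_real (Im w) = J' * of_real (Im w')"
    using assms(1) eq(1) by (simp add: slice_point_def)
  ultimately have "w' = w \<and> (J - J') * of_real (Im w) = 0 \<or> w' = cnj w \<and> (J + J') * of_real (Im w) = 0"
    using eq(1) by (auto simp: complex_eq_iff left_diff_distrib distrib_right)
  then show ?thesis
    by (auto simp: complex_eq_iff eq_neg_iff_add_eq_0 add.commute)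
qed

lemma idx_less:
  fixes i j :: nat
  assumes "1 \<le> i" "i < j" "j \<le> CARD('n::{finite,linorder})"
  shows "(idx i :: 'n) < idx j"
proof -
  have "sorted_wrt (<) (sorted_list_of_set (UNIV :: 'n set))" by simp
  then show ?thesis
    unfolding idx_def sorted_wrt_iff_nth_less using assms by simp
qed

lemma idx_surj: "\<exists>m<CARD('n). (h::'n::{finite,linorder}) = idx (Suc m)"
proof -
  have "h \<in> set (sorted_list_of_set (UNIV :: 'n set))" by simp
  then show ?thesis unfolding in_set_conv_nth idx_def by auto
qed

lemma seg_eq:
  assumes "m < CARD('n::{finite,linorder})"
  shows "seg m = {..<idx (Suc m) :: 'n}"
proof (intro set_eqI iffI)
  fix k :: 'n assume "k \<in> seg m"
  then show "k \<in> {..<idx (Suc m)}" using assms by (auto simp: seg_def intro!: idx_less)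
next
  fix k :: 'n assume k: "k \<in> {..<idx (Suc m)}"
  obtain l where l: "l < CARD('n)" "k = idx (Suc l)" using idx_surj by blast
  have "l < m"
  proof (rule ccontr)
    assume "\<not> l < m"
    then have "idx (Suc m) \<le> k"
      using l idx_less[of "Suc m" "Suc l", where 'n='n] by (cases "l = m") auto
    with k show False by simp
  qed
  then show "k \<in> seg m" using l by (auto simp: seg_def)
qed

lemma seg_0 [simp]: "seg 0 = {}"
  by (simp add: seg_def)

lemma seg_Suc: "seg (Suc m) = insert (idx (Suc m)) (seg m)"
  by (simp add: seg_def atLeastAtMostSuc_conv)

lemma Compl_seg:
  assumes "m < CARD('n::{finite,linorder})"
  shows "- seg m = {idx (Suc m) :: 'n..}"
  using seg_eq[OF assms] by auto

lemma Compl_seg_Suc: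
  assumes "m < CARD('n::{finite,linorder})"
  shows "- seg (Suc m) = {idx (Suc m) :: 'n<..}"
  unfolding seg_Suc seg_eq[OF assms] by auto

lemma ordered_prod_empty [simp]: "ordered_prod {} q = 1"
  by (simp add: ordered_prod_def)

lemma ordered_prod_insert_min:
  assumes "\<forall>a\<in>K. b < a"
  shows "ordered_prod (insert b K) q = q b * ordered_prod K q"
proof -
  have "b \<notin> K" using assms by auto
  have "sorted_list_of_set (insert b K) = b # sorted_list_of_set K"
    using assms \<open>b \<notin> K\<close>
    by (simp add: insort_is_Cons less_imp_le)
  then show ?thesis by (simp add: ordered_prod_def)
qed

lemma ordered_prod_cong: "(\<And>k. k \<in> K \<Longrightarrow> q k = q' k) \<Longrightarrow> ordered_prod K q = ordered_prod K q'"
  unfolding ordered_prod_def by (rule arg_cong[where f = prod_list]) simp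

lemma ordered_prod_nonzero: "(\<And>k. k \<in> K \<Longrightarrow> J k \<in> imag_units) \<Longrightarrow> ordered_prod K J \<noteq> 0"
  using finite[of K]
proof (induction K rule: finite_linorder_min_induct)
  case (insert b A)
  then show ?case by (simp add: ordered_prod_insert_min imag_unit_nonzero)
qed simp

lemma ordered_prod_sign:
  "ordered_prod K (\<lambda>k. if k \<in> S then - J k else J k) = (-1) ^ card (K \<inter> S) * ordered_prod K J"
  using finite[of K]
proof (induction K rule: finite_linorder_min_induct)
  case (insert b A)
  then have "b \<notin> A" by auto
  have sgn: "q * (-1) ^ n = (-1) ^ n * (q::quat)" for q n
    by (cases "even n") auto
  show ?case using insert \<open>b \<notin> A\<close>
    by (simp add: ordered_prod_insert_min mult.assoc[symmetric] sgn)
qed simp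

text \<open>
  The unit of the smallest index stands leftmost in every product containing it, so it can be
  pulled out to the left of the sum. For other indices this fails in general, since the units do not
  commute; this is why the components with indices below \<open>h\<close> have to be removed before
  regularity in the variable \<open>x\<^sub>h\<close> says anything about the stem function.
\<close>

lemma sum_ordered_prod_split:
  fixes c :: "'n::{finite,linorder} set \<Rightarrow> quat"
  assumes "\<And>L. \<not> L \<subseteq> {h..} \<Longrightarrow> c L = 0"
  shows "(\<Sum>L\<in>UNIV. ordered_prod L J * c L) =
    (\<Sum>L\<in>Pow {h<..}. ordered_prod L J * c L) + J h * (\<Sum>L\<in>Pow {h<..}. ordered_prod L J * c (insert h L))"
proof -
  have ivl: "{h..} = insert h {h<..}" by auto
  have "(\<Sum>L\<in>UNIV. ordered_prod L J * c L) = (\<Sum>L\<in>Pow {h..}. ordered_prod L J * c L)"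
    using assms by (intro sum.mono_neutral_right) auto
  also have "\<dots> = (\<Sum>L\<in>Pow {h<..}. ordered_prod L J * c L) + (\<Sum>L\<in>insert h ` Pow {h<..}. ordered_prod L J * c L)"
    unfolding ivl Pow_insert by (rule sum.union_disjoint) auto
  also have "(\<Sum>L\<in>insert h ` Pow {h<..}. ordered_prod L J * c L) =
      (\<Sum>L\<in>Pow {h<..}. ordered_prod (insert h L) J * c (insert h L))"
    by (subst sum.reindex) (auto simp: inj_on_def)
  also have "\<dots> = J h * (\<Sum>L\<in>Pow {h<..}. ordered_prod L J * c (insert h L))"
    unfolding sum_distrib_left
    by (rule sum.cong) (auto simp: ordered_prod_insert_min mult.assoc subset_iff)
  finally show ?thesis .
qed

text \<open>
  Replacing \<open>J h\<close> by \<open>-J h\<close> multiplies the terms with \<open>h \<in> K\<close> by \<open>-1\<close> and fixes the others, so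
  half the sum and half the difference separate the two kinds. Doing this for all indices leaves
  a single term, and its factor \<open>ordered_prod K J\<close> is invertible. The property \<open>Q\<close> stands for
  anything stable under sums and left multiplication: vanishing at a point gives uniqueness of
  stem functions, and the Cauchy-Riemann equations give regularity of single components.
\<close>

lemma component_extraction:
  fixes c :: "'n::{finite,linorder} set \<Rightarrow> 'x \<Rightarrow> quat" and Q :: "('x \<Rightarrow> quat) \<Rightarrow> bool"
  assumes add: "\<And>u v. Q u \<Longrightarrow> Q v \<Longrightarrow> Q (\<lambda>x. u x + v x)"
    and mult: "\<And>q u. Q u \<Longrightarrow> Q (\<lambda>x. q * u x)"
    and all: "\<And>J. (\<And>h. J h \<in> imag_units) \<Longrightarrow> Q (\<lambda>x. \<Sum>K\<in>UNIV. ordered_prod K J * c K x)"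
  shows "Q (c K)"
proof -
  have part: "Q (\<lambda>x. \<Sum>K | K \<inter> A = P. ordered_prod K J * c K x)"
    if "P \<subseteq> A" "\<And>h. J h \<in> imag_units" for A P J
    using finite[of A] that
  proof (induction A arbitrary: P J rule: finite_induct)
    case empty
    then show ?case using all by simp
  next
    case (insert h A)
    let ?J = "\<lambda>k. if k \<in> {h} then - J k else J k"
    let ?s = "if h \<in> P then -1 else (1 :: quat)"
    have J: "?J k \<in> imag_units" for k using insert.prems by (simp add: uminus_imag_units)
    have sub: "P - {h} \<subseteq> A" using insert.prems by auto
    have split: "(\<Sum>K | K \<inter> insert h A = P. ordered_prod K J * c K x) =
       inverse 2 * ((\<Sum>K | K \<inter> A = P - {h}. ordered_prod K J * c K x) +
               ?s * (\<Sum>K | K \<inter> A = P - {h}. ordered_prod K ?J * c K x))" for x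
    proof -
      have "(\<Sum>K | K \<inter> A = P - {h}. ordered_prod K J * c K x) +
               ?s * (\<Sum>K | K \<inter> A = P - {h}. ordered_prod K ?J * c K x)
        = (\<Sum>K | K \<inter> A = P - {h}. if K \<inter> insert h A = P then 2 * (ordered_prod K J * c K x) else 0)"
        unfolding sum_distrib_left sum.distrib[symmetric]
      proof (rule sum.cong[OF refl])
        fix K assume "K \<in> {K. K \<inter> A = P - {h}}"
        then have K: "K \<inter> A = P - {h}" by simp
        have iff: "K \<inter> insert h A = P \<longleftrightarrow> (h \<in> K \<longleftrightarrow> h \<in> P)"
          using K insert.hyps by blast
        show "ordered_prod K J * c K x + ?s * (ordered_prod K ?J * c K x) =
           (if K \<inter> insert h A = P then 2 * (ordered_prod K J * c K x) else 0)"
          unfolding ordered_prod_sign iff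
          by (cases "h \<in> K"; cases "h \<in> P") (simp_all add: Int_insert_right mult_2)
      qed
      also have "\<dots> = (\<Sum>K | K \<inter> insert h A = P. 2 * (ordered_prod K J * c K x))"
        using insert.hyps by (intro sum.mono_neutral_cong_right) auto
      also have "\<dots> = 2 * (\<Sum>K | K \<inter> insert h A = P. ordered_prod K J * c K x)"
        by (simp only: sum_distrib_left)
      finally have *: "(\<Sum>K | K \<inter> A = P - {h}. ordered_prod K J * c K x) +
               ?s * (\<Sum>K | K \<inter> A = P - {h}. ordered_prod K ?J * c K x) =
          2 * (\<Sum>K | K \<inter> insert h A = P. ordered_prod K J * c K x)" .
      have "inverse 2 * 2 = (1 :: quat)" by (rule left_inverse) simp
      then show ?thesis unfolding * mult.assoc[symmetric] by (simp only: mult_1_left)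
    qed
    have "Q (\<lambda>x. \<Sum>K | K \<inter> A = P - {h}. ordered_prod K J * c K x)"
      "Q (\<lambda>x. \<Sum>K | K \<inter> A = P - {h}. ordered_prod K ?J * c K x)"
      by (rule insert.IH; use sub insert.prems(2) J in blast)+
    from mult[OF add[OF this(1) mult[OF this(2), of ?s]], of "inverse 2"]
    show ?case unfolding split .
  qed
  \<comment> \<open>Any units serve here, as the remaining single term has an invertible factor.\<close>
  define J where "J = (\<lambda>h::'n. Quat 0 1 0 0)"
  have J: "J h \<in> imag_units" for h by (simp add: J_def quat_i_imag_unit)
  have "Q (\<lambda>x. ordered_prod K J * c K x)"
    using part[of K UNIV J] J by simp
  from mult[OF this, of "inverse (ordered_prod K J)"]
  show ?thesis using J by (simp add: ordered_prod_nonzero mult.assoc[symmetric])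
qed

lemma components_unique:
  fixes c d :: "'n::{finite,linorder} set \<Rightarrow> quat"
  assumes "\<And>J. (\<And>h. J h \<in> imag_units) \<Longrightarrow>
    (\<Sum>K\<in>UNIV. ordered_prod K J * c K) = (\<Sum>K\<in>UNIV. ordered_prod K J * d K)"
  shows "c K = d K"
proof -
  \<comment> \<open>Functions on a one-point type stand for single values.\<close>
  have "(\<lambda>_::unit. c K - d K) () = 0"
  proof (rule component_extraction[of "\<lambda>u. u () = 0" "\<lambda>K _. c K - d K"])
    fix J :: "'n \<Rightarrow> quat" assume "\<And>h. J h \<in> imag_units"
    then show "(\<Sum>K\<in>UNIV. ordered_prod K J * (c K - d K)) = 0"
      unfolding right_diff_distrib sum_subtractf by (simp only: assms diff_self)
  qed simp_all
  then show ?thesis by simp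
qed

section \<open>Stem functions and the slice functions they induce\<close>

lemma neg_one_power_card_sing: "(-1) ^ card (K \<inter> {h}) = (if h \<in> K then -1 else (1::'a::ring_1))"
  by auto

lemma vec_upd_nth: "vec_upd z h w $ k = (if k = h then w else z $ k)"
  by (simp add: vec_upd_def)

lemma conj_at_nth: "conj_at h z $ k = (if k = h then cnj (z $ h) else z $ k)"
  by (simp add: conj_at_def vec_upd_nth)

lemma conj_at_in_iff: "invariant_set D \<Longrightarrow> conj_at h z \<in> D \<longleftrightarrow> z \<in> D"
  by (simp add: invariant_set_def)

text \<open>
  The value of the induced function is well defined by parity alone, which for quotients and
  products can be checked separately from continuity.
\<close>

definition even_odd :: "'n::finite cvec set \<Rightarrow> 'n stem \<Rightarrow> bool" where
  "even_odd D F \<longleftrightarrow> (\<forall>z\<in>D. \<forall>K h. F (conj_at h z) $ K = (if h \<in> K then - F z $ K else F z $ K))"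

lemma stem_fun_iff: "stem_fun D F \<longleftrightarrow> continuous_on D F \<and> even_odd D F"
  unfolding stem_fun_def even_odd_def neg_one_power_card_sing
  by (intro conj_cong refl ball_cong all_cong1) simp

definition conj_set :: "'n set \<Rightarrow> 'n cvec \<Rightarrow> 'n::finite cvec" where
  "conj_set S z = (\<chi> k. if k \<in> S then cnj (z $ k) else z $ k)"

lemma conj_set_insert: "h \<notin> S \<Longrightarrow> conj_set (insert h S) z = conj_at h (conj_set S z)"
  by (auto simp: conj_set_def vec_eq_iff conj_at_nth)

lemma conj_set_in:
  assumes "invariant_set D" "z \<in> D"
  shows "conj_set S z \<in> D"
  using finite[of S]
proof (induction S rule: finite_induct)
  case empty
  then show ?case using assms by (simp add: conj_set_def)
next
  case (insert h S)
  then show ?case using assms by (simp add: conj_set_insert conj_at_in_iff)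
qed

lemma even_odd_conj_set:
  assumes "even_odd D F" "invariant_set D" "z \<in> D"
  shows "F (conj_set S z) $ K = (-1) ^ card (K \<inter> S) * F z $ K"
  using finite[of S]
proof (induction S rule: finite_induct)
  case empty
  then show ?case by (simp add: conj_set_def)
next
  case (insert h S)
  have "F (conj_set (insert h S) z) $ K = (if h \<in> K then - F (conj_set S z) $ K else F (conj_set S z) $ K)"
    using assms insert.hyps conj_set_in[of D z S] by (simp add: conj_set_insert even_odd_def)
  then show ?case using insert by simp
qed

lemma slice_vec_nth: "slice_vec z J $ h = slice_point (z $ h) (J h)"
  by (simp add: slice_vec_def)

text \<open>
  Two representations of the same point differ by flipping the signs of some units and
  conjugating the same coordinates. At real coordinates the units are unrelated, which is
  harmless because the components containing such an index vanish there.
\<close>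

lemma slice_vec_eqD:
  fixes z z' :: "'n::{finite,linorder} cvec"
  assumes eq: "slice_vec z J = slice_vec z' J'"
    and J: "\<And>h. J h \<in> imag_units" "\<And>h. J' h \<in> imag_units"
  obtains S where "z' = conj_set S z"
    "\<And>h. Im (z $ h) \<noteq> 0 \<Longrightarrow> J' h = (if h \<in> S then - J h else J h)"
proof
  define S where "S = {h. z' $ h \<noteq> z $ h}"
  have *: "z' $ h = z $ h \<and> (Im (z $ h) = 0 \<or> J' h = J h) \<or> z' $ h = cnj (z $ h) \<and> J' h = - J h" for h
    using slice_point_eqD[of "z $ h" "J h" "z' $ h" "J' h"] eq J by (simp add: vec_eq_iff slice_vec_nth)
  show "z' = conj_set S z"
    unfolding conj_set_def vec_eq_iff S_def using * by auto
  show "J' h = (if h \<in> S then - J h else J h)" if "Im (z $ h) \<noteq> 0" for h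
    using *[of h] that by (auto simp: S_def complex_eq_iff)
qed

lemma slice_vec_in_circularization:
  "z \<in> D \<Longrightarrow> (\<And>h. J h \<in> imag_units) \<Longrightarrow> slice_vec z J \<in> circularization D"
  by (auto simp: circularization_def)

lemma slice_vec_in_circularization_iff:
  fixes D :: "'n::{finite,linorder} cvec set"
  assumes "invariant_set D" and J: "\<And>h. J h \<in> imag_units"
  shows "slice_vec z J \<in> circularization D \<longleftrightarrow> z \<in> D"
proof
  assume "slice_vec z J \<in> circularization D"
  then obtain z' J' where *: "slice_vec z' J' = slice_vec z J" "z' \<in> D" "\<And>h. J' h \<in> imag_units"
    by (auto simp: circularization_def)
  from slice_vec_eqD[OF *(1) *(3) J] show "z \<in> D"
    using conj_set_in[OF assms(1) *(2)] by metis
qed (use J slice_vec_in_circularization in blast)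

text \<open>
  The sign from flipping units in \<open>ordered_prod K J\<close> cancels the sign of \<open>F\<^sub>K\<close> under
  conjugation, so the sum does not depend on the chosen representation and the definite
  description in \<open>induced\<close> is met.
\<close>

lemma induced_eq:
  fixes D :: "'n::{finite,linorder} cvec set"
  assumes inv: "invariant_set D" and F: "even_odd D F" and z: "z \<in> D" and J: "\<And>h. J h \<in> imag_units"
  shows "induced D F (slice_vec z J) = (\<Sum>K\<in>UNIV. ordered_prod K J * F z $ K)"
proof -
  have "(\<Sum>K\<in>UNIV. ordered_prod K J' * F z' $ K) = (\<Sum>K\<in>UNIV. ordered_prod K J * F z $ K)"
    if z': "z' \<in> D" and J': "\<And>h. J' h \<in> imag_units" and eq: "slice_vec z J = slice_vec z' J'" for z' J'
  proof (rule sum.cong[OF refl])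
    fix K :: "'n set"
    obtain S where S: "z' = conj_set S z"
      "\<And>h. Im (z $ h) \<noteq> 0 \<Longrightarrow> J' h = (if h \<in> S then - J h else J h)"
      using slice_vec_eqD[OF eq J J'] by metis
    have Fz': "F z' $ K = (-1) ^ card (K \<inter> S) * F z $ K"
      unfolding S(1) by (rule even_odd_conj_set[OF F inv z])
    show "ordered_prod K J' * F z' $ K = ordered_prod K J * F z $ K"
    proof (cases "\<exists>h\<in>K. Im (z $ h) = 0")
      case True
      then obtain h where h: "h \<in> K" "Im (z $ h) = 0" by auto
      then have "conj_at h z = z" by (auto simp: vec_eq_iff conj_at_nth complex_eq_iff)
      then have "F z $ K = - F z $ K" using F z h unfolding even_odd_def by metis
      then have "F z $ K = 0" by (simp add: eq_neg_iff_add_eq_0 flip: mult_2)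
      then show ?thesis by (simp add: Fz')
    next
      case False
      then have "ordered_prod K J' = ordered_prod K (\<lambda>k. if k \<in> S then - J k else J k)"
        by (intro ordered_prod_cong S(2)) auto
      then show ?thesis unfolding ordered_prod_sign Fz'
        by (cases "even (card (K \<inter> S))") auto
    qed
  qed
  then show ?thesis unfolding induced_def
    using z J by (intro the_equality) blast+
qed

lemma induces_eq:
  fixes D :: "'n::{finite,linorder} cvec set"
  assumes "induces D F f" "invariant_set D" "z \<in> D" "\<And>h. J h \<in> imag_units"
  shows "f (slice_vec z J) = (\<Sum>K\<in>UNIV. ordered_prod K J * F z $ K)"
proof -
  have "slice_vec z J \<in> circularization D"
    using assms(3,4) by (rule slice_vec_in_circularization)
  moreover have "even_odd D F" using assms(1) by (simp add: induces_def stem_fun_iff)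
  ultimately show ?thesis
    using assms(1) induced_eq[OF assms(2) _ assms(3,4)] by (simp add: induces_def)
qed

lemma induces_unique:
  fixes D :: "'n::{finite,linorder} cvec set"
  assumes "invariant_set D" "induces D F f" "induces D G f" "z \<in> D"
  shows "F z = G z"
proof -
  have "F z $ K = G z $ K" for K
  proof (rule components_unique)
    fix J :: "'n \<Rightarrow> quat" assume J: "\<And>h. J h \<in> imag_units"
    show "(\<Sum>K\<in>UNIV. ordered_prod K J * F z $ K) = (\<Sum>K\<in>UNIV. ordered_prod K J * G z $ K)"
      by (rule trans[OF induces_eq[OF assms(2,1,4) J, symmetric] induces_eq[OF assms(3,1,4) J]])
  qed
  then show ?thesis by (simp add: vec_eq_iff)
qed

lemma stem_of_eq:
  fixes D :: "'n::{finite,linorder} cvec set"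
  assumes "invariant_set D" "induces D F f" "z \<in> D"
  shows "stem_of D f z = F z"
proof -
  have "induces D (stem_of D f) f"
    unfolding stem_of_def by (rule someI[where P = "\<lambda>F. induces D F f", OF assms(2)])
  then show ?thesis using assms induces_unique by blast
qed

lemma induces_stem_of:
  "f \<in> slice_functions D \<Longrightarrow> induces D (stem_of D f) f"
  unfolding slice_functions_def stem_of_def mem_Collect_eq
  by (erule exE) (rule someI[where P = "\<lambda>F. induces D F f"])

lemma continuous_on_stem_iff:
  fixes F :: "'n::finite stem"
  shows "continuous_on D F \<longleftrightarrow> (\<forall>K. continuous_on D (\<lambda>z. F z $ K))"
proof
  assume "\<forall>K. continuous_on D (\<lambda>z. F z $ K)"
  then have "continuous_on D (\<lambda>z. \<chi> K. F z $ K)" by (intro continuous_on_vec_lambda) auto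
  then show "continuous_on D F" by simp
qed (auto intro: continuous_on_component)

text \<open>
  Expanding the product of the \<open>\<alpha>\<^sub>k + e\<^sub>k \<beta>\<^sub>k\<close> over \<open>k \<in> K\<close>. The components are real, so they
  commute with everything in the stem product.
\<close>

definition coord_stem :: "'n set \<Rightarrow> 'n::{finite,linorder} stem" where
  "coord_stem K z = (\<chi> H. if H \<subseteq> K
     then ((\<Prod>k\<in>K - H. Re (z $ k)) * (\<Prod>k\<in>H. Im (z $ k))) *\<^sub>R 1 else 0)"

lemma sum_Pow_insert:
  assumes "finite A" "h \<notin> A"
  shows "(\<Sum>P\<in>Pow (insert h A). g P) = (\<Sum>P\<in>Pow A. g P) + (\<Sum>P\<in>Pow A. g (insert h P))"
proof -
  have "(\<Sum>P\<in>Pow (insert h A). g P) = (\<Sum>P\<in>Pow A. g P) + (\<Sum>P\<in>insert h ` Pow A. g P)"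
    unfolding Pow_insert using assms by (intro sum.union_disjoint) auto
  also have "(\<Sum>P\<in>insert h ` Pow A. g P) = (\<Sum>P\<in>Pow A. g (insert h P))"
    using assms by (subst sum.reindex) (auto simp: inj_on_def)
  finally show ?thesis .
qed

lemma slice_point_scaleR: "slice_point w J = Re w *\<^sub>R 1 + Im w *\<^sub>R J"
  by (simp add: slice_point_def of_real_def)

lemma coord_prod_slice_vec:
  fixes z :: "'n::{finite,linorder} cvec"
  shows "coord_prod K (slice_vec z J) =
    (\<Sum>H\<in>Pow K. ((\<Prod>k\<in>K - H. Re (z $ k)) * (\<Prod>k\<in>H. Im (z $ k))) *\<^sub>R ordered_prod H J)"
  using finite[of K] unfolding coord_prod_def
proof (induction K rule: finite_linorder_min_induct)
  case (insert b A)
  let ?c = "\<lambda>A H. (\<Prod>k\<in>A - H. Re (z $ k)) * (\<Prod>k\<in>H. Im (z $ k))"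
  have b: "b \<notin> A" using insert.hyps by auto
  have 1: "?c (insert b A) H *\<^sub>R ordered_prod H J = Re (z $ b) *\<^sub>R ?c A H *\<^sub>R ordered_prod H J"
    if "H \<in> Pow A" for H
  proof -
    have "insert b A - H = insert b (A - H)" using that b by auto
    then show ?thesis using b by simp
  qed
  have 2: "?c (insert b A) (insert b H) *\<^sub>R ordered_prod (insert b H) J =
      Im (z $ b) *\<^sub>R J b * (?c A H *\<^sub>R ordered_prod H J)"
    if "H \<in> Pow A" for H
  proof -
    have *: "insert b A - insert b H = A - H" "b \<notin> H" "\<forall>a\<in>H. b < a" using that b insert.hyps by auto
    then show ?thesis by (simp add: ordered_prod_insert_min mult.left_commute)
  qed
  have "ordered_prod (insert b A) (\<lambda>k. slice_vec z J $ k) =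
      Re (z $ b) *\<^sub>R (\<Sum>H\<in>Pow A. ?c A H *\<^sub>R ordered_prod H J) +
      Im (z $ b) *\<^sub>R J b * (\<Sum>H\<in>Pow A. ?c A H *\<^sub>R ordered_prod H J)"
    unfolding ordered_prod_insert_min[OF insert.hyps(2)] insert.IH slice_vec_nth[of z J b] slice_point_scaleR
    by (simp add: distrib_right)
  also have "\<dots> = (\<Sum>H\<in>Pow A. ?c (insert b A) H *\<^sub>R ordered_prod H J) +
      (\<Sum>H\<in>Pow A. ?c (insert b A) (insert b H) *\<^sub>R ordered_prod (insert b H) J)"
    unfolding scaleR_sum_right sum_distrib_left
    by (intro arg_cong2[where f = "(+)"] sum.cong refl 1[symmetric] 2[symmetric])
  finally show ?case
    unfolding sum_Pow_insert[OF \<open>finite A\<close> b] .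
qed simp

lemma even_odd_coord_stem:
  fixes D :: "'n::{finite,linorder} cvec set"
  shows "even_odd D (coord_stem K)"
  unfolding even_odd_def
proof (intro ballI allI)
  fix z :: "'n cvec" and H h
  have 1: "(\<Prod>k\<in>A. Re (conj_at h z $ k)) = (\<Prod>k\<in>A. Re (z $ k))" for A
    by (rule prod.cong) (auto simp: conj_at_nth)
  have 2: "(\<Prod>k\<in>A. Im (conj_at h z $ k)) = (if h \<in> A then - (\<Prod>k\<in>A. Im (z $ k)) else (\<Prod>k\<in>A. Im (z $ k)))" for A
  proof (cases "h \<in> A")
    case True
    have "(\<Prod>k\<in>A - {h}. Im (conj_at h z $ k)) = (\<Prod>k\<in>A - {h}. Im (z $ k))"
      by (rule prod.cong) (auto simp: conj_at_nth)
    then show ?thesis using True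
      by (simp add: prod.remove[of A h] conj_at_nth)
  next
    case False
    then show ?thesis by (auto simp: conj_at_nth intro!: prod.cong)
  qed
  show "coord_stem K (conj_at h z) $ H = (if h \<in> H then - coord_stem K z $ H else coord_stem K z $ H)"
    by (simp add: coord_stem_def 1 2)
qed

lemma induces_coord_stem:
  fixes D :: "'n::{finite,linorder} cvec set"
  assumes "invariant_set D"
  shows "induces D (coord_stem K) (coord_prod K)"
  unfolding induces_def stem_fun_iff
proof (intro conjI ballI even_odd_coord_stem)
  have "continuous_on D (\<lambda>z. coord_stem K z $ H)" for H
    by (cases "H \<subseteq> K") (auto simp: coord_stem_def intro!: continuous_intros)
  then show "continuous_on D (coord_stem K)"
    unfolding continuous_on_stem_iff by simp
  fix x assume "x \<in> circularization D"
  then obtain z J where x: "x = slice_vec z J" "z \<in> D" "\<And>h. J h \<in> imag_units"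
    by (auto simp: circularization_def)
  have "induced D (coord_stem K) x = (\<Sum>H\<in>UNIV. ordered_prod H J * coord_stem K z $ H)"
    unfolding x(1) by (rule induced_eq[OF assms even_odd_coord_stem x(2,3)])
  also have "\<dots> = (\<Sum>H\<in>Pow K. ((\<Prod>k\<in>K - H. Re (z $ k)) * (\<Prod>k\<in>H. Im (z $ k))) *\<^sub>R ordered_prod H J)"
    by (rule sum.mono_neutral_cong_right) (auto simp: coord_stem_def)
  finally show "coord_prod K x = induced D (coord_stem K) x"
    unfolding x(1) coord_prod_slice_vec by simp
qed

lemma stem_prod_nth:
  fixes F G :: "'n::finite stem"
  shows "stem_prod F G z $ L = (\<Sum>K\<in>UNIV. (-1) ^ card (sym_diff K L \<inter> K) * (F z $ K * G z $ sym_diff K L))"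
proof -
  have "stem_prod F G z $ L = (\<Sum>H\<in>UNIV. \<Sum>K\<in>UNIV.
     if H = sym_diff K L then (-1) ^ card (H \<inter> K) * (F z $ K * G z $ H) else 0)"
    unfolding stem_prod_def sum_component
    by (intro sum.cong refl) (auto simp: axis_def)
  also have "\<dots> = (\<Sum>K\<in>UNIV. \<Sum>H\<in>UNIV.
     if H = sym_diff K L then (-1) ^ card (H \<inter> K) * (F z $ K * G z $ H) else 0)"
    by (rule sum.swap)
  also have "\<dots> = (\<Sum>K\<in>UNIV. (-1) ^ card (sym_diff K L \<inter> K) * (F z $ K * G z $ sym_diff K L))"
    by simp
  finally show ?thesis .
qed

lemma stem_fun_stem_prod:
  fixes F G :: "'n::finite stem"
  assumes "stem_fun D F" "stem_fun D G"
  shows "stem_fun D (stem_prod F G)"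
  unfolding stem_fun_iff
proof
  have c: "continuous_on D (\<lambda>z. F z $ K)" "continuous_on D (\<lambda>z. G z $ K)" for K
    using assms by (auto simp: stem_fun_iff continuous_on_stem_iff)
  show "continuous_on D (stem_prod F G)"
    unfolding continuous_on_stem_iff stem_prod_nth by (intro allI continuous_intros c)
  show "even_odd D (stem_prod F G)"
    unfolding even_odd_def
  proof (intro ballI allI)
    fix z L h assume z: "z \<in> D"
    have F: "F (conj_at h z) $ K = (if h \<in> K then -1 else 1) * F z $ K"
      "G (conj_at h z) $ K = (if h \<in> K then -1 else 1) * G z $ K" for K
      using assms z by (auto simp: stem_fun_iff even_odd_def)
    have "stem_prod F G (conj_at h z) $ L = (\<Sum>K\<in>UNIV. (if h \<in> L then -1 else 1) *
       ((-1) ^ card (sym_diff K L \<inter> K) * (F z $ K * G z $ sym_diff K L)))"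
      unfolding stem_prod_nth F by (intro sum.cong refl) auto
    then show "stem_prod F G (conj_at h z) $ L = (if h \<in> L then - stem_prod F G z $ L else stem_prod F G z $ L)"
      unfolding sum_distrib_left[symmetric] stem_prod_nth[symmetric] by simp
  qed
qed

text \<open>
  For \<open>K \<subseteq> L\<close> only the components \<open>F (L - P)\<close> with \<open>P \<subseteq> K\<close> contribute, and every sign is \<open>+1\<close>
  because \<open>sym_diff P L = L - P\<close> is disjoint from \<open>P\<close>. This is the only case occurring in
  spherical components.
\<close>

lemma coord_stem_prod_nth:
  fixes F :: "'n::{finite,linorder} stem"
  assumes "K \<subseteq> L"
  shows "stem_prod (coord_stem K) F z $ L =
    (\<Sum>P\<in>Pow K. ((\<Prod>k\<in>K - P. Re (z $ k)) * (\<Prod>k\<in>P. Im (z $ k))) *\<^sub>R F z $ (L - P))"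
proof -
  have "stem_prod (coord_stem K) F z $ L =
    (\<Sum>P\<in>Pow K. (-1) ^ card (sym_diff P L \<inter> P) * (coord_stem K z $ P * F z $ sym_diff P L))"
    unfolding stem_prod_nth by (rule sum.mono_neutral_right) (auto simp: coord_stem_def)
  also have "\<dots> = (\<Sum>P\<in>Pow K. ((\<Prod>k\<in>K - P. Re (z $ k)) * (\<Prod>k\<in>P. Im (z $ k))) *\<^sub>R F z $ (L - P))"
  proof (rule sum.cong[OF refl])
    fix P assume "P \<in> Pow K"
    then have "P \<subseteq> L" "P \<subseteq> K" using assms by auto
    then have *: "sym_diff P L = L - P" "(L - P) \<inter> P = {}" by auto
    show "(-1) ^ card (sym_diff P L \<inter> P) * (coord_stem K z $ P * F z $ sym_diff P L) =
       ((\<Prod>k\<in>K - P. Re (z $ k)) * (\<Prod>k\<in>P. Im (z $ k))) *\<^sub>R F z $ (L - P)"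
      unfolding * using \<open>P \<subseteq> K\<close> by (simp add: coord_stem_def)
  qed
  finally show ?thesis .
qed

lemma off_real_conj_at: "Im (conj_at h z $ k) = 0 \<longleftrightarrow> Im (z $ k) = 0"
  by (simp add: conj_at_nth)

lemma invariant_off_real: "invariant_set D \<Longrightarrow> invariant_set (off_real D H)"
  unfolding invariant_set_def off_real_def by (simp add: off_real_conj_at)

lemma stem_sder_nth:
  "stem_sder H F z $ L = (if L \<subseteq> - H then inverse (\<Prod>h\<in>H. Im (z $ h)) *\<^sub>R F z $ (L \<union> H) else 0)"
proof -
  have "(\<Sum>K\<in>Pow (- H). axis K (F z $ (K \<union> H)) $ L) =
    (\<Sum>K\<in>Pow (- H). if K = L then F z $ (L \<union> H) else 0)"
    by (rule sum.cong) (auto simp: axis_def)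
  then show ?thesis by (simp add: stem_sder_def sum_component)
qed

lemma even_odd_stem_sder:
  assumes "even_odd D F" "D' \<subseteq> D"
  shows "even_odd D' (stem_sder H F)"
  unfolding even_odd_def
proof (intro ballI allI)
  fix z L h assume "z \<in> D'"
  then have F: "F (conj_at h z) $ K = (if h \<in> K then - F z $ K else F z $ K)" for K
    using assms by (auto simp: even_odd_def)
  show "stem_sder H F (conj_at h z) $ L = (if h \<in> L then - stem_sder H F z $ L else stem_sder H F z $ L)"
  proof (cases "h \<in> H")
    case True
    have "(\<Prod>k\<in>H - {h}. Im (conj_at h z $ k)) = (\<Prod>k\<in>H - {h}. Im (z $ k))"
      by (rule prod.cong) (auto simp: conj_at_nth)
    then have "(\<Prod>k\<in>H. Im (conj_at h z $ k)) = - (\<Prod>k\<in>H. Im (z $ k))"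
      using True by (simp add: prod.remove[of H h] conj_at_nth)
    then show ?thesis using True by (auto simp: stem_sder_nth F)
  next
    case False
    then have "(\<Prod>k\<in>H. Im (conj_at h z $ k)) = (\<Prod>k\<in>H. Im (z $ k))"
      by (intro prod.cong) (auto simp: conj_at_nth)
    then show ?thesis using False by (auto simp: stem_sder_nth F)
  qed
qed

text \<open>
  The choices of stem functions hidden in the definition agree with any stem function inducing
  the same slice function, so the spherical component can be read off from a given one.
\<close>

lemma spherical_comp_eq:
  fixes D :: "'n::{finite,linorder} cvec set"
  assumes inv: "invariant_set D" and F: "induces D F f" and z: "z \<in> off_real D (seg m)"
    and J: "\<And>h. J h \<in> imag_units"
  shows "spherical_comp D m K f (slice_vec z J) =
    (\<Sum>L\<in>UNIV. ordered_prod L J * stem_sder (seg m) (stem_prod (coord_stem K) F) z $ L)"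
proof -
  let ?P = "stem_prod (stem_of D (coord_prod K)) (stem_of D f)"
  have zD: "z \<in> D" using z by (simp add: off_real_def)
  have ind: "induces D (stem_of D (coord_prod K)) (coord_prod K)" "induces D (stem_of D f) f"
    using induces_coord_stem[OF inv, of K] F
    by (auto intro!: induces_stem_of simp: slice_functions_def)
  have P: "stem_fun D ?P"
    using ind by (intro stem_fun_stem_prod) (auto simp: induces_def)
  have "induces D ?P (slice_prod D (coord_prod K) f)"
    using P by (simp add: induces_def slice_prod_def)
  then have SP: "stem_of D (slice_prod D (coord_prod K) f) z' = ?P z'" if "z' \<in> D" for z'
    by (rule stem_of_eq[OF inv _ that])
  have PF: "?P z = stem_prod (coord_stem K) F z"
    unfolding stem_prod_def
    by (simp add: stem_of_eq[OF inv induces_coord_stem[OF inv] zD] stem_of_eq[OF inv F zD])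
  have "induces D (stem_of D (slice_prod D (coord_prod K) f)) (slice_prod D (coord_prod K) f)"
    using \<open>induces D ?P _\<close> by (auto intro!: induces_stem_of simp: slice_functions_def)
  then have "even_odd D (stem_of D (slice_prod D (coord_prod K) f))"
    by (simp add: induces_def stem_fun_iff)
  then have "even_odd (off_real D (seg m)) (stem_sder (seg m) (stem_of D (slice_prod D (coord_prod K) f)))"
    by (rule even_odd_stem_sder) (auto simp: off_real_def)
  from induced_eq[OF invariant_off_real[OF inv] this z J]
  show ?thesis
    unfolding spherical_comp_def spherical_deriv_def stem_sder_nth SP[OF zD] PF .
qed

section \<open>Cauchy-Riemann pairs\<close>

text \<open>
  The equations for \<open>u + \<iota>v\<close> with an extra imaginary unit \<open>\<iota>\<close> commuting with the values of \<open>u\<close>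
  and \<open>v\<close>: writing \<open>p, q\<close> for the partial derivatives of \<open>u\<close>, those of \<open>v\<close> are \<open>-q, p\<close>. The
  values need not form an algebra.
\<close>

definition cr_at :: "(complex \<Rightarrow> 'b::real_normed_vector) \<Rightarrow> (complex \<Rightarrow> 'b) \<Rightarrow> complex \<Rightarrow> bool" where
  "cr_at u v w \<longleftrightarrow> (\<exists>p q.
     (u has_derivative (\<lambda>d. Re d *\<^sub>R p + Im d *\<^sub>R q)) (at w) \<and>
     (v has_derivative (\<lambda>d. Im d *\<^sub>R p - Re d *\<^sub>R q)) (at w))"

lemma cr_atE:
  assumes "cr_at u v w"
  obtains p q where "(u has_derivative (\<lambda>d. Re d *\<^sub>R p + Im d *\<^sub>R q)) (at w)"
    "(v has_derivative (\<lambda>d. Im d *\<^sub>R p - Re d *\<^sub>R q)) (at w)"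
  using assms that unfolding cr_at_def by (elim exE conjE)

lemma cr_atI:
  assumes "(u has_derivative (\<lambda>d. Re d *\<^sub>R p + Im d *\<^sub>R q)) (at w)"
    "(v has_derivative (\<lambda>d. Im d *\<^sub>R p - Re d *\<^sub>R q)) (at w)"
  shows "cr_at u v w"
  unfolding cr_at_def using assms by (intro exI conjI)

lemma cr_at_add:
  assumes "cr_at u v w" "cr_at u' v' w"
  shows "cr_at (\<lambda>x. u x + u' x) (\<lambda>x. v x + v' x) w"
proof -
  obtain p q where
    *: "(u has_derivative (\<lambda>d. Re d *\<^sub>R p + Im d *\<^sub>R q)) (at w)"
    "(v has_derivative (\<lambda>d. Im d *\<^sub>R p - Re d *\<^sub>R q)) (at w)"
    by (rule cr_atE[OF assms(1)])
  obtain p' q' where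
    **: "(u' has_derivative (\<lambda>d. Re d *\<^sub>R p' + Im d *\<^sub>R q')) (at w)"
    "(v' has_derivative (\<lambda>d. Im d *\<^sub>R p' - Re d *\<^sub>R q')) (at w)"
    by (rule cr_atE[OF assms(2)])
  show ?thesis
  proof (rule cr_atI)
    show "((\<lambda>x. u x + u' x) has_derivative (\<lambda>d. Re d *\<^sub>R (p + p') + Im d *\<^sub>R (q + q'))) (at w)"
      by (rule has_derivative_eq_rhs[OF has_derivative_add[OF *(1) **(1)]]) (simp add: fun_eq_iff algebra_simps)
    show "((\<lambda>x. v x + v' x) has_derivative (\<lambda>d. Im d *\<^sub>R (p + p') - Re d *\<^sub>R (q + q'))) (at w)"
      by (rule has_derivative_eq_rhs[OF has_derivative_add[OF *(2) **(2)]]) (simp add: fun_eq_iff algebra_simps)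
  qed
qed

lemma cr_at_bounded_linear:
  assumes "bounded_linear T" "cr_at u v w"
  shows "cr_at (\<lambda>x. T (u x)) (\<lambda>x. T (v x)) w"
proof -
  interpret bounded_linear T by fact
  obtain p q where
    *: "(u has_derivative (\<lambda>d. Re d *\<^sub>R p + Im d *\<^sub>R q)) (at w)"
    "(v has_derivative (\<lambda>d. Im d *\<^sub>R p - Re d *\<^sub>R q)) (at w)"
    by (rule cr_atE[OF assms(2)])
  show ?thesis
  proof (rule cr_atI)
    show "((\<lambda>x. T (u x)) has_derivative (\<lambda>d. Re d *\<^sub>R T p + Im d *\<^sub>R T q)) (at w)"
      by (rule has_derivative_eq_rhs[OF has_derivative[OF *(1)]]) (simp add: fun_eq_iff add scaleR)
    show "((\<lambda>x. T (v x)) has_derivative (\<lambda>d. Im d *\<^sub>R T p - Re d *\<^sub>R T q)) (at w)"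
      by (rule has_derivative_eq_rhs[OF has_derivative[OF *(2)]]) (simp add: fun_eq_iff diff scaleR)
  qed
qed

lemma cr_at_0: "cr_at (\<lambda>x. 0) (\<lambda>x. 0) w"
  unfolding cr_at_def by (intro exI[of _ 0]) simp

lemmas cr_at_scaleR = cr_at_bounded_linear[OF bounded_linear_scaleR_right]
  and cr_at_mult_left = cr_at_bounded_linear[OF bounded_linear_mult_right]

lemma cr_at_sum:
  "(\<And>i. i \<in> I \<Longrightarrow> cr_at (u i) (v i) w) \<Longrightarrow> cr_at (\<lambda>x. \<Sum>i\<in>I. u i x) (\<lambda>x. \<Sum>i\<in>I. v i x) w"
  by (induction I rule: infinite_finite_induct) (auto intro: cr_at_0 cr_at_add)

lemma cr_at_diff:
  assumes "cr_at u v w" "cr_at u' v' w"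
  shows "cr_at (\<lambda>x. u x - u' x) (\<lambda>x. v x - v' x) w"
  using cr_at_add[OF assms(1) cr_at_scaleR[OF assms(2), of "-1"]] by simp

lemma cr_at_transform:
  assumes "cr_at u v w" "open S" "w \<in> S" "\<And>x. x \<in> S \<Longrightarrow> u x = u' x" "\<And>x. x \<in> S \<Longrightarrow> v x = v' x"
  shows "cr_at u' v' w"
proof -
  obtain p q where
    *: "(u has_derivative (\<lambda>d. Re d *\<^sub>R p + Im d *\<^sub>R q)) (at w)"
    "(v has_derivative (\<lambda>d. Im d *\<^sub>R p - Re d *\<^sub>R q)) (at w)"
    by (rule cr_atE[OF assms(1)])
  show ?thesis
    by (rule cr_atI[OF has_derivative_transform_within_open[OF *(1) assms(2-4)]
      has_derivative_transform_within_open[OF *(2) assms(2,3,5)]])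
qed

text \<open>
  This is multiplication of \<open>u + \<iota>v\<close> by the complex variable.
\<close>

lemma cr_at_mult_ident:
  fixes u v :: "complex \<Rightarrow> 'b::real_normed_vector"
  assumes "cr_at u v w"
  shows "cr_at (\<lambda>x. Re x *\<^sub>R u x - Im x *\<^sub>R v x) (\<lambda>x. Re x *\<^sub>R v x + Im x *\<^sub>R u x) w"
proof -
  obtain p q where
    *: "(u has_derivative (\<lambda>d. Re d *\<^sub>R p + Im d *\<^sub>R q)) (at w)"
    "(v has_derivative (\<lambda>d. Im d *\<^sub>R p - Re d *\<^sub>R q)) (at w)"
    by (rule cr_atE[OF assms(1)])
  let ?p = "u w + Re w *\<^sub>R p - Im w *\<^sub>R - q" and ?q = "Re w *\<^sub>R q - (v w + Im w *\<^sub>R p)"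
  have lin: "(Re has_derivative Re) (at w)" "(Im has_derivative Im) (at w)"
    by (rule bounded_linear_imp_has_derivative[OF bounded_linear_Re]
        bounded_linear_imp_has_derivative[OF bounded_linear_Im])+
  show ?thesis
  proof (rule cr_atI)
    show "((\<lambda>x. Re x *\<^sub>R u x - Im x *\<^sub>R v x) has_derivative (\<lambda>d. Re d *\<^sub>R ?p + Im d *\<^sub>R ?q)) (at w)"
      by (rule has_derivative_eq_rhs[OF has_derivative_diff[OF has_derivative_scaleR[OF lin(1) *(1)]
            has_derivative_scaleR[OF lin(2) *(2)]]]) (simp add: fun_eq_iff algebra_simps)
    show "((\<lambda>x. Re x *\<^sub>R v x + Im x *\<^sub>R u x) has_derivative (\<lambda>d. Im d *\<^sub>R ?p - Re d *\<^sub>R ?q)) (at w)"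
      by (rule has_derivative_eq_rhs[OF has_derivative_add[OF has_derivative_scaleR[OF lin(1) *(2)]
            has_derivative_scaleR[OF lin(2) *(1)]]]) (simp add: fun_eq_iff algebra_simps)
  qed
qed

lemma cr_at_shift:
  assumes "cr_at u v (a + w)"
  shows "cr_at (\<lambda>x. u (a + x)) (\<lambda>x. v (a + x)) w"
proof -
  have sh: "((\<lambda>x. a + x) has_derivative (\<lambda>d. d)) (at w)"
    using has_derivative_add[OF has_derivative_const has_derivative_ident, of a "at w"] by simp
  obtain p q where
    *: "(u has_derivative (\<lambda>d. Re d *\<^sub>R p + Im d *\<^sub>R q)) (at (a + w))"
    "(v has_derivative (\<lambda>d. Im d *\<^sub>R p - Re d *\<^sub>R q)) (at (a + w))"
    by (rule cr_atE[OF assms(1)])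
  show ?thesis
    by (rule cr_atI[OF has_derivative_compose[OF sh *(1)] has_derivative_compose[OF sh *(2)]])
qed

text \<open>
  Holomorphy in the single variable \<open>z\<^sub>h\<close>, on the complex line through \<open>z\<close>.
\<close>

definition cr_along :: "'n \<Rightarrow> ('n::finite cvec \<Rightarrow> 'b::real_normed_vector) \<Rightarrow> ('n cvec \<Rightarrow> 'b) \<Rightarrow> 'n cvec \<Rightarrow> bool" where
  "cr_along h u v z \<longleftrightarrow> cr_at (\<lambda>w. u (z + axis h w)) (\<lambda>w. v (z + axis h w)) 0"

lemma axis_add: "axis h (a + b) = axis h a + axis h (b :: 'a::monoid_add)"
  by (simp add: vec_eq_iff axis_def)

lemma axis_scaleR: "axis h (c *\<^sub>R b) = c *\<^sub>R axis h (b :: 'a::real_vector)"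
  by (simp add: vec_eq_iff axis_def)

lemma norm_axis: "norm (axis h (w :: 'a::real_normed_vector)) = norm w"
proof -
  have "norm (axis h w) = sqrt (\<Sum>i\<in>UNIV. if i = h then (norm w)\<^sup>2 else 0)"
    unfolding norm_vec_def L2_set_def by (intro arg_cong[where f = sqrt] sum.cong) (auto simp: axis_def)
  then show ?thesis by simp
qed

lemma bounded_linear_axis: "bounded_linear (axis h :: 'a::real_normed_vector \<Rightarrow> 'a ^ 'n)"
  by (rule bounded_linear_intro[of _ 1]) (simp_all add: axis_add axis_scaleR norm_axis)

lemmas continuous_on_axis[continuous_intros] = bounded_linear.continuous_on[OF bounded_linear_axis]

lemma vec_upd_axis: "vec_upd z h w = z + axis h (w - z $ h)" for w :: "'a::ring"
  by (simp add: vec_eq_iff vec_upd_nth axis_def)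

lemma open_line:
  fixes D :: "('a::real_normed_vector ^ 'n) set"
  assumes "open D"
  shows "open {w. z + axis h w \<in> D}"
proof -
  have "continuous_on UNIV (\<lambda>w::'a. z + axis h w)" by (intro continuous_intros)
  from open_vimage[OF assms this] show ?thesis by (simp add: vimage_def)
qed

lemma cr_along_line:
  assumes "cr_along h u v (z + axis h w)"
  shows "cr_at (\<lambda>w. u (z + axis h w)) (\<lambda>w. v (z + axis h w)) w"
  using cr_at_shift[of "\<lambda>x. u (z + axis h (w + x))" "\<lambda>x. v (z + axis h (w + x))" "- w" w] assms
  by (simp add: cr_along_def axis_add add.assoc)

lemma has_field_derivative_Complex:
  fixes a b :: "complex \<Rightarrow> real"
  assumes "(a has_derivative (\<lambda>d. Re d * p + Im d * q)) (at w)"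
    and "(b has_derivative (\<lambda>d. Im d * p - Re d * q)) (at w)"
  shows "((\<lambda>x. Complex (a x) (b x)) has_field_derivative Complex p (- q)) (at w)"
proof -
  note [derivative_intros] = assms
  have "((\<lambda>x. of_real (a x) + \<i> * of_real (b x)) has_derivative (\<lambda>d. Complex p (- q) * d)) (at w)"
    by (auto intro!: derivative_eq_intros simp: complex_eq_iff algebra_simps)
  then show ?thesis by (simp add: has_field_derivative_def Complex_eq)
qed

lemma has_derivative_of_Complex:
  fixes a b :: "complex \<Rightarrow> real"
  assumes "((\<lambda>x. Complex (a x) (b x)) has_field_derivative D) (at w)"
  shows "(a has_derivative (\<lambda>d. Re d * Re D + Im d * (- Im D))) (at w)"
    and "(b has_derivative (\<lambda>d. Im d * Re D - Re d * (- Im D))) (at w)"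
proof -
  have *: "((\<lambda>x. Complex (a x) (b x)) has_derivative (*) D) (at w)"
    using assms by (simp add: has_field_derivative_def)
  show "(a has_derivative (\<lambda>d. Re d * Re D + Im d * (- Im D))) (at w)"
    using bounded_linear.has_derivative[OF bounded_linear_Re *] by (simp add: algebra_simps)
  show "(b has_derivative (\<lambda>d. Im d * Re D - Re d * (- Im D))) (at w)"
    using bounded_linear.has_derivative[OF bounded_linear_Im *] by (simp add: algebra_simps)
qed

text \<open>
  Complex function theory becomes applicable by pairing the coordinates of \<open>u\<close> and \<open>v\<close> into
  complex-valued functions.
\<close>

lemma cr_at_componentwise:
  fixes u v :: "complex \<Rightarrow> 'b::euclidean_space"
  shows "cr_at u v w \<longleftrightarrow> (\<forall>b\<in>Basis. (\<lambda>x. Complex (u x \<bullet> b) (v x \<bullet> b)) field_differentiable (at w))"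
proof
  assume "cr_at u v w"
  then obtain p q where
    *: "(u has_derivative (\<lambda>d. Re d *\<^sub>R p + Im d *\<^sub>R q)) (at w)"
    "(v has_derivative (\<lambda>d. Im d *\<^sub>R p - Re d *\<^sub>R q)) (at w)"
    by (rule cr_atE)
  have "((\<lambda>x. Complex (u x \<bullet> b) (v x \<bullet> b)) has_field_derivative Complex (p \<bullet> b) (- (q \<bullet> b))) (at w)" for b
    using has_derivative_inner_left[OF *(1), of b] has_derivative_inner_left[OF *(2), of b]
    by (intro has_field_derivative_Complex) (simp_all add: inner_simps)
  then show "\<forall>b\<in>Basis. (\<lambda>x. Complex (u x \<bullet> b) (v x \<bullet> b)) field_differentiable (at w)"
    unfolding field_differentiable_def by blast
next
  assume "\<forall>b\<in>Basis. (\<lambda>x. Complex (u x \<bullet> b) (v x \<bullet> b)) field_differentiable (at w)"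
  then obtain D where D: "\<And>b. b \<in> Basis \<Longrightarrow>
      ((\<lambda>x. Complex (u x \<bullet> b) (v x \<bullet> b)) has_field_derivative D b) (at w)"
    unfolding field_differentiable_def by metis
  define p where "p = (\<Sum>b\<in>Basis. Re (D b) *\<^sub>R b)"
  define q where "q = (\<Sum>b\<in>Basis. (- Im (D b)) *\<^sub>R b)"
  have pq: "p \<bullet> b = Re (D b)" "q \<bullet> b = - Im (D b)" if "b \<in> Basis" for b
    using that by (simp_all add: p_def q_def inner_sum_left inner_Basis if_distrib sum.delta cong: if_cong)
  have "(u has_derivative (\<lambda>d. Re d *\<^sub>R p + Im d *\<^sub>R q)) (at w)"
    "(v has_derivative (\<lambda>d. Im d *\<^sub>R p - Re d *\<^sub>R q)) (at w)"
    unfolding has_derivative_componentwise_within[of u] has_derivative_componentwise_within[of v]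
    using has_derivative_of_Complex[OF D] by (auto simp: inner_simps pq)
  then show "cr_at u v w" by (rule cr_atI)
qed

section \<open>Separately holomorphic continuous functions\<close>

text \<open>
  By uniform continuity on a compact ball, the restrictions of a continuous function to discs
  of a fixed radius in parallel lines converge uniformly when the centres converge. This is the
  input for the two limit arguments below.
\<close>

lemma uniform_close_lines:
  fixes \<Phi> :: "complex ^ 'n \<Rightarrow> 'b::metric_space"
  assumes "open D" "z \<in> D" "continuous_on D \<Phi>"
  obtains r where "r > 0"
    "\<And>e. e > 0 \<Longrightarrow> \<exists>d>0. \<forall>z'. dist z' z < d \<longrightarrow>
      (\<forall>w\<in>cball 0 r. z' + axis h w \<in> D \<and> dist (\<Phi> (z' + axis h w)) (\<Phi> (z + axis h w)) < e)"
proof -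
  obtain s where s: "s > 0" "cball z s \<subseteq> D"
    using assms open_contains_cball by blast
  have "uniformly_continuous_on (cball z s) \<Phi>"
    using s assms by (intro compact_uniformly_continuous) (auto intro: continuous_on_subset)
  note uc = this[unfolded uniformly_continuous_on_def]
  show ?thesis
  proof (rule that[of "s/2"])
    show "s / 2 > 0" using s by simp
    fix e :: real assume "e > 0"
    then obtain d where d: "d > 0"
      "\<And>x x'. x \<in> cball z s \<Longrightarrow> x' \<in> cball z s \<Longrightarrow> dist x' x < d \<Longrightarrow> dist (\<Phi> x') (\<Phi> x) < e"
      using uc by meson
    show "\<exists>d>0. \<forall>z'. dist z' z < d \<longrightarrow>
      (\<forall>w\<in>cball 0 (s/2). z' + axis h w \<in> D \<and> dist (\<Phi> (z' + axis h w)) (\<Phi> (z + axis h w)) < e)"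
    proof (intro exI[of _ "min d (s/2)"] conjI allI impI ballI)
      show "min d (s/2) > 0" using d s by simp
      fix z' and w :: complex assume z': "dist z' z < min d (s/2)" and w: "w \<in> cball 0 (s/2)"
      have "norm (z' + axis h w - z) \<le> norm (z' - z) + norm (axis h w)"
        using norm_triangle_ineq[of "z' - z" "axis h w"] by (simp add: algebra_simps)
      then have 1: "z' + axis h w \<in> cball z s"
        using z' w by (simp add: dist_norm norm_axis norm_minus_commute)
      have 2: "z + axis h w \<in> cball z s"
        using w s by (simp add: dist_norm norm_axis)
      show "z' + axis h w \<in> D" using 1 s by auto
      show "dist (\<Phi> (z' + axis h w)) (\<Phi> (z + axis h w)) < e"
        by (rule d(2)[OF 2 1]) (use z' in \<open>simp add: dist_norm\<close>)
    qed
  qed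
qed

lemma cr_along_holomorphic_line:
  fixes u v :: "'n::finite cvec \<Rightarrow> 'b::euclidean_space"
  assumes cr: "\<And>w. w \<in> S \<Longrightarrow> cr_along h u v (z + axis h w)" and b: "b \<in> Basis"
  shows "(\<lambda>w. Complex (u (z + axis h w) \<bullet> b) (v (z + axis h w) \<bullet> b)) holomorphic_on S"
  unfolding holomorphic_on_def
proof
  fix w assume "w \<in> S"
  from cr_along_line[OF cr[OF this]]
  show "(\<lambda>w. Complex (u (z + axis h w) \<bullet> b) (v (z + axis h w) \<bullet> b)) field_differentiable at w within S"
    unfolding cr_at_componentwise using b field_differentiable_at_within by blast
qed

lemma continuous_on_Complex_inner:
  assumes "continuous_on D u" "continuous_on D v"
  shows "continuous_on D (\<lambda>z. Complex (u z \<bullet> b) (v z \<bullet> b))"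
  unfolding Complex_eq using assms by (intro continuous_intros)

text \<open>
  By the Cauchy estimate, the derivative at the centre of a disc depends continuously on the
  function in the supremum norm, and by the preceding uniformity that function depends
  continuously on the centre. So joint continuity and holomorphy in one variable force joint
  continuity of the derivative in that variable.
\<close>

lemma cr_partials_continuous:
  fixes u v :: "'n::finite cvec \<Rightarrow> 'b::euclidean_space"
  assumes D: "open D" and cont: "continuous_on D u" "continuous_on D v"
    and cr: "\<And>z. z \<in> D \<Longrightarrow> cr_along h u v z"
  obtains P Q where "continuous_on D P" "continuous_on D Q"
    "\<forall>z\<in>D. ((\<lambda>w. u (z + axis h w)) has_derivative (\<lambda>d. Re d *\<^sub>R P z + Im d *\<^sub>R Q z)) (at 0)"
    "\<forall>z\<in>D. ((\<lambda>w. v (z + axis h w)) has_derivative (\<lambda>d. Im d *\<^sub>R P z - Re d *\<^sub>R Q z)) (at 0)"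
proof -
  obtain P Q where
    P: "\<And>z. z \<in> D \<Longrightarrow> ((\<lambda>w. u (z + axis h w)) has_derivative (\<lambda>d. Re d *\<^sub>R P z + Im d *\<^sub>R Q z)) (at 0)"
    "\<And>z. z \<in> D \<Longrightarrow> ((\<lambda>w. v (z + axis h w)) has_derivative (\<lambda>d. Im d *\<^sub>R P z - Re d *\<^sub>R Q z)) (at 0)"
  proof -
    have "\<forall>z. \<exists>p q. z \<in> D \<longrightarrow>
        ((\<lambda>w. u (z + axis h w)) has_derivative (\<lambda>d. Re d *\<^sub>R p + Im d *\<^sub>R q)) (at 0) \<and>
        ((\<lambda>w. v (z + axis h w)) has_derivative (\<lambda>d. Im d *\<^sub>R p - Re d *\<^sub>R q)) (at 0)"
      using cr unfolding cr_along_def cr_at_def by simp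
    then obtain P Q where "\<forall>z. z \<in> D \<longrightarrow>
        ((\<lambda>w. u (z + axis h w)) has_derivative (\<lambda>d. Re d *\<^sub>R P z + Im d *\<^sub>R Q z)) (at 0) \<and>
        ((\<lambda>w. v (z + axis h w)) has_derivative (\<lambda>d. Im d *\<^sub>R P z - Re d *\<^sub>R Q z)) (at 0)"
      unfolding choice_iff by (elim exE)
    then show ?thesis by (intro that[of P Q]) simp_all
  qed
  have cb: "continuous_on D (\<lambda>z. Complex (P z \<bullet> b) (- (Q z \<bullet> b)))" if b: "b \<in> Basis" for b
    unfolding continuous_on_eq_continuous_at[OF D] continuous_at_eps_delta
  proof (intro ballI allI impI)
    fix z and e :: real assume z: "z \<in> D" and e: "e > 0"
    define \<Phi> where "\<Phi> z = Complex (u z \<bullet> b) (v z \<bullet> b)" for z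
    have contPhi: "continuous_on D \<Phi>"
      unfolding \<Phi>_def by (intro continuous_on_Complex_inner cont)
    have der: "((\<lambda>w. \<Phi> (z + axis h w)) has_field_derivative Complex (P z \<bullet> b) (- (Q z \<bullet> b))) (at 0)"
      if "z \<in> D" for z
      unfolding \<Phi>_def
      using has_derivative_inner_left[OF P(1)[OF that], of b] has_derivative_inner_left[OF P(2)[OF that], of b]
      by (intro has_field_derivative_Complex) (simp_all add: inner_simps)
    obtain r where r: "r > 0"
      "\<And>e. e > 0 \<Longrightarrow> \<exists>d>0. \<forall>z'. dist z' z < d \<longrightarrow>
        (\<forall>w\<in>cball 0 r. z' + axis h w \<in> D \<and> dist (\<Phi> (z' + axis h w)) (\<Phi> (z + axis h w)) < e)"
      using uniform_close_lines[OF D z contPhi] by metis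
    \<comment> \<open>A bound \<open>e * r / 2\<close> on discs of radius \<open>r\<close> makes the derivatives differ by at most \<open>e / 2\<close>.\<close>
    obtain d where d: "d > 0" "\<And>z' w. dist z' z < d \<Longrightarrow> w \<in> cball 0 r \<Longrightarrow>
        z' + axis h w \<in> D \<and> dist (\<Phi> (z' + axis h w)) (\<Phi> (z + axis h w)) < e * r / 2"
      using r(2)[of "e * r / 2"] e r(1) by auto
    show "\<exists>d>0. \<forall>z'. dist z' z < d \<longrightarrow>
       dist (Complex (P z' \<bullet> b) (- (Q z' \<bullet> b))) (Complex (P z \<bullet> b) (- (Q z \<bullet> b))) < e"
    proof (intro exI[of _ d] conjI d(1) allI impI)
      fix z' assume z': "dist z' z < d"
      have z'D: "z' \<in> D" using d(2)[OF z', of 0] r(1) by (simp add: axis_def zero_vec_def[symmetric])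
      have inD: "z' + axis h w \<in> D" "z + axis h w \<in> D" if "w \<in> cball 0 r" for w
        using d(2)[OF z' that] d(2)[of z w] that d(1) by auto
      define \<psi> where "\<psi> w = \<Phi> (z' + axis h w) - \<Phi> (z + axis h w)" for w
      have "norm ((deriv ^^ 1) \<psi> 0) \<le> fact 1 * (e * r / 2) / r ^ 1"
      proof (rule Cauchy_higher_deriv_bound)
        show "\<psi> holomorphic_on ball 0 r"
          unfolding \<psi>_def \<Phi>_def
          by (intro holomorphic_on_diff cr_along_holomorphic_line cr b inD) auto
        show "continuous_on (cball 0 r) \<psi>"
          unfolding \<psi>_def using inD
          by (intro continuous_intros continuous_on_compose2[OF contPhi]) auto
        show "\<psi> w \<in> ball 0 (e * r / 2)" if "w \<in> ball 0 r" for w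
          using d(2)[OF z', of w] that by (simp add: \<psi>_def dist_norm norm_minus_commute)
      qed (use r in auto)
      moreover have "(\<psi> has_field_derivative
          (Complex (P z' \<bullet> b) (- (Q z' \<bullet> b)) - Complex (P z \<bullet> b) (- (Q z \<bullet> b)))) (at 0)"
        unfolding \<psi>_def by (intro DERIV_diff der z z'D)
      ultimately have "dist (Complex (P z' \<bullet> b) (- (Q z' \<bullet> b))) (Complex (P z \<bullet> b) (- (Q z \<bullet> b))) \<le> e / 2"
        using r by (simp add: DERIV_imp_deriv dist_norm)
      then show "dist (Complex (P z' \<bullet> b) (- (Q z' \<bullet> b))) (Complex (P z \<bullet> b) (- (Q z \<bullet> b))) < e"
        using e by simp
    qed
  qed
  have "continuous_on D (\<lambda>z. P z \<bullet> b)" "continuous_on D (\<lambda>z. Q z \<bullet> b)" if "b \<in> Basis" for b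
    using continuous_on_Re[OF cb[OF that]] continuous_on_minus[OF continuous_on_Im[OF cb[OF that]]] by simp_all
  then have "continuous_on D P" "continuous_on D Q"
    unfolding continuous_on_componentwise[of D P] continuous_on_componentwise[of D Q] by auto
  with P show ?thesis by (intro that[of P Q]) simp_all
qed

text \<open>
  Moving into the imaginary direction for all indices of \<open>H\<close> at once leaves the real hyperplanes
  \<open>Im (z $ h) = 0\<close>, for every small positive \<open>t\<close>.
\<close>

definition raise_on :: "'n set \<Rightarrow> real \<Rightarrow> 'n::finite cvec" where
  "raise_on H t = (\<chi> k. if k \<in> H then \<i> * of_real t else 0)"

lemma raise_on_tendsto: "((\<lambda>t. z + raise_on H t) \<longlongrightarrow> z) (at_right 0)"
proof (rule vec_tendstoI)
  fix k
  have "((\<lambda>t::real. z $ k + \<i> * of_real t) \<longlongrightarrow> z $ k + \<i> * of_real 0) (at_right 0)"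
    by (intro tendsto_intros)
  then show "((\<lambda>t. (z + raise_on H t) $ k) \<longlongrightarrow> z $ k) (at_right 0)"
    by (cases "k \<in> H") (simp_all add: raise_on_def)
qed

lemma raise_on_off_real:
  assumes "open D" "z \<in> D"
  shows "eventually (\<lambda>t. z + raise_on H t \<in> off_real D H) (at_right 0)"
proof -
  have D: "eventually (\<lambda>t. z + raise_on H t \<in> D) (at_right 0)"
    using topological_tendstoD[OF raise_on_tendsto assms] .
  have "eventually (\<lambda>t. Im (z $ k) + t \<noteq> 0) (at_right 0)" for k
  proof (cases "Im (z $ k) < 0")
    case True
    then have "eventually (\<lambda>t. t < - Im (z $ k)) (at_right 0)"
      unfolding eventually_at_right_field by (intro exI[of _ "- Im (z $ k)"]) simp
    then show ?thesis by eventually_elim simp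
  next
    case False
    have "eventually (\<lambda>t::real. t > 0) (at_right 0)" by (rule eventually_at_right_less)
    then show ?thesis by eventually_elim (use False in simp)
  qed
  then have "eventually (\<lambda>t. \<forall>k. Im (z $ k) + t \<noteq> 0) (at_right 0)"
    by (intro eventually_all_finite) auto
  with D show ?thesis
    by eventually_elim (auto simp: off_real_def raise_on_def)
qed

lemma eq_on_off_real:
  fixes u v :: "'n::finite cvec \<Rightarrow> 'b::t2_space"
  assumes D: "open D" "continuous_on D u" "continuous_on D v"
    and eq: "\<And>z. z \<in> off_real D H \<Longrightarrow> u z = v z" and z: "z \<in> D"
  shows "u z = v z"
proof -
  have lim: "((\<lambda>t. f (z + raise_on H t)) \<longlongrightarrow> f z) (at_right 0)" if "continuous_on D f" for f :: "_ \<Rightarrow> 'b"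
  proof -
    have "isCont f z" using that D(1) z by (simp add: continuous_on_eq_continuous_at)
    then show ?thesis using raise_on_tendsto by (rule isCont_tendsto_compose)
  qed
  have "eventually (\<lambda>t. u (z + raise_on H t) = v (z + raise_on H t)) (at_right 0)"
    using raise_on_off_real[OF D(1) z, of H] by eventually_elim (rule eq)
  with lim[OF D(2)] have "((\<lambda>t. v (z + raise_on H t)) \<longlongrightarrow> u z) (at_right 0)"
    by (rule Lim_transform_eventually)
  from tendsto_unique[OF _ this lim[OF D(3)]] show ?thesis by simp
qed

lemma open_off_real:
  assumes "open D"
  shows "open (off_real D H)"
proof -
  have "off_real D H = D \<inter> (\<Inter>h\<in>H. {z. Im (z $ h) \<noteq> 0})"
    by (auto simp: off_real_def)
  moreover have "open {z :: 'a cvec. Im (z $ h) \<noteq> 0}" for h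
    by (intro open_Collect_neq continuous_intros)
  ultimately show ?thesis using assms by (auto intro!: open_Int open_INT)
qed

text \<open>
  A removable singularity result with the singular set in other variables: the discs in direction
  \<open>h\<close> through the points \<open>z + raise_on H t\<close> avoid the real hyperplanes, as \<open>h \<notin> H\<close>, and the
  functions on them converge uniformly to the one through \<open>z\<close>, so Weierstrass' theorem applies.
\<close>

lemma cr_along_off_real:
  fixes u v :: "'n::finite cvec \<Rightarrow> 'b::euclidean_space"
  assumes D: "open D" and cont: "continuous_on D u" "continuous_on D v" and h: "h \<notin> H"
    and cr: "\<And>z. z \<in> off_real D H \<Longrightarrow> cr_along h u v z" and z: "z \<in> D"
  shows "cr_along h u v z"
  unfolding cr_along_def cr_at_componentwise
proof
  fix b :: 'b assume b: "b \<in> Basis"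
  define \<Phi> where "\<Phi> z = Complex (u z \<bullet> b) (v z \<bullet> b)" for z
  have contPhi: "continuous_on D \<Phi>"
    unfolding \<Phi>_def by (intro continuous_on_Complex_inner cont)
  obtain r where r: "r > 0"
    "\<And>e. e > 0 \<Longrightarrow> \<exists>d>0. \<forall>z'. dist z' z < d \<longrightarrow>
      (\<forall>w\<in>cball 0 r. z' + axis h w \<in> D \<and> dist (\<Phi> (z' + axis h w)) (\<Phi> (z + axis h w)) < e)"
    using uniform_close_lines[OF D z contPhi] by metis
  let ?\<psi> = "\<lambda>t w. \<Phi> (z + raise_on H t + axis h w)"
  have near: "eventually (\<lambda>t. \<forall>w\<in>cball 0 r. z + raise_on H t + axis h w \<in> D \<and>
      dist (?\<psi> t w) (\<Phi> (z + axis h w)) < e) (at_right 0)" if "e > 0" for e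
  proof -
    obtain d where d: "d > 0" "\<forall>z'. dist z' z < d \<longrightarrow>
      (\<forall>w\<in>cball 0 r. z' + axis h w \<in> D \<and> dist (\<Phi> (z' + axis h w)) (\<Phi> (z + axis h w)) < e)"
      using r(2)[OF \<open>e > 0\<close>] by blast
    from tendstoD[OF raise_on_tendsto d(1), of z H] show ?thesis
      by eventually_elim (use d(2) in blast)
  qed
  have hol: "eventually (\<lambda>t. continuous_on (cball 0 r) (?\<psi> t) \<and> ?\<psi> t holomorphic_on ball 0 r) (at_right 0)"
    using near[OF zero_less_one] raise_on_off_real[OF D z, of H]
  proof eventually_elim
    case (elim t)
    have "z + raise_on H t + axis h w \<in> off_real D H" if "w \<in> cball 0 r" for w
      using elim that h by (auto simp: off_real_def axis_def)
    then show ?case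
      using elim unfolding \<Phi>_def
      by (intro conjI cr_along_holomorphic_line[OF cr b] continuous_on_Complex_inner
          continuous_on_compose2[OF cont(1)] continuous_on_compose2[OF cont(2)] continuous_intros) auto
  qed
  have "uniform_limit (cball 0 r) ?\<psi> (\<lambda>w. \<Phi> (z + axis h w)) (at_right 0)"
    unfolding uniform_limit_iff
  proof (intro allI impI)
    fix e :: real assume "e > 0"
    from near[OF this] show "\<forall>\<^sub>F t in at_right 0. \<forall>w\<in>cball 0 r. dist (?\<psi> t w) (\<Phi> (z + axis h w)) < e"
      by eventually_elim blast
  qed
  from holomorphic_uniform_limit[OF hol this]
  have "(\<lambda>w. \<Phi> (z + axis h w)) holomorphic_on ball 0 r" by simp
  then show "(\<lambda>w. Complex (u (z + axis h w) \<bullet> b) (v (z + axis h w) \<bullet> b)) field_differentiable at 0"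
    unfolding \<Phi>_def using r(1) by (auto intro: holomorphic_on_imp_differentiable_at)
qed

lemma has_derivative_line_shift:
  assumes "((\<lambda>x. F (z + axis h w + axis h x)) has_derivative T) (at 0)"
  shows "((\<lambda>x. F (z + axis h x)) has_derivative T) (at (w::complex))"
proof -
  have sh: "((\<lambda>x. x - w) has_derivative (\<lambda>d. d)) (at w)"
    by (auto intro!: derivative_eq_intros)
  have "((\<lambda>x. F (z + axis h w + axis h x)) has_derivative T) (at (w - w))"
    using assms by simp
  from has_derivative_compose[OF sh this] show ?thesis
    by (simp add: add.assoc flip: axis_add)
qed

text \<open>
  The usual proof that continuous partial derivatives suffice, one coordinate at a time. The
  induction needs strict differentiability, with a moving base point \<open>y\<close>, because the increment
  in the last coordinate is taken after the others have been added.
\<close>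

lemma C1_on_of_partials:
  fixes F :: "'n::finite cvec \<Rightarrow> 'b::real_normed_vector"
  assumes D: "open D" and cont: "\<And>h. continuous_on D (P h)" "\<And>h. continuous_on D (Q h)"
    and der: "\<And>h z. z \<in> D \<Longrightarrow>
      ((\<lambda>w. F (z + axis h w)) has_derivative (\<lambda>d. Re d *\<^sub>R P h z + Im d *\<^sub>R Q h z)) (at 0)"
  shows "C1_on D F"
proof -
  let ?L = "\<lambda>h z d. Re d *\<^sub>R P h z + Im d *\<^sub>R Q h z"
  have der': "((\<lambda>w. F (z + axis h w)) has_derivative ?L h (z + axis h w)) (at w)"
    if "z + axis h w \<in> D" for h z w
    by (rule has_derivative_line_shift[OF der[OF that]])
  have strict: "\<exists>\<delta>>0. \<forall>y d. norm (y - z) < \<delta> \<longrightarrow> norm d < \<delta> \<longrightarrow> (\<forall>k. k \<notin> A \<longrightarrow> d $ k = 0) \<longrightarrow>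
      norm (F (y + d) - F y - (\<Sum>h\<in>A. ?L h z (d $ h))) \<le> e * norm d"
    if z: "z \<in> D" and "e > 0" for z e A
    using finite[of A] \<open>e > 0\<close>
  proof (induction A arbitrary: e rule: finite_induct)
    case empty
    have "(\<forall>k. d $ k = 0) \<longleftrightarrow> d = 0" for d :: "'n cvec" by (simp add: vec_eq_iff)
    then show ?case by (intro exI[of _ 1]) auto
  next
    case (insert h A)
    obtain \<delta>1 where \<delta>1: "\<delta>1 > 0" "\<And>y d. norm (y - z) < \<delta>1 \<Longrightarrow> norm d < \<delta>1 \<Longrightarrow> (\<forall>k. k \<notin> A \<longrightarrow> d $ k = 0) \<Longrightarrow>
      norm (F (y + d) - F y - (\<Sum>h\<in>A. ?L h z (d $ h))) \<le> e / 2 * norm d"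
      using insert.IH[of "e / 2"] insert.prems by auto
    have "isCont (P h) z" "isCont (Q h) z"
      using cont z D by (auto simp: continuous_on_eq_continuous_at)
    then obtain \<delta>2 \<delta>3 where \<delta>2: "\<delta>2 > 0" "\<And>x. dist x z < \<delta>2 \<Longrightarrow> dist (P h x) (P h z) < e / 4"
      and \<delta>3: "\<delta>3 > 0" "\<And>x. dist x z < \<delta>3 \<Longrightarrow> dist (Q h x) (Q h z) < e / 4"
      using insert.prems unfolding continuous_at_eps_delta by (metis zero_less_divide_iff zero_less_numeral)
    obtain \<delta>4 where \<delta>4: "\<delta>4 > 0" "ball z \<delta>4 \<subseteq> D" using D z open_contains_ball by blast
    \<comment> \<open>One third, since the base point, the earlier and the last increments each move by less than \<open>\<delta>\<close>.\<close>
    define \<delta> where "\<delta> = Min {\<delta>1, \<delta>2, \<delta>3, \<delta>4} / 3"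
    have \<delta>: "\<delta> > 0" "3 * \<delta> \<le> \<delta>1" "3 * \<delta> \<le> \<delta>2" "3 * \<delta> \<le> \<delta>3" "3 * \<delta> \<le> \<delta>4"
      using \<delta>1 \<delta>2 \<delta>3 \<delta>4 unfolding \<delta>_def by auto
    show ?case
    proof (intro exI[of _ \<delta>] conjI \<delta>(1) allI impI)
      fix y d :: "'n cvec" assume y: "norm (y - z) < \<delta>" and d: "norm d < \<delta>"
        and supp: "\<forall>k. k \<notin> insert h A \<longrightarrow> d $ k = 0"
      define d' where "d' = vec_upd d h 0"
      have dd': "d = d' + axis h (d $ h)"
        by (simp add: d'_def vec_eq_iff vec_upd_nth axis_def)
      have "norm d' \<le> norm d"
        by (rule norm_le_componentwise_cart) (simp add: d'_def vec_upd_nth)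
      have dh: "norm (d $ h) \<le> norm d" by (rule Finite_Cartesian_Product.norm_nth_le)
      have "norm (F (y + d') - F y - (\<Sum>h\<in>A. ?L h z (d' $ h))) \<le> e / 2 * norm d'"
        using y d \<open>norm d' \<le> norm d\<close> \<delta> supp
        by (intro \<delta>1(2)) (auto simp: d'_def vec_upd_nth)
      also have "(\<Sum>h\<in>A. ?L h z (d' $ h)) = (\<Sum>h\<in>A. ?L h z (d $ h))"
        using insert.hyps by (intro sum.cong) (auto simp: d'_def vec_upd_nth)
      finally have 1: "norm (F (y + d') - F y - (\<Sum>h\<in>A. ?L h z (d $ h))) \<le> e / 2 * norm d"
        using \<open>norm d' \<le> norm d\<close> insert.prems by (smt (verit) mult_left_mono half_gt_zero)
      have near: "norm (y + d' + axis h w - z) < 3 * \<delta>" if "w \<in> ball 0 \<delta>" for w :: complex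
      proof -
        have "norm (y + d' + axis h w - z) \<le> norm (y - z) + norm d' + norm (axis h w)"
          using norm_triangle_ineq[of "y - z + d'" "axis h w"] norm_triangle_ineq[of "y - z" d']
          by (simp add: algebra_simps)
        then show ?thesis using y d \<open>norm d' \<le> norm d\<close> that by (simp add: norm_axis)
      qed
      define g where "g w = F (y + d' + axis h w) - ?L h z w" for w
      have "norm (g (d $ h) - g 0) \<le> (e / 2) * norm (d $ h - 0)"
      proof (rule differentiable_bound[where S = "ball 0 \<delta>"])
        show "convex (ball (0::complex) \<delta>)" by simp
        fix w :: complex assume w: "w \<in> ball 0 \<delta>"
        let ?x = "y + d' + axis h w"
        have "dist ?x z < 3 * \<delta>" using near[OF w] by (simp add: dist_norm)
        then have xD: "?x \<in> D" and xP: "norm (P h ?x - P h z) < e / 4" and xQ: "norm (Q h ?x - Q h z) < e / 4"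
          using \<delta> \<delta>2(2)[of ?x] \<delta>3(2)[of ?x] \<delta>4(2) by (auto simp: dist_norm norm_minus_commute mem_ball)
        have lin: "(?L h z has_derivative ?L h z) (at w)"
          by (auto intro!: derivative_eq_intros)
        show "(g has_derivative (\<lambda>a. ?L h ?x a - ?L h z a)) (at w within ball 0 \<delta>)"
          unfolding g_def by (intro has_derivative_at_withinI[OF has_derivative_diff[OF der'[OF xD] lin]])
        show "onorm (\<lambda>a. ?L h ?x a - ?L h z a) \<le> e / 2"
        proof (rule onorm_le)
          fix a :: complex
          have "?L h ?x a - ?L h z a = Re a *\<^sub>R (P h ?x - P h z) + Im a *\<^sub>R (Q h ?x - Q h z)"
            by (simp add: algebra_simps)
          also have "norm \<dots> \<le> \<bar>Re a\<bar> * norm (P h ?x - P h z) + \<bar>Im a\<bar> * norm (Q h ?x - Q h z)"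
            using norm_triangle_ineq by (metis norm_scaleR)
          also have "\<dots> \<le> norm a * (e / 4) + norm a * (e / 4)"
            using xP xQ abs_Re_le_cmod[of a] abs_Im_le_cmod[of a] by (intro add_mono mult_mono) auto
          finally show "norm (?L h ?x a - ?L h z a) \<le> e / 2 * norm a" by simp
        qed
      qed (use d dh \<delta>(1) in auto)
      then have 2: "norm (F (y + d) - F (y + d') - ?L h z (d $ h)) \<le> e / 2 * norm d"
      proof -
        have "g (d $ h) - g 0 = F (y + d) - F (y + d') - ?L h z (d $ h)"
        proof -
          have eq: "y + d' + axis h (d $ h) = y + d" by (metis dd' add.assoc)
          show ?thesis unfolding g_def eq by (simp add: axis_eq_0_iff[THEN iffD2])
        qed
        moreover have "e / 2 * norm (d $ h - 0) \<le> e / 2 * norm d"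
          using dh insert.prems by (intro mult_left_mono) simp_all
        ultimately show ?thesis
          using \<open>norm (g (d $ h) - g 0) \<le> _\<close> by (metis order_trans)
      qed
      have eq: "F (y + d) - F y - (\<Sum>h\<in>insert h A. ?L h z (d $ h)) =
          (F (y + d') - F y - (\<Sum>h\<in>A. ?L h z (d $ h))) + (F (y + d) - F (y + d') - ?L h z (d $ h))"
        using insert.hyps by (simp add: algebra_simps)
      show "norm (F (y + d) - F y - (\<Sum>h\<in>insert h A. ?L h z (d $ h))) \<le> e * norm d"
        unfolding eq by (rule norm_triangle_le) (use 1 2 in simp)
    qed
  qed
  define F' where "F' z = (\<Sum>h\<in>UNIV. (blinfun_scaleR_left (P h z) o\<^sub>L Blinfun (\<lambda>d. Re (d $ h))) +
      (blinfun_scaleR_left (Q h z) o\<^sub>L Blinfun (\<lambda>d. Im (d $ h))))" for z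
  have bl: "bounded_linear (\<lambda>d::'n cvec. Re (d $ h))" "bounded_linear (\<lambda>d::'n cvec. Im (d $ h))" for h
    by (rule bounded_linear_compose[OF bounded_linear_Re bounded_linear_vec_nth],
        rule bounded_linear_compose[OF bounded_linear_Im bounded_linear_vec_nth])
  have F': "blinfun_apply (F' z) d = (\<Sum>h\<in>UNIV. ?L h z (d $ h))" for z d
    unfolding F'_def blinfun.sum_left
    by (simp add: blinfun.add_left bounded_linear_Blinfun_apply bl)
  show ?thesis
    unfolding C1_on_def
  proof (intro exI[of _ F'] conjI ballI)
    show "continuous_on D F'"
      unfolding F'_def
      by (intro continuous_intros bounded_linear.continuous_on[OF bounded_linear_blinfun_scaleR_left] cont)
    fix z assume z: "z \<in> D"
    show "(F has_derivative blinfun_apply (F' z)) (at z)"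
      unfolding has_derivative_at_alt
    proof (intro conjI blinfun.bounded_linear_right allI impI)
      fix e :: real assume "e > 0"
      from strict[OF z this, of UNIV] obtain \<delta> where \<delta>: "\<delta> > 0"
        "\<And>y d. norm (y - z) < \<delta> \<Longrightarrow> norm d < \<delta> \<Longrightarrow>
          norm (F (y + d) - F y - (\<Sum>h\<in>UNIV. ?L h z (d $ h))) \<le> e * norm d" by auto
      show "\<exists>d>0. \<forall>y. norm (y - z) < d \<longrightarrow> norm (F y - F z - blinfun_apply (F' z) (y - z)) \<le> e * norm (y - z)"
      proof (intro exI[of _ \<delta>] conjI \<delta>(1) allI impI)
        fix y assume "norm (y - z) < \<delta>"
        then show "norm (F y - F z - blinfun_apply (F' z) (y - z)) \<le> e * norm (y - z)"
          using \<delta>(2)[of z "y - z"] \<delta>(1) unfolding F' by simp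
      qed
    qed
  qed
qed

section \<open>Division by the imaginary part of a coordinate\<close>

text \<open>
  On the hyperplane \<open>Im (z $ h) = 0\<close> the quotient is continued by its limit, the derivative in
  the imaginary direction.
\<close>

definition im_quotient :: "'n \<Rightarrow> ('n::finite cvec \<Rightarrow> 'b::real_normed_vector) \<Rightarrow> 'n cvec \<Rightarrow> 'b" where
  "im_quotient h u z = (if Im (z $ h) = 0 then dir_deriv u z (axis h \<i>) else u z /\<^sub>R Im (z $ h))"

lemma dir_deriv_has_derivative:
  assumes "(u has_derivative T) (at x)"
  shows "dir_deriv u x v = T v"
proof -
  have "((\<lambda>t::real. x + t *\<^sub>R v) has_derivative (\<lambda>t. t *\<^sub>R v)) (at 0)"
    by (auto intro!: derivative_eq_intros)
  from has_derivative_compose[OF this, of u T] assms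
  have "((\<lambda>t. u (x + t *\<^sub>R v)) has_derivative (\<lambda>t. T (t *\<^sub>R v))) (at 0)" by simp
  moreover have "T (t *\<^sub>R v) = t *\<^sub>R T v" for t
    using assms by (intro linear_scale has_derivative_linear)
  ultimately have "((\<lambda>t. u (x + t *\<^sub>R v)) has_vector_derivative T v) (at 0)"
    by (simp add: has_vector_derivative_def)
  then show ?thesis unfolding dir_deriv_def by (rule vector_derivative_at)
qed

lemma dir_deriv_line:
  assumes "((\<lambda>w. u (z + axis h w)) has_derivative T) (at 0)"
  shows "dir_deriv u z (axis h a) = T (a::complex)"
  using dir_deriv_has_derivative[OF assms, of a] by (simp add: dir_deriv_def axis_scaleR)

text \<open>
  Near a real point, the mean value theorem on the segment from the hyperplane to \<open>z\<close> compares
  \<open>u z\<close> with \<open>Im (z $ h)\<close> times the derivative at the limit point.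
\<close>

lemma continuous_on_im_quotient:
  fixes u :: "'n::finite cvec \<Rightarrow> 'b::real_normed_vector"
  assumes D: "open D" and cont: "continuous_on D u" "continuous_on D Q"
    and der: "\<And>z. z \<in> D \<Longrightarrow>
      ((\<lambda>w. u (z + axis h w)) has_derivative (\<lambda>d. Re d *\<^sub>R P z + Im d *\<^sub>R Q z)) (at 0)"
    and zero: "\<And>z. z \<in> D \<Longrightarrow> Im (z $ h) = 0 \<Longrightarrow> u z = 0"
  shows "continuous_on D (im_quotient h u)"
  unfolding continuous_on_eq_continuous_at[OF D]
proof
  fix z0 assume z0: "z0 \<in> D"
  show "isCont (im_quotient h u) z0"
  proof (cases "Im (z0 $ h) = 0")
    case False
    have op: "open (off_real D {h})" by (rule open_off_real[OF D])
    have "continuous_on (off_real D {h}) (\<lambda>z. u z /\<^sub>R Im (z $ h))"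
      by (intro continuous_intros continuous_on_subset[OF cont(1)]) (auto simp: off_real_def)
    then have "continuous_on (off_real D {h}) (im_quotient h u)"
      by (rule continuous_on_eq) (auto simp: im_quotient_def off_real_def)
    moreover have "z0 \<in> off_real D {h}" using z0 False by (simp add: off_real_def)
    ultimately show ?thesis using op by (simp add: continuous_on_eq_continuous_at)
  next
    case True
    have quot0: "im_quotient h u z = Q z" if "z \<in> D" "Im (z $ h) = 0" for z
      using dir_deriv_line[OF der[OF that(1)], of \<i>] that by (simp add: im_quotient_def)
    show ?thesis
      unfolding continuous_at_eps_delta
    proof (intro allI impI)
      fix e :: real assume e: "e > 0"
      have "isCont Q z0" using cont(2) D z0 by (simp add: continuous_on_eq_continuous_at)
      then obtain \<delta>1 where \<delta>1: "\<delta>1 > 0" "\<And>x. dist x z0 < \<delta>1 \<Longrightarrow> dist (Q x) (Q z0) < e / 2"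
        using e unfolding continuous_at_eps_delta by (metis half_gt_zero)
      obtain \<delta>2 where \<delta>2: "\<delta>2 > 0" "ball z0 \<delta>2 \<subseteq> D" using D z0 open_contains_ball by blast
      define \<delta> where "\<delta> = min \<delta>1 \<delta>2"
      show "\<exists>d>0. \<forall>z. dist z z0 < d \<longrightarrow> dist (im_quotient h u z) (im_quotient h u z0) < e"
      proof (intro exI[of _ \<delta>] conjI allI impI)
        show "\<delta> > 0" using \<delta>1 \<delta>2 by (simp add: \<delta>_def)
        fix z assume z: "dist z z0 < \<delta>"
        have zD: "z \<in> D" using z \<delta>2(2) by (auto simp: \<delta>_def dist_commute)
        show "dist (im_quotient h u z) (im_quotient h u z0) < e"
        proof (cases "Im (z $ h) = 0")
          case True
          then show ?thesis
            using \<delta>1(2)[of z] z e by (simp add: quot0 zD z0 \<open>Im (z0 $ h) = 0\<close> \<delta>_def)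
        next
          case False
          define b where "b = Im (z $ h)"
          \<comment> \<open>The foot of \<open>z\<close> on the hyperplane; the segment from it to \<open>z\<close> is nowhere farther from \<open>z0\<close> than \<open>z\<close>.\<close>
          define y where "y = z - axis h (\<i> * of_real b)"
          let ?S = "closed_segment 0 b"
          have near: "norm (y + axis h (\<i> * of_real s) - z0) < \<delta>" if s: "s \<in> ?S" for s
          proof -
            have sb: "\<bar>s\<bar> \<le> \<bar>b\<bar>" using s by (auto simp: closed_segment_eq_real_ivl split: if_splits)
            have "norm (y + axis h (\<i> * of_real s) - z0) \<le> norm (z - z0)"
            proof (rule norm_le_componentwise_cart)
              fix k
              show "norm ((y + axis h (\<i> * of_real s) - z0) $ k) \<le> norm ((z - z0) $ k)"
              proof (cases "k = h")
                case True
                have "(y + axis h (\<i> * of_real s) - z0) $ h = Complex (Re (z $ h) - Re (z0 $ h)) s"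
                  "(z - z0) $ h = Complex (Re (z $ h) - Re (z0 $ h)) b"
                  using \<open>Im (z0 $ h) = 0\<close> by (simp_all add: y_def b_def complex_eq_iff)
                then show ?thesis using sb True by (simp add: cmod_def abs_le_square_iff)
              next
                case False
                then show ?thesis by (simp add: y_def axis_def)
              qed
            qed
            then show ?thesis using z by (simp add: dist_norm)
          qed
          have inD: "y + axis h (\<i> * of_real s) \<in> D" if "s \<in> ?S" for s
            using near[OF that] \<delta>2(2) by (auto simp: \<delta>_def dist_norm norm_minus_commute)
          define g where "g s = u (y + axis h (\<i> * of_real s)) - s *\<^sub>R Q z0" for s
          have "norm (g b - g 0) \<le> (e / 2) * norm (b - 0)"
          proof (rule differentiable_bound[where S = ?S])
            fix s assume s: "s \<in> ?S"
            let ?x = "y + axis h (\<i> * of_real s)"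
            have sh: "((\<lambda>s'. \<i> * of_real (s' - s)) has_derivative (\<lambda>d. \<i> * of_real d)) (at s within ?S)"
              by (auto intro!: derivative_eq_intros)
            have "((\<lambda>w. u (?x + axis h w)) has_derivative (\<lambda>d. Re d *\<^sub>R P ?x + Im d *\<^sub>R Q ?x))
                (at (\<i> * of_real (s - s)))"
              using der[OF inD[OF s]] by simp
            from has_derivative_compose[OF sh this]
            have "((\<lambda>s'. u (y + axis h (\<i> * of_real s'))) has_derivative (\<lambda>d. d *\<^sub>R Q ?x)) (at s within ?S)"
              by (simp add: add.assoc distrib_left[symmetric] flip: axis_add)
            moreover have "((\<lambda>s. s *\<^sub>R Q z0) has_derivative (\<lambda>d. d *\<^sub>R Q z0)) (at s within ?S)"
              by (auto intro!: derivative_eq_intros)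
            ultimately show "(g has_derivative (\<lambda>d. d *\<^sub>R Q ?x - d *\<^sub>R Q z0)) (at s within ?S)"
              unfolding g_def by (rule has_derivative_diff)
            have "norm (Q ?x - Q z0) < e / 2"
              using \<delta>1(2)[of ?x] near[OF s] by (simp add: dist_norm \<delta>_def)
            then have "\<bar>d\<bar> * norm (Q ?x - Q z0) \<le> \<bar>d\<bar> * (e / 2)" for d
              by (intro mult_left_mono) auto
            then show "onorm (\<lambda>d. d *\<^sub>R Q ?x - d *\<^sub>R Q z0) \<le> e / 2"
              by (intro onorm_le) (simp add: mult.commute flip: scaleR_diff_right)
          qed auto
          moreover have "g b = u z - b *\<^sub>R Q z0" by (simp add: g_def y_def)
          moreover have "g 0 = 0"
          proof -
            have "y \<in> D" using inD[of 0] by (simp add: axis_eq_0_iff[THEN iffD2])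
            moreover have "Im (y $ h) = 0" by (simp add: y_def b_def)
            ultimately show ?thesis using zero by (simp add: g_def axis_eq_0_iff[THEN iffD2])
          qed
          ultimately have "norm (u z - b *\<^sub>R Q z0) \<le> e / 2 * \<bar>b\<bar>" by simp
          moreover have "im_quotient h u z - Q z0 = (u z - b *\<^sub>R Q z0) /\<^sub>R b"
            using False by (simp add: im_quotient_def b_def algebra_simps)
          ultimately have "norm (im_quotient h u z - Q z0) \<le> e / 2"
            using False by (simp add: b_def divide_simps)
          then show ?thesis using e by (simp add: dist_norm quot0 z0 \<open>Im (z0 $ h) = 0\<close>)
        qed
      qed
    qed
  qed
qed

section \<open>Stem functions regular in the later variables\<close>

text \<open>
  The common shape of all stem functions in the proof: for \<open>A = {}\<close> these are the holomorphic
  stem functions, and for \<open>A = seg m\<close> they are stem functions of the extended spherical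
  components, which no longer contain the units of the first \<open>m\<close> variables and are holomorphic
  in the remaining ones.
\<close>

definition regular_off :: "'n::finite cvec set \<Rightarrow> 'n set \<Rightarrow> 'n stem \<Rightarrow> bool" where
  "regular_off D A F \<longleftrightarrow> stem_fun D F \<and> (\<forall>z\<in>D. \<forall>L. \<not> L \<subseteq> - A \<longrightarrow> F z $ L = 0) \<and>
     (\<forall>h L z. h \<notin> A \<longrightarrow> h \<notin> L \<longrightarrow> z \<in> D \<longrightarrow> cr_along h (\<lambda>z. F z $ L) (\<lambda>z. F z $ insert h L) z)"

lemma stem_J_nth: "stem_J h v $ L = (if h \<in> L then v $ (L - {h}) else - v $ insert h L)"
proof -
  have iff: "sym_diff K {h} = L \<longleftrightarrow> K = sym_diff L {h}" for K by auto
  have "stem_J h v $ L = (\<Sum>K\<in>UNIV. if K = sym_diff L {h} then (-1) ^ card (K \<inter> {h}) * v $ K else 0)"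
    unfolding stem_J_def sum_component by (intro sum.cong refl) (auto simp: axis_def iff)
  also have "\<dots> = (-1) ^ card (sym_diff L {h} \<inter> {h}) * v $ sym_diff L {h}" by simp
  also have "\<dots> = (if h \<in> L then v $ (L - {h}) else - v $ insert h L)"
    unfolding neg_one_power_card_sing by auto
  finally show ?thesis .
qed

lemma axis_complex: "axis h d = Re d *\<^sub>R axis h 1 + Im d *\<^sub>R axis h \<i>"
  by (simp add: vec_eq_iff axis_def complex_eq_iff)

text \<open>
  The equation \<open>stem_dbar h F z = 0\<close> couples only the components \<open>L\<close> and \<open>insert h L\<close>, and for
  these two it is the Cauchy-Riemann system.
\<close>

lemma holomorphic_stem_imp_regular_off:
  fixes F :: "'n::finite stem"
  assumes "holomorphic_stem D F"
  shows "regular_off D {} F"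
  unfolding regular_off_def
proof (intro conjI allI impI ballI)
  show "stem_fun D F" using assms by (simp add: holomorphic_stem_def)
  fix h :: 'n and L z assume hL: "h \<notin> L" and z: "z \<in> D"
  obtain T where T: "(F has_derivative T) (at z)"
    using assms z unfolding holomorphic_stem_def C1_on_def by blast
  define p where "p = T (axis h 1)"
  define q where "q = T (axis h \<i>)"
  have lin: "linear T" using T by (rule has_derivative_linear)
  have line: "((\<lambda>w. F (z + axis h w) $ K) has_derivative (\<lambda>d. Re d *\<^sub>R p $ K + Im d *\<^sub>R q $ K)) (at 0)" for K
  proof -
    have "((\<lambda>w. z + axis h w) has_derivative axis h) (at 0)"
      by (rule has_derivative_eq_rhs[OF has_derivative_add[OF has_derivative_const
            bounded_linear_imp_has_derivative[OF bounded_linear_axis]]]) simp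
    from has_derivative_compose[OF this, of F T] T
    have "((\<lambda>w. F (z + axis h w)) has_derivative (\<lambda>d. T (axis h d))) (at 0)"
      by (simp add: axis_eq_0_iff[THEN iffD2])
    from bounded_linear.has_derivative[OF bounded_linear_vec_nth this, of K]
    have "((\<lambda>w. F (z + axis h w) $ K) has_derivative (\<lambda>d. T (axis h d) $ K)) (at 0)" .
    moreover have "T (axis h d) $ K = Re d *\<^sub>R p $ K + Im d *\<^sub>R q $ K" for d
      by (subst axis_complex) (simp add: linear_add[OF lin] linear_scale[OF lin] p_def q_def)
    ultimately show ?thesis by simp
  qed
  have "stem_dbar h F z = 0" using assms z by (simp add: holomorphic_stem_def)
  then have dbar: "p + stem_J h q = 0"
    by (simp add: stem_dbar_def dir_deriv_has_derivative[OF T] p_def q_def)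
  have "p $ L = q $ insert h L" "q $ L = - p $ insert h L"
    using arg_cong[OF dbar, of "\<lambda>v. v $ L"] arg_cong[OF dbar, of "\<lambda>v. v $ insert h L"] hL
    by (simp_all add: stem_J_nth eq_neg_iff_add_eq_0 add.commute)
  then show "cr_along h (\<lambda>z. F z $ L) (\<lambda>z. F z $ insert h L) z"
    unfolding cr_along_def using line[of L] line[of "insert h L"]
    by (intro cr_atI[where p = "p $ L" and q = "q $ L"]) (simp_all add: add.commute)
qed auto

text \<open>
  Separate holomorphy in each variable together with continuity gives continuous partial
  derivatives, hence a continuously differentiable stem function.
\<close>

lemma regular_off_imp_holomorphic_stem:
  fixes F :: "'n::finite stem"
  assumes D: "open D" and F: "regular_off D {} F"
  shows "holomorphic_stem D F"
proof -
  have stem: "stem_fun D F" and cont: "continuous_on D (\<lambda>z. F z $ K)" for K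
    using F by (auto simp: regular_off_def stem_fun_iff continuous_on_stem_iff)
  have cr: "cr_along h (\<lambda>z. F z $ L) (\<lambda>z. F z $ insert h L) z" if "h \<notin> L" "z \<in> D" for h L z
    using F that by (simp add: regular_off_def)
  let ?der = "\<lambda>h L p q. \<forall>z\<in>D. ((\<lambda>w. F (z + axis h w) $ L) has_derivative (\<lambda>d. Re d *\<^sub>R p z + Im d *\<^sub>R q z)) (at 0)"
  have "\<exists>p q. continuous_on D p \<and> continuous_on D q \<and> ?der h L p q" for h L
  proof (cases "h \<in> L")
    case False
    obtain p q where "continuous_on D p" "continuous_on D q"
      "\<forall>z\<in>D. ((\<lambda>w. F (z + axis h w) $ L) has_derivative (\<lambda>d. Re d *\<^sub>R p z + Im d *\<^sub>R q z)) (at 0)"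
      "\<forall>z\<in>D. ((\<lambda>w. F (z + axis h w) $ insert h L) has_derivative (\<lambda>d. Im d *\<^sub>R p z - Re d *\<^sub>R q z)) (at 0)"
      by (rule cr_partials_continuous[OF D cont cont cr[OF False]])
    then show ?thesis by (intro exI[of _ p] exI[of _ q]) simp
  next
    case True
    then have ins: "insert h (L - {h}) = L" by auto
    obtain p q where "continuous_on D p" "continuous_on D q"
      "\<forall>z\<in>D. ((\<lambda>w. F (z + axis h w) $ (L - {h})) has_derivative (\<lambda>d. Re d *\<^sub>R p z + Im d *\<^sub>R q z)) (at 0)"
      "\<forall>z\<in>D. ((\<lambda>w. F (z + axis h w) $ insert h (L - {h})) has_derivative (\<lambda>d. Im d *\<^sub>R p z - Re d *\<^sub>R q z)) (at 0)"
      by (rule cr_partials_continuous[OF D cont cont cr[of h "L - {h}"]]) simp_all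
    note this(1,2) this(4)[unfolded ins]
    then show ?thesis
      by (intro exI[of _ "\<lambda>z. - q z"] exI[of _ p]) (simp add: continuous_on_minus)
  qed
  then have "\<forall>h L. \<exists>p q. continuous_on D p \<and> continuous_on D q \<and> ?der h L p q" by blast
  then obtain p q where pq: "\<forall>h L. continuous_on D (p h L) \<and> continuous_on D (q h L) \<and> ?der h L (p h L) (q h L)"
    unfolding choice_iff by (elim exE)
  define P where "P h z = (\<chi> L. p h L z)" for h z
  define Q where "Q h z = (\<chi> L. q h L z)" for h z
  have PQ: "continuous_on D (P h)" "continuous_on D (Q h)" for h
    unfolding P_def Q_def continuous_on_stem_iff using pq by simp_all
  have der: "((\<lambda>w. F (z + axis h w)) has_derivative (\<lambda>d. Re d *\<^sub>R P h z + Im d *\<^sub>R Q h z)) (at 0)"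
    if "z \<in> D" for h z
  proof (subst has_derivative_componentwise_within, rule ballI)
    fix b :: "quat ^ 'n set" assume "b \<in> Basis"
    then obtain L c where b: "b = axis L c" by (auto simp: Basis_vec_def)
    have "((\<lambda>w. F (z + axis h w) $ L) has_derivative (\<lambda>d. Re d *\<^sub>R p h L z + Im d *\<^sub>R q h L z)) (at 0)"
      using pq that by simp
    from has_derivative_inner_left[OF this, of c]
    show "((\<lambda>w. F (z + axis h w) \<bullet> b) has_derivative (\<lambda>d. (Re d *\<^sub>R P h z + Im d *\<^sub>R Q h z) \<bullet> b)) (at 0)"
      unfolding b inner_axis by (simp add: P_def Q_def)
  qed
  have "stem_dbar h F z = 0" if z: "z \<in> D" for h z
  proof -
    have dd: "dir_deriv F z (axis h 1) = P h z" "dir_deriv F z (axis h \<i>) = Q h z"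
      using dir_deriv_line[OF der[OF z], of h] by simp_all
    have "P h z $ L = (if h \<in> L then - Q h z $ (L - {h}) else Q h z $ insert h L)" for L
    proof -
      have *: "P h z $ L = Q h z $ insert h L \<and> Q h z $ L = - P h z $ insert h L" if hL: "h \<notin> L" for L
      proof -
        obtain a b where
          ab: "((\<lambda>w. F (z + axis h w) $ L) has_derivative (\<lambda>d. Re d *\<^sub>R a + Im d *\<^sub>R b)) (at 0)"
          "((\<lambda>w. F (z + axis h w) $ insert h L) has_derivative (\<lambda>d. Im d *\<^sub>R a - Re d *\<^sub>R b)) (at 0)"
          by (rule cr_atE[OF cr[OF hL z, unfolded cr_along_def]])
        have cd: "((\<lambda>w. F (z + axis h w) $ K) has_derivative (\<lambda>d. Re d *\<^sub>R P h z $ K + Im d *\<^sub>R Q h z $ K)) (at 0)" for K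
          using bounded_linear.has_derivative[OF bounded_linear_vec_nth der[OF z], where i2 = K] by simp
        show ?thesis
          using fun_cong[OF has_derivative_unique[OF ab(1) cd], of 1] fun_cong[OF has_derivative_unique[OF ab(1) cd], of \<i>]
            fun_cong[OF has_derivative_unique[OF ab(2) cd], of 1] fun_cong[OF has_derivative_unique[OF ab(2) cd], of \<i>]
          by simp (metis minus_minus)
      qed
      show ?thesis
      proof (cases "h \<in> L")
        case True
        then have "insert h (L - {h}) = L" by auto
        then show ?thesis using *[of "L - {h}"] True by simp
      next
        case False
        then show ?thesis using *[of L] by simp
      qed
    qed
    then show ?thesis
      unfolding stem_dbar_def dd by (simp add: vec_eq_iff stem_J_nth)
  qed
  moreover have "C1_on D F" by (rule C1_on_of_partials[OF D PQ der])
  ultimately show ?thesis using stem by (simp add: holomorphic_stem_def)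
qed

text \<open>
  One step of the recursion in a single variable \<open>x\<^sub>h\<close>: multiply by \<open>x\<^sub>h\<close> if \<open>c\<close> holds, then take
  the spherical derivative. The component \<open>insert h L\<close> of the product with
  \<open>\<alpha>\<^sub>h + e\<^sub>h \<beta>\<^sub>h\<close> is \<open>\<alpha>\<^sub>h F (insert h L) + \<beta>\<^sub>h F L\<close>, so only the first summand has to be
  divided by \<open>\<beta>\<^sub>h\<close> with care.
\<close>

definition stem_step :: "bool \<Rightarrow> 'n \<Rightarrow> 'n stem \<Rightarrow> 'n::{finite,linorder} stem" where
  "stem_step c h F z = (\<chi> L. if L \<subseteq> {h<..} then
      (if c then Re (z $ h) *\<^sub>R im_quotient h (\<lambda>z. F z $ insert h L) z + F z $ L
       else im_quotient h (\<lambda>z. F z $ insert h L) z) else 0)"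

primrec comp_stem :: "'n set \<Rightarrow> 'n stem \<Rightarrow> nat \<Rightarrow> 'n::{finite,linorder} stem" where
  "comp_stem K F 0 = F"
| "comp_stem K F (Suc m) = stem_step (idx (Suc m) \<in> K) (idx (Suc m)) (comp_stem K F m)"

lemma even_odd_real_zero:
  assumes "even_odd D F" "z \<in> D" "Im (z $ h) = 0" "h \<in> L"
  shows "F z $ L = 0"
proof -
  have "conj_at h z = z" using assms by (auto simp: vec_eq_iff conj_at_nth complex_eq_iff)
  then have "F z $ L = - F z $ L" using assms unfolding even_odd_def by metis
  then have "(2::real) *\<^sub>R F z $ L = 0" by (simp add: eq_neg_iff_add_eq_0 scaleR_2)
  then show ?thesis by simp
qed

lemma continuous_on_conj_at: "continuous_on D (conj_at h)"
  unfolding conj_at_def vec_upd_axis by (intro continuous_intros)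

text \<open>
  Components containing \<open>h\<close> are odd in \<open>Im (z $ h)\<close>, hence vanish at real \<open>z $ h\<close> and can be
  divided.
\<close>

lemma
  fixes F :: "'n::{finite,linorder} stem"
  assumes D: "open D" "invariant_set D" and F: "regular_off D {..<h} F" and L: "L \<subseteq> {h<..}"
  shows continuous_im_quotient_stem: "continuous_on D (im_quotient h (\<lambda>z. F z $ insert h L))"
    and stem_eq_Im_quotient: "\<And>z. z \<in> D \<Longrightarrow> F z $ insert h L = Im (z $ h) *\<^sub>R im_quotient h (\<lambda>z. F z $ insert h L) z"
proof -
  have hL: "h \<notin> L" using L by auto
  have eo: "even_odd D F" and cont: "continuous_on D (\<lambda>z. F z $ K)" for K
    using F by (auto simp: regular_off_def stem_fun_iff continuous_on_stem_iff)
  have cr: "cr_along h (\<lambda>z. F z $ L) (\<lambda>z. F z $ insert h L) z" if "z \<in> D" for z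
    using F that hL by (simp add: regular_off_def)
  have zero: "F z $ insert h L = 0" if "z \<in> D" "Im (z $ h) = 0" for z
    using even_odd_real_zero[OF eo that] by simp
  obtain P Q where PQ: "continuous_on D P" "continuous_on D Q"
    "\<forall>z\<in>D. ((\<lambda>w. F (z + axis h w) $ L) has_derivative (\<lambda>d. Re d *\<^sub>R P z + Im d *\<^sub>R Q z)) (at 0)"
    "\<forall>z\<in>D. ((\<lambda>w. F (z + axis h w) $ insert h L) has_derivative (\<lambda>d. Im d *\<^sub>R P z - Re d *\<^sub>R Q z)) (at 0)"
    by (rule cr_partials_continuous[OF D(1) cont cont cr])
  show "continuous_on D (im_quotient h (\<lambda>z. F z $ insert h L))"
    by (rule continuous_on_im_quotient[OF D(1) cont PQ(1), where P = "\<lambda>z. - Q z"])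
       (use PQ(4) zero in \<open>simp_all\<close>)
  show "F z $ insert h L = Im (z $ h) *\<^sub>R im_quotient h (\<lambda>z. F z $ insert h L) z" if "z \<in> D" for z
    using zero[OF that] by (simp add: im_quotient_def)
qed

text \<open>
  Parity and the Cauchy-Riemann equations in the variables after \<open>h\<close> hold for the quotient where
  \<open>Im (z $ h) \<noteq> 0\<close>, and both pass to the remaining points: parity by density, the equations by
  the limit theorem for discs in a direction different from \<open>h\<close>.
\<close>

lemma regular_off_stem_step:
  fixes F :: "'n::{finite,linorder} stem"
  assumes D: "open D" "invariant_set D" and F: "regular_off D {..<h} F"
  shows "regular_off D {..h} (stem_step c h F)"
proof -
  let ?V = "\<lambda>L. im_quotient h (\<lambda>z. F z $ insert h L)"
  have eo: "even_odd D F" and cont: "continuous_on D (\<lambda>z. F z $ K)" for K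
    using F by (auto simp: regular_off_def stem_fun_iff continuous_on_stem_iff)
  have cr: "cr_along k (\<lambda>z. F z $ L) (\<lambda>z. F z $ insert k L) z" if "h \<le> k" "k \<notin> L" "z \<in> D" for k L z
    using F that by (auto simp: regular_off_def)
  have V: "continuous_on D (?V L)" if "L \<subseteq> {h<..}" for L
    using continuous_im_quotient_stem[OF D F that] .
  have V_off: "?V L z = F z $ insert h L /\<^sub>R Im (z $ h)" if "z \<in> off_real D {h}" for L z
    using that by (simp add: im_quotient_def off_real_def)
  have par: "?V L (conj_at k z) = (if k \<in> L then - ?V L z else ?V L z)"
    if L: "L \<subseteq> {h<..}" and z: "z \<in> D" for L k z
  proof (rule eq_on_off_real[OF D(1) _ _ _ z])
    show "continuous_on D (\<lambda>z. ?V L (conj_at k z))"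
      by (rule continuous_on_compose2[OF V[OF L] continuous_on_conj_at])
         (use D(2) in \<open>auto simp: conj_at_in_iff\<close>)
    show "continuous_on D (\<lambda>z. if k \<in> L then - ?V L z else ?V L z)"
      by (cases "k \<in> L") (simp_all add: V[OF L] continuous_on_minus)
    fix z assume z: "z \<in> off_real D {h}"
    then have z': "conj_at k z \<in> off_real D {h}"
      using conj_at_in_iff[OF invariant_off_real[OF D(2)]] by blast
    have zD: "z \<in> D" using z by (simp add: off_real_def)
    have "h \<notin> L" using L by auto
    then show "?V L (conj_at k z) = (if k \<in> L then - ?V L z else ?V L z)"
      unfolding V_off[OF z] V_off[OF z']
      using eo zD by (auto simp: even_odd_def conj_at_nth)
  qed
  have crV: "cr_along k (?V L) (?V (insert k L)) z"
    if L: "L \<subseteq> {h<..}" and k: "h < k" "k \<notin> L" and z: "z \<in> D" for k L z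
  proof (rule cr_along_off_real[OF D(1) V[OF L] _ _ _ z, where H = "{h}"])
    show "continuous_on D (?V (insert k L))" using L k by (intro V) auto
    show "k \<notin> {h}" using k by simp
    fix z assume z: "z \<in> off_real D {h}"
    define S where "S = {w. z + axis k w \<in> off_real D {h}}"
    have S: "open S" "0 \<in> S"
      using z open_off_real[OF D(1)] by (auto simp: S_def axis_eq_0_iff[THEN iffD2] intro!: open_line)
    have Im: "Im ((z + axis k w) $ h) = Im (z $ h)" for w using k by (simp add: axis_def)
    have "h \<notin> L" using L by auto
    then have "cr_along k (\<lambda>z. F z $ insert h L) (\<lambda>z. F z $ insert k (insert h L)) z"
      using k z by (intro cr) (auto simp: off_real_def)
    from cr_at_scaleR[OF this[unfolded cr_along_def], of "inverse (Im (z $ h))"]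
    have c: "cr_at (\<lambda>w. F (z + axis k w) $ insert h L /\<^sub>R Im (z $ h))
        (\<lambda>w. F (z + axis k w) $ insert h (insert k L) /\<^sub>R Im (z $ h)) 0"
      by (simp add: insert_commute)
    show "cr_along k (?V L) (?V (insert k L)) z"
      unfolding cr_along_def
      by (rule cr_at_transform[OF c S]; unfold S_def mem_Collect_eq; subst V_off; simp add: Im del: vector_add_component)
  qed
  show ?thesis
    unfolding regular_off_def
  proof (intro conjI ballI allI impI)
    show "stem_fun D (stem_step c h F)"
      unfolding stem_fun_iff
    proof
      have "continuous_on D (\<lambda>z. stem_step c h F z $ L)" for L
      proof (cases "L \<subseteq> {h<..}")
        case True
        have "continuous_on D (\<lambda>z. Re (z $ h) *\<^sub>R ?V L z + F z $ L)"
          by (intro continuous_on_add continuous_on_scaleR cont V[OF True] continuous_intros)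
        then show ?thesis
          by (cases c) (simp_all add: stem_step_def True V)
      qed (simp add: stem_step_def)
      then show "continuous_on D (stem_step c h F)" by (simp add: continuous_on_stem_iff)
      show "even_odd D (stem_step c h F)"
        unfolding even_odd_def
      proof (intro ballI allI)
        fix z L k assume z: "z \<in> D"
        show "stem_step c h F (conj_at k z) $ L = (if k \<in> L then - stem_step c h F z $ L else stem_step c h F z $ L)"
        proof (cases "L \<subseteq> {h<..}")
          case True
          have "Re (conj_at k z $ h) = Re (z $ h)" by (simp add: conj_at_nth)
          then show ?thesis
            using par[OF True z] eo z True by (simp add: stem_step_def even_odd_def)
        qed (simp add: stem_step_def)
      qed
    qed
    show "stem_step c h F z $ L = 0" if "\<not> L \<subseteq> - {..h}" for z L
    proof -
      have "- {..h} = {h<..}" by auto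
      then show ?thesis using that by (simp add: stem_step_def)
    qed
    fix k L z assume "k \<notin> {..h}" and kL: "k \<notin> L" and z: "z \<in> D"
    then have k: "h < k" by auto
    show "cr_along k (\<lambda>z. stem_step c h F z $ L) (\<lambda>z. stem_step c h F z $ insert k L) z"
    proof (cases "L \<subseteq> {h<..}")
      case True
      then have True': "insert k L \<subseteq> {h<..}" using k by auto
      have Re: "Re ((z + axis k w) $ h) = Re (z $ h)" for w using k by (simp add: axis_def)
      have cV: "cr_at (\<lambda>w. ?V L (z + axis k w)) (\<lambda>w. ?V (insert k L) (z + axis k w)) 0"
        using crV[OF True k kL z] by (simp add: cr_along_def)
      have cF: "cr_at (\<lambda>w. F (z + axis k w) $ L) (\<lambda>w. F (z + axis k w) $ insert k L) 0"
        using cr[OF _ kL z] k by (simp add: cr_along_def)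
      show ?thesis
        using cV cr_at_add[OF cr_at_scaleR[OF cV, of "Re (z $ h)"] cF] True True'
        by (cases c) (simp_all add: cr_along_def stem_step_def Re del: vector_add_component insert_subset)
    next
      case False
      then have "\<not> insert k L \<subseteq> {h<..}" by auto
      then show ?thesis
        using False cr_at_0 by (simp add: cr_along_def stem_step_def del: insert_subset)
    qed
  qed
qed

lemma regular_off_comp_stem:
  fixes F :: "'n::{finite,linorder} stem"
  assumes D: "open D" "invariant_set D" and F: "regular_off D {} F" and m: "m \<le> CARD('n)"
  shows "regular_off D (seg m) (comp_stem K F m)"
  using m
proof (induction m)
  case (Suc m)
  then have "regular_off D {..<idx (Suc m)} (comp_stem K F m)"
    using seg_eq[of m, where 'n = 'n] by simp
  from regular_off_stem_step[OF D this]
  have "regular_off D {..idx (Suc m)} (comp_stem K F (Suc m))" by simp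
  moreover have "seg (Suc m) = {..idx (Suc m) :: 'n}"
    using Compl_seg_Suc[of m, where 'n = 'n] Suc.prems by (metis (no_types) Suc_le_lessD double_complement Compl_greaterThan)
  ultimately show ?case by simp
qed (use F in simp)

text \<open>
  Both sides obey the same recursion in \<open>m\<close>. The sum over subsets of \<open>insert h A\<close> on the right
  splits into the subsets without and with \<open>h\<close>, which carry the factors \<open>Re (z $ h)\<close> and
  \<open>Im (z $ h)\<close>; these are the two summands of \<open>stem_step\<close>.
\<close>

lemma comp_stem_eq:
  fixes F :: "'n::{finite,linorder} stem"
  assumes "m \<le> CARD('n)" "\<And>k. k \<in> seg m \<Longrightarrow> Im (z $ k) \<noteq> 0"
  shows "comp_stem K F m z = stem_sder (seg m) (stem_prod (coord_stem (K \<inter> seg m)) F) z"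
  using assms
proof (induction m)
  case 0
  then show ?case by (simp add: vec_eq_iff stem_sder_nth coord_stem_prod_nth)
next
  case (Suc m)
  define h :: 'n where "h = idx (Suc m)"
  define A where "A = seg m \<inter> K"
  have m: "m < CARD('n)" using Suc.prems by simp
  have seg: "seg (Suc m) = insert h (seg m)" by (simp add: seg_Suc h_def)
  have hA: "h \<notin> seg m" using seg_eq[OF m] by (simp add: h_def)
  have IH: "comp_stem K F m z $ L = inverse (\<Prod>k\<in>seg m. Im (z $ k)) *\<^sub>R
      stem_prod (coord_stem A) F z $ (L \<union> seg m)" if "L \<subseteq> - seg m" for L
    using Suc that by (simp add: stem_sder_nth seg A_def Int_commute)
  have Im: "Im (z $ h) \<noteq> 0" using Suc.prems by (simp add: seg)
  have "comp_stem K F (Suc m) z $ L = stem_sder (seg (Suc m)) (stem_prod (coord_stem (K \<inter> seg (Suc m))) F) z $ L" for L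
  proof (cases "L \<subseteq> {h<..}")
    case False
    then show ?thesis
      using Compl_seg_Suc[OF m] by (simp add: stem_sder_nth stem_step_def h_def)
  next
    case True
    have L: "L \<subseteq> - seg (Suc m)" using Compl_seg_Suc[OF m] True by (simp add: h_def)
    then have L': "insert h L \<subseteq> - seg m" "L \<subseteq> - seg m" "h \<notin> L" using hA by (auto simp: seg)
    let ?c = "\<lambda>A P. (\<Prod>k\<in>A - P. Re (z $ k)) * (\<Prod>k\<in>P. Im (z $ k))"
    have V: "im_quotient h (\<lambda>z. comp_stem K F m z $ insert h L) z = inverse (\<Prod>k\<in>seg (Suc m). Im (z $ k)) *\<^sub>R
        stem_prod (coord_stem A) F z $ (L \<union> seg (Suc m))"
      using Im hA by (simp add: im_quotient_def IH[OF L'(1)] seg)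
    show ?thesis
    proof (cases "h \<in> K")
      case False
      then have "K \<inter> seg (Suc m) = A" by (auto simp: seg A_def)
      then show ?thesis using L V True False by (simp add: stem_sder_nth stem_step_def flip: h_def)
    next
      case True
      then have K: "K \<inter> seg (Suc m) = insert h A" by (auto simp: seg A_def)
      have hA': "h \<notin> A" using hA by (auto simp: A_def)
      have "stem_prod (coord_stem (insert h A)) F z $ (L \<union> seg (Suc m)) =
        (\<Sum>P\<in>Pow A. ?c (insert h A) P *\<^sub>R F z $ (L \<union> seg (Suc m) - P)) +
        (\<Sum>P\<in>Pow A. ?c (insert h A) (insert h P) *\<^sub>R F z $ (L \<union> seg (Suc m) - insert h P))"
        by (subst coord_stem_prod_nth) (auto simp: A_def seg sum_Pow_insert hA)
      also have "(\<Sum>P\<in>Pow A. ?c (insert h A) P *\<^sub>R F z $ (L \<union> seg (Suc m) - P)) =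
         (\<Sum>P\<in>Pow A. Re (z $ h) *\<^sub>R (?c A P *\<^sub>R F z $ (L \<union> seg (Suc m) - P)))"
      proof (rule sum.cong[OF refl])
        fix P assume "P \<in> Pow A"
        then have "insert h A - P = insert h (A - P)" using hA' by auto
        then show "?c (insert h A) P *\<^sub>R F z $ (L \<union> seg (Suc m) - P) =
          Re (z $ h) *\<^sub>R (?c A P *\<^sub>R F z $ (L \<union> seg (Suc m) - P))"
          using hA' by simp
      qed
      also have "\<dots> = Re (z $ h) *\<^sub>R stem_prod (coord_stem A) F z $ (L \<union> seg (Suc m))"
        by (subst coord_stem_prod_nth) (auto simp: A_def seg scaleR_sum_right)
      also have "(\<Sum>P\<in>Pow A. ?c (insert h A) (insert h P) *\<^sub>R F z $ (L \<union> seg (Suc m) - insert h P)) =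
         (\<Sum>P\<in>Pow A. Im (z $ h) *\<^sub>R (?c A P *\<^sub>R F z $ (L \<union> seg m - P)))"
      proof (rule sum.cong[OF refl])
        fix P assume "P \<in> Pow A"
        then have "insert h A - insert h P = A - P" "h \<notin> P" using hA' by auto
        moreover have "L \<union> seg (Suc m) - insert h P = L \<union> seg m - P"
          using hA L' by (auto simp: seg)
        ultimately show "?c (insert h A) (insert h P) *\<^sub>R F z $ (L \<union> seg (Suc m) - insert h P) =
          Im (z $ h) *\<^sub>R (?c A P *\<^sub>R F z $ (L \<union> seg m - P))"
          by (simp add: mult.left_commute)
      qed
      also have "\<dots> = Im (z $ h) *\<^sub>R stem_prod (coord_stem A) F z $ (L \<union> seg m)"
        by (subst coord_stem_prod_nth) (auto simp: A_def scaleR_sum_right)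
      finally have S: "stem_prod (coord_stem (insert h A)) F z $ (L \<union> seg (Suc m)) =
         Re (z $ h) *\<^sub>R stem_prod (coord_stem A) F z $ (L \<union> seg (Suc m)) +
         Im (z $ h) *\<^sub>R stem_prod (coord_stem A) F z $ (L \<union> seg m)" .
      have "comp_stem K F (Suc m) z $ L = Re (z $ h) *\<^sub>R inverse (\<Prod>k\<in>seg (Suc m). Im (z $ k)) *\<^sub>R
        stem_prod (coord_stem A) F z $ (L \<union> seg (Suc m)) + inverse (\<Prod>k\<in>seg m. Im (z $ k)) *\<^sub>R
      stem_prod (coord_stem A) F z $ (L \<union> seg m)"
        using \<open>L \<subseteq> {h<..}\<close> \<open>h \<in> K\<close> IH[OF L'(2)] by (simp add: stem_step_def V flip: h_def)
      also have "inverse (\<Prod>k\<in>seg m. Im (z $ k)) = inverse (\<Prod>k\<in>seg (Suc m). Im (z $ k)) * Im (z $ h)"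
        using Im hA by (simp add: seg)
      finally show ?thesis
        unfolding K stem_sder_nth S using L by (simp add: scaleR_add_right mult.commute)
    qed
  qed
  then show ?case by (simp add: vec_eq_iff)
qed

section \<open>Slices in one variable\<close>

text \<open>
  If no component below \<open>h\<close> occurs, the slice function is \<open>even_part + J\<^sub>h odd_part\<close>, a one-variable
  slice function in \<open>x\<^sub>h\<close> whose coefficients depend on the units of the later variables.
\<close>

definition even_part :: "'n \<Rightarrow> ('n \<Rightarrow> quat) \<Rightarrow> 'n::{finite,linorder} stem \<Rightarrow> 'n cvec \<Rightarrow> quat" where
  "even_part h J F z = (\<Sum>L\<in>Pow {h<..}. ordered_prod L J * F z $ L)"

definition odd_part :: "'n \<Rightarrow> ('n \<Rightarrow> quat) \<Rightarrow> 'n::{finite,linorder} stem \<Rightarrow> 'n cvec \<Rightarrow> quat" where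
  "odd_part h J F z = (\<Sum>L\<in>Pow {h<..}. ordered_prod L J * F z $ insert h L)"

lemma sum_even_odd_part:
  fixes F :: "'n::{finite,linorder} stem"
  assumes "\<And>L. \<not> L \<subseteq> {h..} \<Longrightarrow> F z $ L = 0"
  shows "(\<Sum>L\<in>UNIV. ordered_prod L (J(h := q)) * F z $ L) = even_part h J F z + q * odd_part h J F z"
proof -
  have *: "ordered_prod L (J(h := q)) = ordered_prod L J" if "L \<in> Pow {h<..}" for L
    by (rule ordered_prod_cong) (use that in auto)
  have "(\<Sum>L\<in>UNIV. ordered_prod L (J(h := q)) * F z $ L) =
    (\<Sum>L\<in>Pow {h<..}. ordered_prod L (J(h := q)) * F z $ L) +
    (J(h := q)) h * (\<Sum>L\<in>Pow {h<..}. ordered_prod L (J(h := q)) * F z $ insert h L)"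
    by (rule sum_ordered_prod_split) (rule assms)
  also have "(\<Sum>L\<in>Pow {h<..}. ordered_prod L (J(h := q)) * F z $ L) = even_part h J F z"
    unfolding even_part_def by (rule sum.cong) (simp_all only: *)
  also have "(\<Sum>L\<in>Pow {h<..}. ordered_prod L (J(h := q)) * F z $ insert h L) = odd_part h J F z"
    unfolding odd_part_def by (rule sum.cong) (simp_all only: *)
  finally show ?thesis by (simp only: fun_upd_same)
qed

lemma vec_upd_slice_vec:
  "vec_upd (slice_vec z J) h (slice_point w q) = slice_vec (vec_upd z h w) (J(h := q))"
  by (simp add: vec_eq_iff vec_upd_nth slice_vec_nth)

lemma slice_domain_slice_vec:
  fixes D :: "'n::{finite,linorder} cvec set"
  assumes inv: "invariant_set D" and J: "\<And>h. J h \<in> imag_units"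
  shows "slice_domain D h (slice_vec z J) = {w. vec_upd z h w \<in> D}"
proof -
  have "slice_vec (vec_upd z h w) (J(h := q)) \<in> circularization D \<longleftrightarrow> vec_upd z h w \<in> D"
    if "q \<in> imag_units" for w q
    by (rule slice_vec_in_circularization_iff[OF inv]) (use J that in simp)
  then show ?thesis
    unfolding slice_domain_def vec_upd_slice_vec using quat_i_imag_unit by auto
qed

lemma vec_upd_line: "vec_upd z h w = vec_upd z h 0 + axis h (w :: 'a::ring)"
  by (simp add: vec_eq_iff vec_upd_nth axis_def)

lemma open_vec_upd: "open D \<Longrightarrow> open {w :: complex. vec_upd z h w \<in> D}"
  using open_line[of D "vec_upd z h 0" h] by (simp only: vec_upd_line[symmetric])

lemma vec_upd_same [simp]: "vec_upd z h (z $ h) = z"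
  by (simp add: vec_eq_iff vec_upd_nth)

lemma cr_along_even_odd_part:
  fixes F :: "'n::{finite,linorder} stem"
  assumes "\<And>L. L \<subseteq> {h<..} \<Longrightarrow> cr_along h (\<lambda>z. F z $ L) (\<lambda>z. F z $ insert h L) z"
  shows "cr_along h (even_part h J F) (odd_part h J F) z"
  unfolding cr_along_def even_part_def odd_part_def
  by (intro cr_at_sum cr_at_mult_left) (use assms in \<open>simp add: cr_along_def\<close>)

lemma continuous_on_even_odd_part:
  fixes F :: "'n::{finite,linorder} stem"
  assumes "continuous_on D F"
  shows "continuous_on D (even_part h J F)" "continuous_on D (odd_part h J F)"
  unfolding even_part_def odd_part_def
  using assms[unfolded continuous_on_stem_iff]
  by (auto intro!: continuous_on_sum continuous_on_mult_left)

lemma even_odd_part_conj_at: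
  fixes F :: "'n::{finite,linorder} stem"
  assumes "even_odd D F" "z \<in> D"
  shows "even_part h J F (conj_at h z) = even_part h J F z" "odd_part h J F (conj_at h z) = - odd_part h J F z"
proof -
  show "even_part h J F (conj_at h z) = even_part h J F z"
    unfolding even_part_def by (rule sum.cong) (use assms in \<open>auto simp: even_odd_def\<close>)
  show "odd_part h J F (conj_at h z) = - odd_part h J F z"
    unfolding odd_part_def sum_negf[symmetric]
    by (rule sum.cong) (use assms in \<open>auto simp: even_odd_def\<close>)
qed

lemma C1_on_complex:
  fixes u :: "complex \<Rightarrow> 'b::real_normed_vector"
  assumes "continuous_on E p" "continuous_on E q"
    and "\<And>w. w \<in> E \<Longrightarrow> (u has_derivative (\<lambda>d. Re d *\<^sub>R p w + Im d *\<^sub>R q w)) (at w)"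
  shows "C1_on E u"
proof -
  define u' where "u' w = (blinfun_scaleR_left (p w) o\<^sub>L Blinfun Re) + (blinfun_scaleR_left (q w) o\<^sub>L Blinfun Im)" for w
  have "blinfun_apply (u' w) = (\<lambda>d. Re d *\<^sub>R p w + Im d *\<^sub>R q w)" for w
    unfolding u'_def by (rule ext)
      (simp add: blinfun.add_left bounded_linear_Blinfun_apply bounded_linear_Re bounded_linear_Im)
  moreover have "continuous_on E u'"
    unfolding u'_def
    by (intro continuous_intros bounded_linear.continuous_on[OF bounded_linear_blinfun_scaleR_left] assms)
  ultimately show ?thesis
    unfolding C1_on_def using assms(3) by (intro exI[of _ u']) simp
qed

lemma induced_slice:
  fixes D :: "'n::{finite,linorder} cvec set"
  assumes "invariant_set D" "even_odd D F" "\<And>L. \<not> L \<subseteq> {h..} \<Longrightarrow> F (vec_upd z h w) $ L = 0"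
    and "vec_upd z h w \<in> D" "\<And>k. J k \<in> imag_units" "q \<in> imag_units"
  shows "induced D F (slice_vec (vec_upd z h w) (J(h := q))) =
    even_part h J F (vec_upd z h w) + q * odd_part h J F (vec_upd z h w)"
proof -
  define J' where "J' = J(h := q)"
  have "J' k \<in> imag_units" for k using assms by (simp add: J'_def)
  from induced_eq[OF assms(1,2,4) this] show ?thesis
    unfolding J'_def by (rule trans) (rule sum_even_odd_part, rule assms(3))
qed

text \<open>
  The pair of even and odd part satisfies the Cauchy-Riemann equations as a left linear
  combination of the pairs of components, and its partial derivatives are continuous.
\<close>

lemma induced_in_slice_regular_wrt:
  fixes F :: "'n::{finite,linorder} stem"
  assumes D: "open D" "invariant_set D" and F: "regular_off D {..<h} F"
  shows "induced D F \<in> slice_regular_wrt D h"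
proof -
  have cont: "continuous_on D F" and eo: "even_odd D F"
    using F by (simp_all add: regular_off_def stem_fun_iff)
  have compl: "- {..<h} = {h..}" by auto
  have supp: "F z $ L = 0" if "z \<in> D" "\<not> L \<subseteq> {h..}" for z L
    using F that unfolding regular_off_def compl by blast
  have cr: "cr_along h (\<lambda>z. F z $ L) (\<lambda>z. F z $ insert h L) z" if "z \<in> D" "L \<subseteq> {h<..}" for z L
  proof -
    have "h \<notin> L" using that by auto
    then show ?thesis using F that by (simp add: regular_off_def)
  qed
  have "slice_regular1 (slice_domain D h y) (\<lambda>x. induced D F (vec_upd y h x))"
    if "y \<in> circularization D" for y
  proof -
    obtain z J where y: "y = slice_vec z J" and J: "\<And>h. J h \<in> imag_units"
      using \<open>y \<in> circularization D\<close> by (auto simp: circularization_def)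
    define z0 where "z0 = vec_upd z h 0"
    have line: "vec_upd z h w = z0 + axis h w" for w
      unfolding z0_def by (rule vec_upd_line)
    define E where "E = {w. vec_upd z h w \<in> D}"
    have E: "slice_domain D h y = E"
      unfolding y E_def by (rule slice_domain_slice_vec[OF D(2) J])
    let ?u = "even_part h J F" and ?v = "odd_part h J F"
    obtain P Q where PQ: "continuous_on D P" "continuous_on D Q"
      "\<forall>z\<in>D. ((\<lambda>w. ?u (z + axis h w)) has_derivative (\<lambda>d. Re d *\<^sub>R P z + Im d *\<^sub>R Q z)) (at 0)"
      "\<forall>z\<in>D. ((\<lambda>w. ?v (z + axis h w)) has_derivative (\<lambda>d. Im d *\<^sub>R P z - Re d *\<^sub>R Q z)) (at 0)"
      by (rule cr_partials_continuous[OF D(1) continuous_on_even_odd_part[OF cont] cr_along_even_odd_part[OF cr]])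
    define G0 where "G0 w = ?u (vec_upd z h w)" for w
    define G1 where "G1 w = ?v (vec_upd z h w)" for w
    define p where "p w = P (vec_upd z h w)" for w
    define q where "q w = Q (vec_upd z h w)" for w
    have cvu: "continuous_on E (\<lambda>w. vec_upd z h w)"
      unfolding line by (intro continuous_intros)
    have pq: "continuous_on E p" "continuous_on E q"
      unfolding p_def q_def
      by (rule continuous_on_compose2[OF PQ(1) cvu] continuous_on_compose2[OF PQ(2) cvu]; auto simp: E_def)+
    have d0: "(G0 has_derivative (\<lambda>d. Re d *\<^sub>R p w + Im d *\<^sub>R q w)) (at w)" if "w \<in> E" for w
      unfolding G0_def p_def q_def line
      by (rule has_derivative_line_shift, rule bspec[OF PQ(3)]) (use that in \<open>simp add: E_def line\<close>)
    have d1: "(G1 has_derivative (\<lambda>d. Im d *\<^sub>R p w - Re d *\<^sub>R q w)) (at w)" if "w \<in> E" for w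
      unfolding G1_def p_def q_def line
      by (rule has_derivative_line_shift, rule bspec[OF PQ(4)]) (use that in \<open>simp add: E_def line\<close>)
    have conj: "vec_upd z h (cnj w) = conj_at h (vec_upd z h w)" for w
      by (simp add: vec_eq_iff vec_upd_nth conj_at_nth)
    show ?thesis
      unfolding slice_regular1_def E
    proof (rule exI[of _ G0], rule exI[of _ G1], intro conjI ballI)
      show "C1_on E G0" by (rule C1_on_complex[OF pq d0])
      show "C1_on E G1"
        by (rule C1_on_complex[OF continuous_on_minus[OF pq(2)] pq(1)]) (use d1 in \<open>simp add: algebra_simps\<close>)
      fix w assume w: "w \<in> E"
      then have wD: "vec_upd z h w \<in> D" by (simp add: E_def)
      show "G0 (cnj w) = G0 w" "G1 (cnj w) = - G1 w"
        unfolding G0_def G1_def conj by (rule even_odd_part_conj_at[OF eo wD])+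
      show "dir_deriv G0 w 1 = dir_deriv G1 w \<i>" "dir_deriv G0 w \<i> = - dir_deriv G1 w 1"
        unfolding dir_deriv_has_derivative[OF d0[OF w]] dir_deriv_has_derivative[OF d1[OF w]] by simp_all
      fix J' assume "J' \<in> imag_units"
      then show "induced D F (vec_upd y h (slice_point w J')) = G0 w + J' * G1 w"
        unfolding y vec_upd_slice_vec G0_def G1_def
        by (intro induced_slice[OF D(2) eo supp[OF wD] wD J])
    qed
  qed
  moreover have "induces D F (induced D F)"
    using F by (simp add: induces_def regular_off_def)
  ultimately show ?thesis
    unfolding slice_regular_wrt_def slice_functions_def by blast
qed

section \<open>From the spherical components back to the stem function\<close>

lemma spherical_comp_slice:
  fixes D :: "'n::{finite,linorder} cvec set"
  assumes inv: "invariant_set D" and F: "induces D F f" and m: "m < CARD('n)" and h: "h = idx (Suc m)"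
    and z: "vec_upd z h w \<in> off_real D (seg m)" and J: "\<And>k. J k \<in> imag_units" "q \<in> imag_units"
  shows "spherical_comp D m K f (slice_vec (vec_upd z h w) (J(h := q))) =
    even_part h J (stem_sder (seg m) (stem_prod (coord_stem K) F)) (vec_upd z h w) +
    q * odd_part h J (stem_sder (seg m) (stem_prod (coord_stem K) F)) (vec_upd z h w)"
proof -
  have supp: "stem_sder (seg m) (stem_prod (coord_stem K) F) (vec_upd z h w) $ L = 0" if "\<not> L \<subseteq> {h..}" for L
    using that Compl_seg[OF m] by (simp add: stem_sder_nth h)
  define J' where "J' = J(h := q)"
  have "J' k \<in> imag_units" for k using J by (simp add: J'_def)
  from spherical_comp_eq[OF inv F z this, of K] show ?thesis
    unfolding J'_def by (rule trans) (rule sum_even_odd_part, rule supp)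
qed

text \<open>
  The two coefficient functions of a slice function are unique: evaluate at \<open>J\<close> and \<open>-J\<close>.
\<close>

lemma slice_regular1_imp_cr_at:
  assumes "slice_regular1 E g" "open E" "w \<in> E"
    and uv: "\<And>x J. x \<in> E \<Longrightarrow> J \<in> imag_units \<Longrightarrow> g (slice_point x J) = u x + J * v x"
  shows "cr_at u v w"
proof -
  obtain G0 G1 where C1: "C1_on E G0" "C1_on E G1"
    and G: "\<forall>w\<in>E. G0 (cnj w) = G0 w \<and> G1 (cnj w) = - G1 w \<and>
        dir_deriv G0 w 1 = dir_deriv G1 w \<i> \<and> dir_deriv G0 w \<i> = - dir_deriv G1 w 1 \<and>
        (\<forall>J\<in>imag_units. g (slice_point w J) = G0 w + J * G1 w)"
    using assms(1) unfolding slice_regular1_def by blast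
  obtain T0 T1 where T: "(G0 has_derivative T0) (at w)" "(G1 has_derivative T1) (at w)"
    using C1 \<open>w \<in> E\<close> unfolding C1_on_def by blast
  have rel: "T0 1 = T1 \<i>" "T0 \<i> = - T1 1"
    using G \<open>w \<in> E\<close> dir_deriv_has_derivative[OF T(1)] dir_deriv_has_derivative[OF T(2)] by auto
  have lin: "T d = Re d *\<^sub>R T 1 + Im d *\<^sub>R T \<i>" if "linear T" for T :: "complex \<Rightarrow> quat" and d
  proof -
    have "T d = T (Re d *\<^sub>R 1 + Im d *\<^sub>R \<i>)" by (rule arg_cong[where f = T]) (simp add: complex_eq_iff)
    then show ?thesis by (simp only: linear_add[OF that] linear_scale[OF that])
  qed
  have "T0 = (\<lambda>d. Re d *\<^sub>R T0 1 + Im d *\<^sub>R T0 \<i>)"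
    by (rule ext) (rule lin[OF has_derivative_linear[OF T(1)]])
  moreover have "T1 = (\<lambda>d. Im d *\<^sub>R T0 1 - Re d *\<^sub>R T0 \<i>)"
  proof
    fix d show "T1 d = Im d *\<^sub>R T0 1 - Re d *\<^sub>R T0 \<i>"
      using lin[OF has_derivative_linear[OF T(2)], of d] rel by simp
  qed
  ultimately have "cr_at G0 G1 w" using T by (intro cr_atI) simp_all
  moreover have "G0 x = u x \<and> G1 x = v x" if "x \<in> E" for x
  proof -
    define J where "J = Quat 0 1 0 0"
    have J: "J \<in> imag_units" "- J \<in> imag_units" using quat_i_imag_unit by (simp_all add: J_def uminus_imag_units)
    have 1: "G0 x + J * G1 x = u x + J * v x" "G0 x + (- J) * G1 x = u x + (- J) * v x"
      using G uv that J by metis+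
    then have "2 *\<^sub>R G0 x = 2 *\<^sub>R u x"
      by (simp add: scaleR_2) (metis (no_types, lifting) add_diff_cancel_left' add_diff_eq diff_add_cancel diff_add_eq)
    then have "G0 x = u x" by simp
    then have "J * G1 x = J * v x" using 1 by simp
    then show ?thesis using \<open>G0 x = u x\<close> imag_unit_nonzero[OF J(1)] by simp
  qed
  ultimately show ?thesis
    using cr_at_transform[OF _ \<open>open E\<close> \<open>w \<in> E\<close>] by blast
qed

lemma cr_along_of_vec_upd:
  assumes "cr_at (\<lambda>w. u (vec_upd z h w)) (\<lambda>w. v (vec_upd z h w)) (z $ h)"
  shows "cr_along h u v z"
proof -
  have *: "vec_upd z h (z $ h + w) = z + axis h w" for w
    by (simp add: vec_eq_iff vec_upd_nth axis_def)
  have "cr_at (\<lambda>w. u (vec_upd z h (z $ h + w))) (\<lambda>w. v (vec_upd z h (z $ h + w))) 0"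
    by (rule cr_at_shift) (use assms in simp)
  then show ?thesis by (simp add: * cr_along_def)
qed

text \<open>
  Holomorphy of the slices for all units of the later variables is holomorphy of every single
  pair of components.
\<close>

lemma cr_along_extraction:
  fixes S :: "'n::{finite,linorder} stem"
  assumes all: "\<And>J. (\<And>k. J k \<in> imag_units) \<Longrightarrow> cr_along h (even_part h J S) (odd_part h J S) z"
    and L: "L \<subseteq> {h<..}"
  shows "cr_along h (\<lambda>z. S z $ L) (\<lambda>z. S z $ insert h L) z"
proof -
  \<comment> \<open>The truth value selects the member of the pair, so that one function carries both.\<close>
  define Q where "Q u = cr_at (\<lambda>w. u (True, w)) (\<lambda>w. u (False, w)) 0" for u :: "bool \<times> complex \<Rightarrow> quat"
  define c where "c L x = (if L \<subseteq> {h<..} then S (z + axis h (snd x)) $ (if fst x then L else insert h L) else 0)"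
    for L :: "'n set" and x :: "bool \<times> complex"
  have "Q (c L)"
  proof (rule component_extraction[of Q c])
    show "Q (\<lambda>x. u x + v x)" if "Q u" "Q v" for u v
      using that unfolding Q_def by (rule cr_at_add)
    show "Q (\<lambda>x. q * u x)" if "Q u" for q u
      using that unfolding Q_def by (rule cr_at_mult_left)
    fix J :: "'n \<Rightarrow> quat" assume J: "\<And>k. J k \<in> imag_units"
    have "(\<Sum>K\<in>UNIV. ordered_prod K J * c K x) = (\<Sum>K\<in>Pow {h<..}. ordered_prod K J *
        S (z + axis h (snd x)) $ (if fst x then K else insert h K))" for x
      by (rule sum.mono_neutral_cong_right) (auto simp: c_def)
    then show "Q (\<lambda>x. \<Sum>K\<in>UNIV. ordered_prod K J * c K x)"
      using all[OF J] by (simp add: Q_def cr_along_def even_part_def odd_part_def)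
  qed
  then show ?thesis using L by (simp add: Q_def c_def cr_along_def)
qed

text \<open>
  Put \<open>H = seg m\<close>. Away from the real hyperplanes of \<open>H\<close>, the component \<open>L\<close> of the stem function of
  the spherical component for \<open>K \<subseteq> H\<close> is, up to a nonzero factor independent of \<open>z\<^sub>h\<close>, the
  combination of the \<open>F (L \<union> H - R)\<close> with \<open>R \<subseteq> K\<close> from \<open>coord_stem_prod_nth\<close>. This system is
  triangular with respect to inclusion of \<open>K\<close>, its coefficients do not depend on \<open>z\<^sub>h\<close>, and its
  diagonal coefficients are nonzero there. So holomorphy in \<open>z\<^sub>h\<close> passes from the spherical
  components to all components of \<open>F\<close>, and then to the real hyperplanes by the limit theorem.
\<close>

lemma cr_along_of_spherical_comps:
  fixes D :: "'n::{finite,linorder} cvec set"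
  assumes D: "open D" "invariant_set D" and F: "induces D F f" and m: "m < CARD('n)" and h: "h = idx (Suc m)"
    and ext: "\<And>K. K \<subseteq> seg m \<Longrightarrow> \<exists>g. regular_extension D m K f g"
    and M: "h \<notin> M" and z: "z \<in> D"
  shows "cr_along h (\<lambda>z. F z $ M) (\<lambda>z. F z $ insert h M) z"
proof -
  define H :: "'n set" where "H = seg m"
  have H: "H = {..<h}" unfolding H_def h by (rule seg_eq[OF m])
  have hH: "h \<notin> H" by (simp add: H)
  have nth: "(z + axis h w) $ k = z $ k" if "k \<in> H" for k w and z :: "'n cvec"
    using that hH by (auto simp: axis_def)
  let ?C = "\<lambda>K. stem_prod (coord_stem K) F"
  have comp: "cr_along h (\<lambda>z. ?C K z $ (L \<union> H)) (\<lambda>z. ?C K z $ (insert h L \<union> H)) z"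
    if K: "K \<subseteq> H" and L: "L \<subseteq> {h<..}" and z: "z \<in> off_real D H" for K L z
  proof -
    define S where "S = stem_sder H (?C K)"
    obtain g where g: "g \<in> slice_regular_wrt D h"
      "\<And>x. x \<in> circularization (off_real D H) \<Longrightarrow> g x = spherical_comp D m K f x"
      using ext[of K] K unfolding regular_extension_def H_def h by auto
    have zD: "z \<in> D" using z by (simp add: off_real_def)
    have "cr_along h (even_part h J S) (odd_part h J S) z" if J: "\<And>k. J k \<in> imag_units" for J
    proof (rule cr_along_of_vec_upd, rule slice_regular1_imp_cr_at)
      define E where "E = {w. vec_upd z h w \<in> D}"
      have "slice_vec z J \<in> circularization D" using zD J by (rule slice_vec_in_circularization)
      then have "slice_regular1 (slice_domain D h (slice_vec z J)) (\<lambda>x. g (vec_upd (slice_vec z J) h x))"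
        using g(1) unfolding slice_regular_wrt_def by blast
      then show "slice_regular1 E (\<lambda>x. g (vec_upd (slice_vec z J) h x))"
        unfolding slice_domain_slice_vec[OF D(2) J] E_def .
      show "open E" unfolding E_def by (rule open_vec_upd[OF D(1)])
      show "z $ h \<in> E" using zD by (simp add: E_def)
      fix x q assume x: "x \<in> E" and q: "q \<in> imag_units"
      have "vec_upd z h x \<in> off_real D (seg m)"
        using x z hH by (auto simp: E_def off_real_def vec_upd_nth H_def)
      then show "g (vec_upd (slice_vec z J) h (slice_point x q)) =
          even_part h J S (vec_upd z h x) + q * odd_part h J S (vec_upd z h x)"
        unfolding vec_upd_slice_vec S_def H_def
        by (subst g(2)) (use J q in \<open>auto simp: H_def intro!: slice_vec_in_circularization
            spherical_comp_slice[OF D(2) F m h]\<close>)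
    qed
    from cr_along_extraction[OF this L]
    have "cr_at (\<lambda>w. S (z + axis h w) $ L) (\<lambda>w. S (z + axis h w) $ insert h L) 0"
      by (simp add: cr_along_def)
    from cr_at_scaleR[OF this, of "\<Prod>k\<in>H. Im (z $ k)"]
    have "cr_at (\<lambda>w. (\<Prod>k\<in>H. Im (z $ k)) *\<^sub>R S (z + axis h w) $ L)
      (\<lambda>w. (\<Prod>k\<in>H. Im (z $ k)) *\<^sub>R S (z + axis h w) $ insert h L) 0" .
    moreover have "(\<Prod>k\<in>H. Im (z $ k)) *\<^sub>R S (z + axis h w) $ L' = ?C K (z + axis h w) $ (L' \<union> H)"
      if "L' \<subseteq> {h..}" for w L'
    proof -
      have "L' \<subseteq> - H" using that by (auto simp: H)
      moreover have "(\<Prod>k\<in>H. Im (z $ k)) \<noteq> 0" using z by (simp add: off_real_def)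
      moreover have "(\<Prod>k\<in>H. Im ((z + axis h w) $ k)) = (\<Prod>k\<in>H. Im (z $ k))"
        by (rule prod.cong) (simp_all only: nth)
      ultimately show ?thesis by (simp add: S_def stem_sder_nth)
    qed
    moreover have "L \<subseteq> {h..}" "insert h L \<subseteq> {h..}" using L by auto
    ultimately show ?thesis by (simp add: cr_along_def)
  qed
  have part: "cr_along h (\<lambda>z. F z $ (L \<union> H - P)) (\<lambda>z. F z $ (insert h L \<union> H - P)) z"
    if L: "L \<subseteq> {h<..}" and z: "z \<in> off_real D H" and P: "P \<subseteq> H" for L P z
    using finite[of P] P
  proof (induction P rule: finite_psubset_induct)
    case (psubset P)
    \<comment> \<open>Constant along direction \<open>h\<close>, because \<open>h \<notin> H\<close>.\<close>
    define a where "a R = (\<Prod>k\<in>P - R. Re (z $ k)) * (\<Prod>k\<in>R. Im (z $ k))" for R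
    have split: "a P *\<^sub>R F (z + axis h w) $ (L' \<union> H - P) =
        ?C P (z + axis h w) $ (L' \<union> H) - (\<Sum>R\<in>Pow P - {P}. a R *\<^sub>R F (z + axis h w) $ (L' \<union> H - R))" for L' w
    proof -
      have "?C P (z + axis h w) $ (L' \<union> H) = (\<Sum>R\<in>Pow P. a R *\<^sub>R F (z + axis h w) $ (L' \<union> H - R))"
      proof (subst coord_stem_prod_nth)
        show "P \<subseteq> L' \<union> H" using psubset.prems by auto
        show "(\<Sum>R\<in>Pow P. ((\<Prod>k\<in>P - R. Re ((z + axis h w) $ k)) * (\<Prod>k\<in>R. Im ((z + axis h w) $ k))) *\<^sub>R
            F (z + axis h w) $ (L' \<union> H - R)) = (\<Sum>R\<in>Pow P. a R *\<^sub>R F (z + axis h w) $ (L' \<union> H - R))"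
          unfolding a_def
          by (intro sum.cong refl arg_cong2[where f = scaleR] arg_cong2[where f = times] prod.cong arg_cong[where f = Re] arg_cong[where f = Im] nth)
             (use psubset.prems in auto)
      qed
      also have "\<dots> = a P *\<^sub>R F (z + axis h w) $ (L' \<union> H - P) +
          (\<Sum>R\<in>Pow P - {P}. a R *\<^sub>R F (z + axis h w) $ (L' \<union> H - R))"
        by (rule sum.remove) auto
      finally show ?thesis by simp
    qed
    have "cr_at (\<lambda>w. a P *\<^sub>R F (z + axis h w) $ (L \<union> H - P)) (\<lambda>w. a P *\<^sub>R F (z + axis h w) $ (insert h L \<union> H - P)) 0"
      unfolding split
    proof (intro cr_at_diff cr_at_sum cr_at_scaleR)
      show "cr_at (\<lambda>w. ?C P (z + axis h w) $ (L \<union> H)) (\<lambda>w. ?C P (z + axis h w) $ (insert h L \<union> H)) 0"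
        using comp[OF psubset.prems L z] by (simp add: cr_along_def)
      fix R assume "R \<in> Pow P - {P}"
      then have "R \<subset> P" by auto
      then show "cr_at (\<lambda>w. F (z + axis h w) $ (L \<union> H - R)) (\<lambda>w. F (z + axis h w) $ (insert h L \<union> H - R)) 0"
        using psubset.IH[of R] psubset.prems by (auto simp: cr_along_def)
    qed
    moreover have "a P \<noteq> 0"
      using z psubset.prems by (auto simp: a_def off_real_def)
    ultimately show ?case
      using cr_at_scaleR[of _ _ _ "inverse (a P)"] unfolding cr_along_def by fastforce
  qed
  have cont: "continuous_on D (\<lambda>z. F z $ K)" for K
    using F by (auto simp: induces_def stem_fun_iff continuous_on_stem_iff)
  show ?thesis
  proof (rule cr_along_off_real[OF D(1) cont cont hH _ z])
    fix z assume z: "z \<in> off_real D H"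
    have "M - H \<subseteq> {h<..}" using M by (auto simp: H not_less le_less)
    moreover have "(M - H) \<union> H - (H - M) = M" "insert h (M - H) \<union> H - (H - M) = insert h M"
      using hH M by auto
    ultimately show "cr_along h (\<lambda>z. F z $ M) (\<lambda>z. F z $ insert h M) z"
      using part[of "M - H" z "H - M"] z by simp
  qed
qed

section \<open>The quaternionic operator on a slice function of one variable\<close>

lemma has_vector_derivative_line:
  assumes "(A has_derivative T) (at w)" "(\<gamma> has_vector_derivative d) (at (0::real))" "\<gamma> 0 = w"
  shows "((\<lambda>t. A (\<gamma> t)) has_vector_derivative T d) (at 0)"
proof -
  have "((\<lambda>t. A (\<gamma> t)) has_derivative (\<lambda>t. T (t *\<^sub>R d))) (at 0)"
    using has_derivative_compose[of \<gamma> "\<lambda>t. t *\<^sub>R d" 0 UNIV A T] assms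
    by (simp add: has_vector_derivative_def)
  moreover have "T (t *\<^sub>R d) = t *\<^sub>R T d" for t
    using assms(1) by (intro linear_scale has_derivative_linear)
  ultimately show ?thesis by (simp add: has_vector_derivative_def)
qed

lemma quat_norm_imag: "(quat_i p)\<^sup>2 + (quat_j p)\<^sup>2 + (quat_k p)\<^sup>2 = p \<bullet> p - (quat_re p)\<^sup>2"
  by (simp add: inner_quat_def power2_eq_square)

text \<open>
  A slice function \<open>\<phi>\<close> of one quaternionic variable with its coefficients \<open>A\<close> and \<open>B\<close>. The function
  \<open>C\<close> is the spherical derivative \<open>B / Im\<close>, extended continuously to the real axis.
\<close>

locale slice_extension =
  fixes E :: "complex set" and A B C :: "complex \<Rightarrow> quat" and \<phi> :: "quat \<Rightarrow> quat"
  assumes E: "open E"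
    and cr: "\<And>w. w \<in> E \<Longrightarrow> cr_at A B w"
    and phi: "\<And>w J. w \<in> E \<Longrightarrow> J \<in> imag_units \<Longrightarrow> \<phi> (slice_point w J) = A w + J * B w"
    and BC: "\<And>w. w \<in> E \<Longrightarrow> B w = Im w *\<^sub>R C w"
    and C: "continuous_on E C"
begin

lemma eventually_in_E:
  assumes "(\<gamma> has_vector_derivative d) (at (0::real))" "\<gamma> 0 \<in> E"
  obtains S where "open S" "0 \<in> S" "\<And>t. t \<in> S \<Longrightarrow> \<gamma> t \<in> E"
proof -
  have "isCont \<gamma> 0" using assms(1) by (rule has_vector_derivative_continuous)
  then have "eventually (\<lambda>t. \<gamma> t \<in> E) (nhds 0)"
    using topological_tendstoD[of \<gamma> "\<gamma> 0" "nhds 0" E] E assms(2) by (simp add: isCont_def tendsto_at_iff_tendsto_nhds)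
  then show ?thesis using that unfolding eventually_nhds by blast
qed

text \<open>
  Differentiate \<open>A + K B\<close> along the path \<open>\<gamma> t\<close> of complex coordinates and the path \<open>K t\<close> of units
  representing \<open>slice_point w J + t u\<close>. The imaginary part of that point has squared length \<open>N t\<close>.
\<close>

lemma derivative_nonreal:
  assumes w: "w \<in> E" "Im w \<noteq> 0" and J: "J \<in> imag_units"
    and A': "(A has_derivative (\<lambda>d. Re d *\<^sub>R p + Im d *\<^sub>R s)) (at w)"
    and B': "(B has_derivative (\<lambda>d. Im d *\<^sub>R p - Re d *\<^sub>R s)) (at w)"
    and v: "v = u - quat_re u *\<^sub>R 1"
  shows "((\<lambda>t. \<phi> (slice_point w J + t *\<^sub>R u)) has_vector_derivative
    quat_re u *\<^sub>R (p - J * s) + (J \<bullet> u) *\<^sub>R (s - J * C w + J * p) + v * C w) (at 0)"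
proof -
  define b where "b = Im w"
  define \<sigma> where "\<sigma> = J \<bullet> u"
  define N where "N t = b\<^sup>2 + 2 * t * b * \<sigma> + t\<^sup>2 * (v \<bullet> v)" for t
  \<comment> \<open>The sign of \<open>b\<close> makes the path start at \<open>w\<close> and not at its conjugate.\<close>
  define y where "y t = sgn b * sqrt (N t)" for t
  define \<gamma> where "\<gamma> t = (Re w + t * quat_re u) *\<^sub>R 1 + y t *\<^sub>R \<i>" for t
  define K where "K t = inverse (y t) *\<^sub>R (b *\<^sub>R J + t *\<^sub>R v)" for t
  have b: "b \<noteq> 0" using w by (simp add: b_def)
  have y0: "y 0 = b" using b by (simp add: y_def N_def real_sqrt_abs sgn_mult_abs)
  have N: "(N has_real_derivative (2 * b * \<sigma>)) (at 0)"
    unfolding N_def by (auto intro!: derivative_eq_intros)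
  have "(y has_real_derivative (sgn b * (inverse (sqrt (N 0)) / 2 * (2 * b * \<sigma>)))) (at 0)"
    unfolding y_def using b by (intro DERIV_cmult DERIV_chain2[OF DERIV_real_sqrt N]) (simp add: N_def)
  also have "sgn b * (inverse (sqrt (N 0)) / 2 * (2 * b * \<sigma>)) = \<sigma>"
    using b by (simp add: N_def sgn_real_def field_simps)
  finally have y': "(y has_real_derivative \<sigma>) (at 0)" .
  have y'': "(y has_vector_derivative \<sigma>) (at 0)"
    using y' by (simp add: has_real_derivative_iff_has_vector_derivative)
  have \<gamma>': "(\<gamma> has_vector_derivative (quat_re u *\<^sub>R 1 + \<sigma> *\<^sub>R \<i>)) (at 0)"
    unfolding \<gamma>_def using y''
    by (auto intro!: derivative_eq_intros simp: has_real_derivative_iff_has_vector_derivative[symmetric] y')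
  have \<gamma>0: "\<gamma> 0 = w" by (simp add: \<gamma>_def y0 b_def complex_eq_iff)
  obtain S1 where S1: "open S1" "0 \<in> S1" "\<And>t. t \<in> S1 \<Longrightarrow> \<gamma> t \<in> E"
    by (rule eventually_in_E[OF \<gamma>']) (auto simp: \<gamma>0 w)
  define S where "S = S1 \<inter> {t. N t > 0}"
  have "open {t. N t > 0}"
    unfolding N_def by (intro open_Collect_less continuous_intros)
  then have S: "open S" "0 \<in> S" using S1 b by (auto simp: S_def N_def)
  have reJ: "quat_re J = 0" and nJ: "J \<bullet> J = 1"
    using J unfolding imag_units_iff quat_norm_imag by auto
  have rev: "quat_re v = 0" by (simp add: v quat_arith_defs)
  have "J \<bullet> v = \<sigma>"
    using reJ by (simp add: v \<sigma>_def inner_quat_def quat_arith_defs)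
  then have dot: "(b *\<^sub>R J + t *\<^sub>R v) \<bullet> (b *\<^sub>R J + t *\<^sub>R v) = N t" for t
    using nJ by (simp add: N_def inner_simps inner_commute[of v J] power2_eq_square algebra_simps)
  have K: "K t \<in> imag_units" and q: "slice_point (\<gamma> t) (K t) = slice_point w J + t *\<^sub>R u" if "t \<in> S" for t
  proof -
    have Nt: "N t > 0" using that by (simp add: S_def)
    then have yt: "(y t)\<^sup>2 = N t" "y t \<noteq> 0"
      using b by (auto simp: y_def power_mult_distrib sgn_real_def)
    have "K t \<bullet> K t = (inverse (y t))\<^sup>2 * N t"
      by (simp add: K_def dot[symmetric] power2_eq_square)
    also have "\<dots> = 1" using yt by (simp add: power_inverse flip: yt(1))
    finally have "K t \<bullet> K t = 1" .
    moreover have "quat_re (K t) = 0" using reJ rev by (simp add: K_def plus_quat_def scaleR_quat_def)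
    ultimately show "K t \<in> imag_units" using quat_norm_imag[of "K t"] by (simp add: imag_units_iff)
    have "slice_point (\<gamma> t) (K t) = (Re w + t * quat_re u) *\<^sub>R 1 + (b *\<^sub>R J + t *\<^sub>R v)"
      using yt(2) by (simp add: slice_point_scaleR \<gamma>_def K_def)
    also have "\<dots> = slice_point w J + t *\<^sub>R u"
      by (simp add: slice_point_scaleR b_def v algebra_simps)
    finally show "slice_point (\<gamma> t) (K t) = slice_point w J + t *\<^sub>R u" .
  qed
  have K0: "K 0 = J" using b by (simp add: K_def y0)
  have K': "(K has_vector_derivative (inverse b *\<^sub>R v - (\<sigma> / b) *\<^sub>R J)) (at 0)"
  proof -
    have i: "((\<lambda>t. inverse (y t)) has_real_derivative - (inverse b * \<sigma> * inverse b)) (at 0)"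
      using DERIV_inverse'[OF y'] b by (simp add: y0)
    have l: "((\<lambda>t. b *\<^sub>R J + t *\<^sub>R v) has_vector_derivative v) (at 0)"
      by (auto intro!: derivative_eq_intros)
    have "inverse b * \<sigma> * inverse b * b = \<sigma> / b" using b by (simp add: field_simps)
    with has_vector_derivative_scaleR[OF i l] show ?thesis
      unfolding K_def by (simp add: y0)
  qed
  have "((\<lambda>t. A (\<gamma> t) + K t * B (\<gamma> t)) has_vector_derivative
      (quat_re u *\<^sub>R p + \<sigma> *\<^sub>R s) + (J * (\<sigma> *\<^sub>R p - quat_re u *\<^sub>R s) + (inverse b *\<^sub>R v - (\<sigma> / b) *\<^sub>R J) * B w)) (at 0)"
    using has_vector_derivative_add[OF has_vector_derivative_line[OF A' \<gamma>' \<gamma>0]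
      has_vector_derivative_mult[OF K' has_vector_derivative_line[OF B' \<gamma>' \<gamma>0]]]
    by (simp add: K0 \<gamma>0)
  also have "(quat_re u *\<^sub>R p + \<sigma> *\<^sub>R s) + (J * (\<sigma> *\<^sub>R p - quat_re u *\<^sub>R s) + (inverse b *\<^sub>R v - (\<sigma> / b) *\<^sub>R J) * B w)
     = quat_re u *\<^sub>R (p - J * s) + \<sigma> *\<^sub>R (s - J * C w + J * p) + v * C w"
    using b by (simp add: BC[OF w(1)] b_def[symmetric] algebra_simps)
  finally have "((\<lambda>t. A (\<gamma> t) + K t * B (\<gamma> t)) has_vector_derivative
      quat_re u *\<^sub>R (p - J * s) + \<sigma> *\<^sub>R (s - J * C w + J * p) + v * C w) (at 0)" .
  then show ?thesis
    unfolding \<sigma>_def[symmetric]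
  proof (rule has_vector_derivative_transform_within_open[OF _ S])
    fix t assume t: "t \<in> S"
    then have "\<gamma> t \<in> E" using S1 by (simp add: S_def)
    from phi[OF this K[OF t]] show "A (\<gamma> t) + K t * B (\<gamma> t) = \<phi> (slice_point w J + t *\<^sub>R u)"
      by (simp add: q[OF t])
  qed
qed

text \<open>
  At a real point \<open>a\<close>, the points \<open>a + t J\<close> with a unit \<open>J\<close> stay on one complex line, so no path
  of units is needed. Since \<open>B = Im C\<close>, the function \<open>B\<close> vanishes on the real axis, which kills
  \<open>s\<close>, and its derivative in the imaginary direction is \<open>C\<close>.
\<close>

lemma derivatives_real:
  assumes w: "w \<in> E" "Im w = 0"
    and A': "(A has_derivative (\<lambda>d. Re d *\<^sub>R p + Im d *\<^sub>R s)) (at w)"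
    and B': "(B has_derivative (\<lambda>d. Im d *\<^sub>R p - Re d *\<^sub>R s)) (at w)"
  shows "p = C w" "s = 0"
    and "((\<lambda>t. \<phi> (of_real (Re w) + t *\<^sub>R 1)) has_vector_derivative p) (at 0)"
    and "J \<in> imag_units \<Longrightarrow> ((\<lambda>t. \<phi> (of_real (Re w) + t *\<^sub>R J)) has_vector_derivative J * p) (at 0)"
proof -
  have line: "((\<lambda>t. w + t *\<^sub>R d) has_vector_derivative d) (at 0)" for d
    by (auto intro!: derivative_eq_intros)
  note A_line = has_vector_derivative_line[OF A' line, simplified]
  note B_line = has_vector_derivative_line[OF B' line, simplified]
  obtain S where S: "open S" "0 \<in> S" "\<And>t. t \<in> S \<Longrightarrow> w + t *\<^sub>R 1 \<in> E"
    by (rule eventually_in_E[OF line[of 1]]) (auto simp: w)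
  obtain S' where S': "open S'" "0 \<in> S'" "\<And>t. t \<in> S' \<Longrightarrow> w + t *\<^sub>R \<i> \<in> E"
    by (rule eventually_in_E[OF line[of \<i>]]) (auto simp: w)
  have "((\<lambda>t. B (w + t *\<^sub>R 1)) has_vector_derivative - s) (at 0)"
    using B_line[of 1] by simp
  moreover have "((\<lambda>t. B (w + t *\<^sub>R 1)) has_vector_derivative 0) (at 0)"
  proof (rule has_vector_derivative_transform_within_open[OF _ S(1,2)])
    show "0 = B (w + t *\<^sub>R 1)" if "t \<in> S" for t
      unfolding BC[OF S(3)[OF that]] using w(2) by simp
  qed simp
  ultimately have "- s = 0" by (rule vector_derivative_unique_at)
  then show s: "s = 0" by simp
  show pC: "p = C w"
  proof -
    have "((\<lambda>t. B (w + t *\<^sub>R \<i>)) has_vector_derivative p) (at 0)"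
      using B_line[of \<i>] by simp
    note B_i = this
    have "isCont C (w + 0 *\<^sub>R \<i>)" using C E w by (simp add: continuous_on_eq_continuous_at)
    moreover have "((\<lambda>t::real. w + t *\<^sub>R \<i>) \<longlongrightarrow> w + 0 *\<^sub>R \<i>) (at 0)" by (intro tendsto_intros)
    ultimately have C_i: "((\<lambda>t. C (w + t *\<^sub>R \<i>)) \<longlongrightarrow> C w) (at 0)"
      using isCont_tendsto_compose by fastforce
    show ?thesis
    proof (rule euclidean_eqI)
      fix b :: quat
      have "((\<lambda>t. B (w + t *\<^sub>R \<i>) \<bullet> b) has_real_derivative p \<bullet> b) (at 0)"
        using bounded_linear.has_vector_derivative[OF bounded_linear_inner_left B_i, of b]
        by (simp add: has_real_derivative_iff_has_vector_derivative)
      from DERIV_D[OF this] have "((\<lambda>t. (B (w + t *\<^sub>R \<i>) \<bullet> b) / t) \<longlongrightarrow> p \<bullet> b) (at 0)"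
        using BC[OF w(1)] w(2) by simp
      moreover have "((\<lambda>t. (B (w + t *\<^sub>R \<i>) \<bullet> b) / t) \<longlongrightarrow> C w \<bullet> b) (at 0)"
      proof (rule Lim_transform_within_open[OF _ S'(1,2)])
        show "((\<lambda>t. C (w + t *\<^sub>R \<i>) \<bullet> b) \<longlongrightarrow> C w \<bullet> b) (at 0)"
          by (intro tendsto_intros C_i)
        show "C (w + t *\<^sub>R \<i>) \<bullet> b = (B (w + t *\<^sub>R \<i>) \<bullet> b) / t" if "t \<in> S'" "t \<noteq> 0" for t
          unfolding BC[OF S'(3)[OF that(1)]] using w(2) that(2) by simp
      qed
      ultimately show "p \<bullet> b = C w \<bullet> b" by (rule tendsto_unique[rotated]) simp
    qed
  qed
  show "((\<lambda>t. \<phi> (of_real (Re w) + t *\<^sub>R 1)) has_vector_derivative p) (at 0)"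
  proof (rule has_vector_derivative_transform_within_open[OF _ S(1,2)])
    let ?J = "Quat 0 1 0 0"
    show "((\<lambda>t. A (w + t *\<^sub>R 1)) has_vector_derivative p) (at 0)" using A_line[of 1] by simp
    fix t assume t: "t \<in> S"
    have "\<phi> (slice_point (w + t *\<^sub>R 1) ?J) = A (w + t *\<^sub>R 1) + ?J * B (w + t *\<^sub>R 1)"
      by (rule phi[OF S(3)[OF t] quat_i_imag_unit])
    moreover have "B (w + t *\<^sub>R 1) = 0" unfolding BC[OF S(3)[OF t]] using w(2) by simp
    moreover have "slice_point (w + t *\<^sub>R 1) ?J = of_real (Re w) + t *\<^sub>R 1"
      using w(2) by (simp add: slice_point_def of_real_def algebra_simps)
    ultimately show "A (w + t *\<^sub>R 1) = \<phi> (of_real (Re w) + t *\<^sub>R 1)" by simp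
  qed
  assume J: "J \<in> imag_units"
  show "((\<lambda>t. \<phi> (of_real (Re w) + t *\<^sub>R J)) has_vector_derivative J * p) (at 0)"
  proof (rule has_vector_derivative_transform_within_open[OF _ S'(1,2)])
    show "((\<lambda>t. A (w + t *\<^sub>R \<i>) + J * B (w + t *\<^sub>R \<i>)) has_vector_derivative J * p) (at 0)"
      using has_vector_derivative_add[OF A_line[of \<i>] has_vector_derivative_mult_right[OF B_line[of \<i>], of J]] s by simp
    fix t assume t: "t \<in> S'"
    have "slice_point (w + t *\<^sub>R \<i>) J = of_real (Re w) + t *\<^sub>R J"
      using w(2) by (simp add: slice_point_def of_real_def)
    then show "A (w + t *\<^sub>R \<i>) + J * B (w + t *\<^sub>R \<i>) = \<phi> (of_real (Re w) + t *\<^sub>R J)"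
      using phi[OF S'(3)[OF t] J] by simp
  qed
qed

text \<open>
  The operator applied to a slice regular function is minus its spherical derivative. Off the
  real axis, \<open>J\<close> is a combination of \<open>i, j, k\<close>, so the terms along \<open>J\<close> add up to
  \<open>J * (s - J C + J p) = J s + C - p\<close>, the direction \<open>1\<close> contributes \<open>p - J s\<close>, and the terms
  \<open>u * (u * C)\<close> for \<open>u = i, j, k\<close> contribute \<open>-3 C\<close>; the total is \<open>-2 C\<close>. On the real axis it
  is \<open>p - 3 p\<close> with \<open>p = C\<close>.
\<close>

lemma directional_derivatives:
  assumes w: "w \<in> E" and J: "J \<in> imag_units"
  obtains d where
    "\<And>u. u \<in> Basis \<Longrightarrow> ((\<lambda>t. \<phi> (slice_point w J + t *\<^sub>R u)) has_vector_derivative d u) (at 0)"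
    "d 1 + Quat 0 1 0 0 * d (Quat 0 1 0 0) + Quat 0 0 1 0 * d (Quat 0 0 1 0) + Quat 0 0 0 1 * d (Quat 0 0 0 1)
      = - (2 *\<^sub>R C w)"
proof -
  let ?i = "Quat 0 1 0 0" and ?j = "Quat 0 0 1 0" and ?k = "Quat 0 0 0 1"
  have sq: "?i * (?i * x) = - x" "?j * (?j * x) = - x" "?k * (?k * x) = - x" for x
    using quat_i_imag_unit quat_j_imag_unit quat_k_imag_unit
    by (simp_all add: imag_unit_sq flip: mult.assoc)
  have ne: "?i \<noteq> 1" "?j \<noteq> 1" "?k \<noteq> 1" by (simp_all add: one_quat_def)
  obtain p s where AB: "(A has_derivative (\<lambda>d. Re d *\<^sub>R p + Im d *\<^sub>R s)) (at w)"
    "(B has_derivative (\<lambda>d. Im d *\<^sub>R p - Re d *\<^sub>R s)) (at w)"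
    by (rule cr_atE[OF cr[OF w]])
  show ?thesis
  proof (cases "Im w = 0")
    case True
    note R = derivatives_real[OF w True AB]
    have q: "slice_point w J = of_real (Re w)" using True by (simp add: slice_point_def)
    show ?thesis
    proof (rule that[of "\<lambda>u. if u = 1 then p else u * p"])
      fix u :: quat assume "u \<in> Basis"
      then show "((\<lambda>t. \<phi> (slice_point w J + t *\<^sub>R u)) has_vector_derivative (if u = 1 then p else u * p)) (at 0)"
        unfolding q Basis_quat_def
        using R(3) R(4)[OF quat_i_imag_unit] R(4)[OF quat_j_imag_unit] R(4)[OF quat_k_imag_unit] ne by auto
    qed (simp add: ne sq R(1) scaleR_2 flip: scaleR_minus_left)
  next
    case False
    define X where "X = s - J * C w + J * p"
    note N = derivative_nonreal[OF w False J AB refl, folded X_def]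
    have J_sum: "J = (J \<bullet> ?i) *\<^sub>R ?i + (J \<bullet> ?j) *\<^sub>R ?j + (J \<bullet> ?k) *\<^sub>R ?k"
      using J by (simp add: imag_units_iff inner_quat_def plus_quat_def scaleR_quat_def quat_eq_iff)
    have "J * X = (J \<bullet> ?i) *\<^sub>R (?i * X) + (J \<bullet> ?j) *\<^sub>R (?j * X) + (J \<bullet> ?k) *\<^sub>R (?k * X)"
      by (subst (1) J_sum) (simp add: distrib_right)
    moreover have "J * X = J * s + C w - p"
      using imag_unit_sq[OF J] by (simp add: X_def algebra_simps flip: mult.assoc)
    ultimately have sum: "(J \<bullet> ?i) *\<^sub>R (?i * X) + (J \<bullet> ?j) *\<^sub>R (?j * X) + (J \<bullet> ?k) *\<^sub>R (?k * X) = J * s + C w - p"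
      by simp
    have J1: "J \<bullet> 1 = 0" using J by (simp add: imag_units_iff inner_quat_def one_quat_def)
    have re: "quat_re 1 = 1" by (simp add: one_quat_def)
    show ?thesis
    proof (rule that[OF N])
      show "quat_re 1 *\<^sub>R (p - J * s) + (J \<bullet> 1) *\<^sub>R X + (1 - quat_re 1 *\<^sub>R 1) * C w +
        ?i * (quat_re ?i *\<^sub>R (p - J * s) + (J \<bullet> ?i) *\<^sub>R X + (?i - quat_re ?i *\<^sub>R 1) * C w) +
        ?j * (quat_re ?j *\<^sub>R (p - J * s) + (J \<bullet> ?j) *\<^sub>R X + (?j - quat_re ?j *\<^sub>R 1) * C w) +
        ?k * (quat_re ?k *\<^sub>R (p - J * s) + (J \<bullet> ?k) *\<^sub>R X + (?k - quat_re ?k *\<^sub>R 1) * C w) = - (2 *\<^sub>R C w)"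
        using sum by (simp add: J1 re distrib_left sq scaleR_2 algebra_simps)
    qed
  qed
qed

end

lemma vec_upd_plus_axis: "x + t *\<^sub>R axis h u = vec_upd x h (x $ h + t *\<^sub>R u)"
  by (simp add: vec_eq_iff vec_upd_nth axis_def)

lemma quat_dbar_slice_extension:
  assumes "slice_extension E A B C (\<lambda>q. g (vec_upd x h q))"
    and w: "w \<in> E" "J \<in> imag_units" "x $ h = slice_point w J"
  shows "has_partials h g x" "quat_dbar h g x = - C w"
proof -
  obtain d where d: "\<And>u. u \<in> Basis \<Longrightarrow>
      ((\<lambda>t. g (vec_upd x h (slice_point w J + t *\<^sub>R u))) has_vector_derivative d u) (at 0)"
    and sum: "d 1 + Quat 0 1 0 0 * d (Quat 0 1 0 0) + Quat 0 0 1 0 * d (Quat 0 0 1 0) + Quat 0 0 0 1 * d (Quat 0 0 0 1)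
      = - (2 *\<^sub>R C w)"
    using slice_extension.directional_derivatives[OF assms(1) w(1,2)] by metis
  have d': "((\<lambda>t. g (x + t *\<^sub>R axis h u)) has_vector_derivative d u) (at 0)" if "u \<in> Basis" for u
    using d[OF that] by (simp add: vec_upd_plus_axis w(3))
  show "has_partials h g x"
    using d' by (auto simp: has_partials_def Basis_quat_def dest: differentiableI_vector)
  have "dir_deriv g x (axis h u) = d u" if "u \<in> Basis" for u
    unfolding dir_deriv_def using d'[OF that] by (rule vector_derivative_at)
  then show "quat_dbar h g x = - C w"
    using sum by (simp add: quat_dbar_def Basis_quat_def)
qed

text \<open>
  Multiplying \<open>A + J B\<close> by \<open>x\<^sub>h\<close> turns \<open>C\<close> into \<open>Re C + A\<close>. This is the recursion in \<open>stem_step\<close>, so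
  each application of the operator is minus one step on the level of stem functions.
\<close>

lemma dbar_twist_step:
  fixes F :: "'n::{finite,linorder} stem"
  assumes D: "open D" "invariant_set D" and F: "regular_off D {..<h} F"
    and g: "\<And>x. x \<in> circularization D \<Longrightarrow> g x = \<epsilon> *\<^sub>R induced D F x" and x: "x \<in> circularization D"
  shows "has_partials h (twist K h g) x"
    and "quat_dbar h (twist K h g) x = - \<epsilon> *\<^sub>R induced D (stem_step (h \<in> K) h F) x"
proof -
  have cont: "continuous_on D F" and eo: "even_odd D F"
    using F by (simp_all add: regular_off_def stem_fun_iff)
  have compl: "- {..<h} = {h..}" by auto
  have supp: "F z $ L = 0" if "z \<in> D" "\<not> L \<subseteq> {h..}" for z L
    using F that unfolding regular_off_def compl by blast
  have crF: "cr_along h (\<lambda>z. F z $ L) (\<lambda>z. F z $ insert h L) z" if "z \<in> D" "L \<subseteq> {h<..}" for z L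
  proof -
    have "h \<notin> L" using that by auto
    then show ?thesis using F that by (simp add: regular_off_def)
  qed
  obtain z J where xz: "x = slice_vec z J" and z: "z \<in> D" and J: "\<And>h. J h \<in> imag_units"
    using x by (auto simp: circularization_def)
  define E where "E = {w. vec_upd z h w \<in> D}"
  define V where "V z = (\<Sum>L\<in>Pow {h<..}. ordered_prod L J * im_quotient h (\<lambda>z. F z $ insert h L) z)" for z
  define u where "u w = even_part h J F (vec_upd z h w)" for w
  define v where "v w = odd_part h J F (vec_upd z h w)" for w
  define c where "c w = V (vec_upd z h w)" for w
  define z0 where "z0 = vec_upd z h 0"
  have line: "vec_upd z h w = z0 + axis h w" for w
    unfolding z0_def by (rule vec_upd_line)
  have openE: "open E" unfolding E_def by (rule open_vec_upd[OF D(1)])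
  have cvu: "continuous_on E (\<lambda>w. vec_upd z h w)" unfolding line by (intro continuous_intros)
  have contV: "continuous_on D V"
    unfolding V_def using continuous_im_quotient_stem[OF D F]
    by (auto intro!: continuous_on_sum continuous_on_mult_left)
  have contc: "continuous_on E c"
    unfolding c_def by (rule continuous_on_compose2[OF contV cvu]) (auto simp: E_def)
  have contu: "continuous_on E u"
    unfolding u_def by (rule continuous_on_compose2[OF continuous_on_even_odd_part(1)[OF cont] cvu]) (auto simp: E_def)
  have cr: "cr_at u v w" if "w \<in> E" for w
    unfolding u_def v_def line
    by (rule cr_along_line, rule cr_along_even_odd_part, rule crF) (use that in \<open>simp_all add: E_def line\<close>)
  have vc: "v w = Im w *\<^sub>R c w" if "w \<in> E" for w
    unfolding v_def odd_part_def c_def V_def scaleR_sum_right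
  proof (rule sum.cong[OF refl])
    fix L assume "L \<in> Pow {h<..}"
    then have "F (vec_upd z h w) $ insert h L = Im (vec_upd z h w $ h) *\<^sub>R im_quotient h (\<lambda>z. F z $ insert h L) (vec_upd z h w)"
      using that by (intro stem_eq_Im_quotient[OF D F]) (auto simp: E_def)
    then show "ordered_prod L J * F (vec_upd z h w) $ insert h L =
        Im w *\<^sub>R (ordered_prod L J * im_quotient h (\<lambda>z. F z $ insert h L) (vec_upd z h w))"
      by (simp add: vec_upd_nth)
  qed
  have val: "twist K h g (vec_upd x h (slice_point w q)) =
      slice_point w q ^ (if h \<in> K then 1 else 0) * (\<epsilon> *\<^sub>R (u w + q * v w))"
    if "w \<in> E" "q \<in> imag_units" for w q
  proof -
    have "slice_vec (vec_upd z h w) (J(h := q)) \<in> circularization D"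
      using that J by (intro slice_vec_in_circularization) (auto simp: E_def)
    then have "g (vec_upd x h (slice_point w q)) = \<epsilon> *\<^sub>R (u w + q * v w)"
      unfolding xz vec_upd_slice_vec u_def v_def using that J
      by (subst g) (auto simp: E_def intro!: induced_slice[OF D(2) eo supp])
    then show ?thesis by (simp add: twist_def vec_upd_nth)
  qed
  have xh: "x $ h = slice_point (z $ h) (J h)" by (simp add: xz slice_vec_nth)
  have zE: "z $ h \<in> E" using z by (simp add: E_def)
  have step: "induced D (stem_step (h \<in> K) h F) x =
      (if h \<in> K then Re (z $ h) *\<^sub>R c (z $ h) + u (z $ h) else c (z $ h))"
  proof -
    have "even_odd D (stem_step (h \<in> K) h F)"
      using regular_off_stem_step[OF D F] by (simp add: regular_off_def stem_fun_iff)
    then have "induced D (stem_step (h \<in> K) h F) x = (\<Sum>L\<in>UNIV. ordered_prod L J * stem_step (h \<in> K) h F z $ L)"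
      unfolding xz using z J by (intro induced_eq[OF D(2)]) auto
    also have "\<dots> = (\<Sum>L\<in>Pow {h<..}. ordered_prod L J *
        (if h \<in> K then Re (z $ h) *\<^sub>R im_quotient h (\<lambda>z. F z $ insert h L) z + F z $ L
         else im_quotient h (\<lambda>z. F z $ insert h L) z))"
      by (rule sum.mono_neutral_cong_right) (auto simp: stem_step_def)
    also have "\<dots> = (if h \<in> K then Re (z $ h) *\<^sub>R c (z $ h) + u (z $ h) else c (z $ h))"
      by (simp add: c_def u_def V_def even_part_def distrib_left sum.distrib scaleR_sum_right)
    finally show ?thesis .
  qed
  define A where "A w = \<epsilon> *\<^sub>R (if h \<in> K then Re w *\<^sub>R u w - Im w *\<^sub>R v w else u w)" for w
  define B where "B w = \<epsilon> *\<^sub>R (if h \<in> K then Re w *\<^sub>R v w + Im w *\<^sub>R u w else v w)" for w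
  define C where "C w = \<epsilon> *\<^sub>R (if h \<in> K then Re w *\<^sub>R c w + u w else c w)" for w
  have "slice_extension E A B C (\<lambda>q. twist K h g (vec_upd x h q))"
  proof
    show "open E" by (rule openE)
    show "cr_at A B w" if "w \<in> E" for w
      unfolding A_def B_def using cr_at_mult_ident[OF cr[OF that]] cr[OF that]
      by (intro cr_at_scaleR) (cases "h \<in> K"; simp)
    show "B w = Im w *\<^sub>R C w" if "w \<in> E" for w
      by (simp add: B_def C_def vc[OF that] scaleR_add_right mult.left_commute mult.commute)
    show "continuous_on E C"
      unfolding C_def using contc contu by (cases "h \<in> K") (auto intro!: continuous_intros)
    show "twist K h g (vec_upd x h (slice_point w q)) = A w + q * B w" if "w \<in> E" "q \<in> imag_units" for w q
    proof (cases "h \<in> K")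
      case True
      have "slice_point w q * (u w + q * v w) = Re w *\<^sub>R u w + Re w *\<^sub>R (q * v w) + Im w *\<^sub>R (q * u w) + Im w *\<^sub>R (q * q * v w)"
        by (simp add: slice_point_scaleR algebra_simps)
      also have "\<dots> = (Re w *\<^sub>R u w - Im w *\<^sub>R v w) + q * (Re w *\<^sub>R v w + Im w *\<^sub>R u w)"
        unfolding imag_unit_sq[OF that(2)] by (simp add: algebra_simps)
      finally have *: "slice_point w q * (u w + q * v w) =
          (Re w *\<^sub>R u w - Im w *\<^sub>R v w) + q * (Re w *\<^sub>R v w + Im w *\<^sub>R u w)" .
      have "twist K h g (vec_upd x h (slice_point w q)) = \<epsilon> *\<^sub>R (slice_point w q * (u w + q * v w))"
        using True by (simp only: val[OF that] if_True power_one_right mult_scaleR_right)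
      also have "\<dots> = A w + q * B w"
        unfolding * A_def B_def using True by (simp only: if_True mult_scaleR_right scaleR_add_right distrib_left)
      finally show ?thesis .
    next
      case False
      then show ?thesis by (simp add: val[OF that] A_def B_def scaleR_add_right)
    qed
  qed
  from quat_dbar_slice_extension[OF this zE J xh]
  show "has_partials h (twist K h g) x"
    and "quat_dbar h (twist K h g) x = - \<epsilon> *\<^sub>R induced D (stem_step (h \<in> K) h F) x"
    by (simp_all add: step C_def)
qed

lemma iter_dbar_eq:
  fixes F :: "'n::{finite,linorder} stem"
  assumes D: "open D" "invariant_set D" and f: "induces D F f" and F: "regular_off D {} F"
  shows "l \<le> CARD('n) \<Longrightarrow> x \<in> circularization D \<Longrightarrow>
      iter_dbar K f l x = (-1) ^ l *\<^sub>R induced D (comp_stem K F l) x"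
    and "l < CARD('n) \<Longrightarrow> x \<in> circularization D \<Longrightarrow>
      has_partials (idx (Suc l)) (twist K (idx (Suc l)) (iter_dbar K f l)) x"
proof -
  have reg: "regular_off D {..<idx (Suc l)} (comp_stem K F l)" if "l < CARD('n)" for l
    using regular_off_comp_stem[OF D F, of l K] that seg_eq[OF that] by simp
  have iter: "iter_dbar K f l x = (-1) ^ l *\<^sub>R induced D (comp_stem K F l) x"
    if "l \<le> CARD('n)" "x \<in> circularization D" for l x
    using that
  proof (induction l arbitrary: x)
    case 0
    then show ?case using f by (simp add: induces_def)
  next
    case (Suc l)
    have "quat_dbar (idx (Suc l)) (twist K (idx (Suc l)) (iter_dbar K f l)) x =
        - ((-1) ^ l) *\<^sub>R induced D (stem_step (idx (Suc l) \<in> K) (idx (Suc l)) (comp_stem K F l)) x"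
      by (rule dbar_twist_step(2)[OF D reg]) (use Suc in auto)
    then show ?case by simp
  qed
  then show "l \<le> CARD('n) \<Longrightarrow> x \<in> circularization D \<Longrightarrow>
      iter_dbar K f l x = (-1) ^ l *\<^sub>R induced D (comp_stem K F l) x" .
  show "has_partials (idx (Suc l)) (twist K (idx (Suc l)) (iter_dbar K f l)) x"
    if "l < CARD('n)" "x \<in> circularization D"
    by (rule dbar_twist_step(1)[OF D reg[OF that(1)] _ that(2)]) (use iter that in auto)
qed

section \<open>Extension of the spherical components\<close>

lemma induced_comp_stem_off_real:
  fixes F :: "'n::{finite,linorder} stem"
  assumes D: "open D" "invariant_set D" and f: "induces D F f" and F: "regular_off D {} F"
    and m: "m < CARD('n)" and K: "K \<subseteq> seg m" and x: "x \<in> circularization (off_real D (seg m))"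
  shows "induced D (comp_stem K F m) x = spherical_comp D m K f x"
proof -
  obtain z J where xz: "x = slice_vec z J" and z: "z \<in> off_real D (seg m)" and J: "\<And>h. J h \<in> imag_units"
    using x by (auto simp: circularization_def)
  have zD: "z \<in> D" using z by (simp add: off_real_def)
  have eo: "even_odd D (comp_stem K F m)"
    using regular_off_comp_stem[OF D F, of m K] m by (simp add: regular_off_def stem_fun_iff)
  have eq: "comp_stem K F m z = stem_sder (seg m) (stem_prod (coord_stem K) F) z"
    using comp_stem_eq[of m z K F] m z K by (simp add: off_real_def Int_absorb2)
  show ?thesis
    unfolding xz spherical_comp_eq[OF D(2) f z J] induced_eq[OF D(2) eo zD J] eq ..
qed

lemma regular_extension_comp_stem:
  fixes F :: "'n::{finite,linorder} stem"
  assumes D: "open D" "invariant_set D" and f: "induces D F f" and F: "regular_off D {} F"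
    and m: "m < CARD('n)" and K: "K \<subseteq> seg m"
  shows "regular_extension D m K f (induced D (comp_stem K F m))"
proof -
  have "regular_off D {..<idx (m + 1)} (comp_stem K F m)"
    using regular_off_comp_stem[OF D F, of m K] m seg_eq[OF m] by simp
  then show ?thesis
    unfolding regular_extension_def
    using induced_in_slice_regular_wrt[OF D] induced_comp_stem_off_real[OF D f F m K] by blast
qed

text \<open>
  The points with nonreal coordinates are dense, and for fixed units a slice function depends
  continuously on \<open>z\<close>.
\<close>

lemma regular_extension_unique:
  fixes D :: "'n::{finite,linorder} cvec set"
  assumes D: "open D" "invariant_set D"
    and g: "regular_extension D m K f g" and g': "regular_extension D m K f g'" and x: "x \<in> circularization D"
  shows "g x = g' x"
proof -
  obtain G G' where G: "induces D G g" and G': "induces D G' g'"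
    using g g' unfolding regular_extension_def slice_regular_wrt_def slice_functions_def by blast
  obtain z J where xz: "x = slice_vec z J" and z: "z \<in> D" and J: "\<And>h. J h \<in> imag_units"
    using x by (auto simp: circularization_def)
  have cont: "continuous_on D (\<lambda>z. \<Sum>L\<in>UNIV. ordered_prod L J * G z $ L)" if "induces D G g" for G g
    using that by (auto simp: induces_def stem_fun_iff continuous_on_stem_iff intro!: continuous_on_sum continuous_on_mult_left)
  have "(\<Sum>L\<in>UNIV. ordered_prod L J * G z $ L) = (\<Sum>L\<in>UNIV. ordered_prod L J * G' z $ L)"
  proof (rule eq_on_off_real[OF D(1) cont[OF G] cont[OF G'] _ z])
    fix z assume z: "z \<in> off_real D (seg m)"
    then have zD: "z \<in> D" by (simp add: off_real_def)
    have "slice_vec z J \<in> circularization (off_real D (seg m))"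
      using z J by (rule slice_vec_in_circularization)
    then have "g (slice_vec z J) = g' (slice_vec z J)"
      using g g' by (simp add: regular_extension_def)
    then show "(\<Sum>L\<in>UNIV. ordered_prod L J * G z $ L) = (\<Sum>L\<in>UNIV. ordered_prod L J * G' z $ L)"
      unfolding induces_eq[OF G D(2) zD J] induces_eq[OF G' D(2) zD J] .
  qed
  then show ?thesis
    unfolding xz induces_eq[OF G D(2) z J] induces_eq[OF G' D(2) z J] .
qed

theorem proposition3p4:
  fixes D :: "'n::{finite,linorder} cvec set" and f :: "'n qvec \<Rightarrow> quat"
  assumes "open D" and "invariant_set D" and "f \<in> slice_functions D"
  shows "(f \<in> slice_regular D \<longleftrightarrow>
            (\<forall>m<CARD('n). \<forall>K. K \<subseteq> seg m \<longrightarrow> (\<exists>g. regular_extension D m K f g))) \<and>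
         (f \<in> slice_regular D \<longrightarrow>
            (\<forall>m<CARD('n). \<forall>K. K \<subseteq> seg m \<longrightarrow>
               (\<forall>l<m. \<forall>x\<in>circularization D.
                  has_partials (idx (Suc l)) (twist K (idx (Suc l)) (iter_dbar K f l)) x) \<and>
               (\<forall>g. regular_extension D m K f g \<longrightarrow>
                  (\<forall>x\<in>circularization D. g x = (-1) ^ m * iter_dbar K f m x))))"
proof -
  note D = assms(1,2)
  have regular: "\<exists>F. induces D F f \<and> regular_off D {} F" if "f \<in> slice_regular D"
    using that holomorphic_stem_imp_regular_off unfolding slice_regular_def by blast
  have ext: "\<exists>g. regular_extension D m K f g"
    if "f \<in> slice_regular D" "m < CARD('n)" "K \<subseteq> seg m" for m K
    using regular[OF that(1)] regular_extension_comp_stem[OF D _ _ that(2,3)] by blast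
  have "f \<in> slice_regular D"
    if ext: "\<forall>m<CARD('n). \<forall>K. K \<subseteq> seg m \<longrightarrow> (\<exists>g. regular_extension D m K f g)"
  proof -
    obtain F where F: "induces D F f" using assms(3) by (auto simp: slice_functions_def)
    have "cr_along h (\<lambda>z. F z $ L) (\<lambda>z. F z $ insert h L) z" if "h \<notin> L" "z \<in> D" for h L z
    proof -
      obtain m where m: "m < CARD('n)" "h = idx (Suc m)" using idx_surj by blast
      show ?thesis
        by (rule cr_along_of_spherical_comps[OF D F m _ that]) (use ext m in blast)
    qed
    then have "regular_off D {} F"
      using F by (simp add: regular_off_def induces_def)
    then show ?thesis
      using F regular_off_imp_holomorphic_stem[OF D(1)] unfolding slice_regular_def by blast
  qed
  moreover have "(\<forall>l<m. \<forall>x\<in>circularization D.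
        has_partials (idx (Suc l)) (twist K (idx (Suc l)) (iter_dbar K f l)) x) \<and>
      (\<forall>g. regular_extension D m K f g \<longrightarrow> (\<forall>x\<in>circularization D. g x = (-1) ^ m * iter_dbar K f m x))"
    if f: "f \<in> slice_regular D" and m: "m < CARD('n)" and K: "K \<subseteq> seg m" for m K
  proof -
    obtain F where F: "induces D F f" "regular_off D {} F" using regular[OF f] by blast
    note iter = iter_dbar_eq[OF D F]
    have "g x = (-1) ^ m * iter_dbar K f m x"
      if "regular_extension D m K f g" "x \<in> circularization D" for g x
    proof -
      have "g x = induced D (comp_stem K F m) x"
        using regular_extension_unique[OF D that(1) regular_extension_comp_stem[OF D F m K] that(2)] .
      also have "\<dots> = (-1) ^ m * iter_dbar K f m x"
        using iter(1)[of m x K] m that(2) by (cases "even m") simp_all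
      finally show ?thesis .
    qed
    then show ?thesis using iter(2) m by auto
  qed
  ultimately show ?thesis using ext by blast
qed

end
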